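(* Let $d\ge 2$ be a constant integer, let $c>1$ be a constant, and let $m = O(n)$. Let $\phi_d$ be the unique real number greater than $1$ satisfying $\phi_d^d = 1+\phi_d+\cdots+\phi_d^{d-1}$; then $\phi_d \in (1.61, 2)$. There is a choice of parameters of the hash family $\mathcal{H}$ described in the context (with its output range being a group of $n/d$ bins), sampled using $O(\log n\log\log n)$ random bits, such that for every set of $m$ balls in $U$, with probability at least $1-n^{-c}$ over $d$ independent samples $h^{(1)},\ldots,h^{(d)}$ from $\mathcal{H}$, the max-load of the Always-Go-Left scheme with choices $h^{(1)},\ldots,h^{(d)}$ is at most $\frac{\log\log n}{d\log \phi_d} + O\!\left(c+\frac{m}{n}\right)$ (the implied constant may depend on $d$; $n$ sufficiently large).
   Context: There are $n$ bins, $n$ a power of $2$; logarithms are base 2. $U$ is a universe of balls with $|U|=\mathrm{poly}(n)$, and $m\ge n$ balls from $U$ are inserted in an arbitrary fixed order. A distribution on functions $U\to[p]$ (viewed in $\mathbb{F}_p^U$) is a $k$-wise $\delta$-biased space if every nontrivial character $\chi_\alpha$ with support size at most $k$ satisfies $|\mathbb{E}[\chi_\alpha(x)]|\le\delta$. A family of functions is $k$-wise independent if its values at any $k$ distinct points are jointly uniform. Hash family $\mathcal{H}$ with parameters $\delta_1,\delta_2>0$ and integers $k,k_g$, mapping into a set of $N$ bins ($N$ a power of 2, here $N = n/d$): independently sample $h_i: U\to[n^{2^{-i}}]$ for $i\in[k]$ from $O(\log^2 n)$-wise $\delta_1$-biased spaces, a last function $h_{k+1}$ from an $O(\log^2 n)$-wise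 $\delta_2$-biased space whose range is chosen so that the concatenation of bit strings $h_1(x)\circ\cdots\circ h_{k+1}(x)$ lies in $[N]$ (here $h_{k+1}:U\to[\log^3 n/d]$ when $n^{2^{-k}}=\log^3 n$), and $g:U\to[N]$ from a $k_g$-wise independent family; set $h(x)=\big(h_1(x)\circ\cdots\circ h_{k+1}(x)\big)\oplus g(x)$, with $\oplus$ bitwise XOR. Always-Go-Left scheme with $d$ choices: the $n$ bins are partitioned into $d$ groups $G_1,\ldots,G_d$ of size $n/d$ each; $h^{(j)}$ maps $U$ into $G_j$. Each ball $x$ in turn is placed in the bin among $h^{(1)}(x)\in G_1,\ldots,h^{(d)}(x)\in G_d$ with the fewest balls; among ties, the bin with the smallest group index is chosen. The max-load is the maximum number of balls in any bin after all $m$ balls are placed. *)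

theory Defs
  imports "HOL-Probability.Probability"
begin

text \<open>
  Throughout, \<open>[p]\<close> is \<open>{..<p}\<close>. When \<open>p = 2 ^ b\<close>, an element of \<open>[p]\<close> is identified with the
  bit string of length \<open>b\<close> given by its binary expansion. Functions \<open>U \<rightarrow> [p]\<close> are elements of
  \<open>U \<rightarrow>\<^sub>E {..<p}\<close>, and a random such function is a \<open>pmf\<close> supported on that set.
\<close>

subsection \<open>Small-bias spaces and limited independence\<close>

text \<open>
  The field with \<open>p = 2 ^ b\<close> elements is, as an additive group, the group of bit strings of length
  \<open>b\<close> under XOR. The character of the \<open>U\<close>-th power of this group with index \<open>\<alpha>\<close> maps \<open>x\<close> to
  \<open>(-1)\<close> to the sum over \<open>u \<in> U\<close> of the inner products of the bit strings \<open>\<alpha> u\<close> and \<open>x u\<close>.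
  The usual trace labelling differs from this one by a bijective linear map applied to every
  coordinate of \<open>\<alpha>\<close>, so supports are the same in both labellings.
\<close>

definition character :: "'a set \<Rightarrow> ('a \<Rightarrow> nat) \<Rightarrow> ('a \<Rightarrow> nat) \<Rightarrow> real" where
  "character U \<alpha> x = (\<Prod>u\<in>U. (-1) ^ card {j. bit (\<alpha> u) j \<and> bit (x u) j})"

definition char_support :: "'a set \<Rightarrow> ('a \<Rightarrow> nat) \<Rightarrow> 'a set" where
  "char_support U \<alpha> = {u \<in> U. \<alpha> u \<noteq> 0}"

text \<open>\<open>w\<close>-wise \<open>\<delta>\<close>-biased spaces of functions \<open>U \<rightarrow> [2 ^ b]\<close>:\<close>

definition biased_space :: "'a set \<Rightarrow> nat \<Rightarrow> nat \<Rightarrow> real \<Rightarrow> ('a \<Rightarrow> nat) pmf \<Rightarrow> bool" where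
  "biased_space U b w \<delta> P \<longleftrightarrow>
     set_pmf P \<subseteq> (U \<rightarrow>\<^sub>E {..<2 ^ b}) \<and>
     (\<forall>\<alpha> \<in> U \<rightarrow>\<^sub>E {..<2 ^ b}.
        char_support U \<alpha> \<noteq> {} \<and> card (char_support U \<alpha>) \<le> w \<longrightarrow>
        \<bar>measure_pmf.expectation P (character U \<alpha>)\<bar> \<le> \<delta>)"

text \<open>Sets of fewer than \<open>k\<close> points are included so that the notion is not vacuous for
  \<open>k > card U\<close>; for \<open>k \<le> card U\<close> they add nothing.\<close>

definition kwise_independent :: "'a set \<Rightarrow> nat \<Rightarrow> nat \<Rightarrow> ('a \<Rightarrow> nat) pmf \<Rightarrow> bool" where
  "kwise_independent U N k P \<longleftrightarrow>
     set_pmf P \<subseteq> (U \<rightarrow>\<^sub>E {..<N}) \<and>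
     (\<forall>S. S \<subseteq> U \<and> card S \<le> k \<longrightarrow>
        map_pmf (\<lambda>f. restrict f S) P = pmf_of_set (S \<rightarrow>\<^sub>E {..<N}))"

definition sampled_with_bits :: "nat \<Rightarrow> 'b pmf \<Rightarrow> bool" where
  "sampled_with_bits s P \<longleftrightarrow>
     (\<exists>F. P = map_pmf F (pmf_of_set {bs :: bool list. length bs = s}))"

subsection \<open>The hash family\<close>

text \<open>The range \<open>n powr (2 powr (-i))\<close> of the \<open>i\<close>-th function is rounded down to a power of two,
  so that its elements are bit strings. The number of bits is:\<close>

definition level_bits :: "nat \<Rightarrow> nat \<Rightarrow> nat" where
  "level_bits n i = nat \<lfloor>log 2 (real n) / 2 ^ i\<rfloor>"

text \<open>The concatenation of \<open>f 1, \<dots>, f r\<close> (first string most significant), where \<open>f i\<close> is a bit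
  string of length \<open>b i\<close>:\<close>

primrec bit_concat :: "(nat \<Rightarrow> nat) \<Rightarrow> (nat \<Rightarrow> nat) \<Rightarrow> nat \<Rightarrow> nat" where
  "bit_concat b f 0 = 0"
| "bit_concat b f (Suc r) = push_bit (b (Suc r)) (bit_concat b f r) + f (Suc r)"

text \<open>
  \<open>hash_family U n N \<delta>1 \<delta>2 w k kg H\<close>: the random function \<open>H\<close> from \<open>U\<close> to \<open>[N]\<close> is the hash
  family with parameters \<open>\<delta>1\<close>, \<open>\<delta>2\<close>, \<open>k\<close>, \<open>kg\<close> built from some \<open>w\<close>-wise small-bias spaces
  \<open>P 1, \<dots>, P (k + 1)\<close> and some \<open>kg\<close>-wise independent family \<open>G\<close>. The bit length \<open>b (k + 1)\<close> of the
  last function is determined by the requirement that the concatenation has range exactly \<open>[N]\<close>.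
\<close>

definition hash_family ::
  "'a set \<Rightarrow> nat \<Rightarrow> nat \<Rightarrow> real \<Rightarrow> real \<Rightarrow> nat \<Rightarrow> nat \<Rightarrow> nat \<Rightarrow> ('a \<Rightarrow> nat) pmf \<Rightarrow> bool" where
  "hash_family U n N \<delta>1 \<delta>2 w k kg H \<longleftrightarrow>
     (\<exists>b P G.
        (\<forall>i\<in>{1..k}. b i = level_bits n i) \<and> 2 ^ (\<Sum>i\<in>{1..k + 1}. b i) = N \<and>
        (\<forall>i\<in>{1..k}. biased_space U (b i) w \<delta>1 (P i)) \<and>
        biased_space U (b (k + 1)) w \<delta>2 (P (k + 1)) \<and>
        kwise_independent U N kg G \<and>
        H = map_pmf
              (\<lambda>(hs, g). \<lambda>x\<in>U. semiring_bit_operations_class.xor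
                                 (bit_concat b (\<lambda>i. hs i x) (k + 1)) (g x))
              (pair_pmf (Pi_pmf {1..k + 1} (\<lambda>_. undefined) P) G))"

subsection \<open>The Always-Go-Left scheme\<close>

text \<open>The bins are the pairs \<open>(j, y)\<close> with \<open>j \<in> {1..d}\<close> and \<open>y < N\<close>; the group \<open>G\<^sub>j\<close> consists of
  those with first component \<open>j\<close>. An allocation is described by its load function.\<close>

definition agl_group :: "nat \<Rightarrow> (nat \<Rightarrow> 'a \<Rightarrow> nat) \<Rightarrow> (nat \<times> nat \<Rightarrow> nat) \<Rightarrow> 'a \<Rightarrow> nat" where
  "agl_group d h load x =
     (LEAST j. j \<in> {1..d} \<and> (\<forall>i\<in>{1..d}. load (j, h j x) \<le> load (i, h i x)))"

definition agl_step ::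
  "nat \<Rightarrow> (nat \<Rightarrow> 'a \<Rightarrow> nat) \<Rightarrow> 'a \<Rightarrow> (nat \<times> nat \<Rightarrow> nat) \<Rightarrow> (nat \<times> nat \<Rightarrow> nat)" where
  "agl_step d h x load =
     (let j = agl_group d h load x in load((j, h j x) := load (j, h j x) + 1))"

definition agl_loads :: "nat \<Rightarrow> (nat \<Rightarrow> 'a \<Rightarrow> nat) \<Rightarrow> 'a list \<Rightarrow> (nat \<times> nat \<Rightarrow> nat)" where
  "agl_loads d h xs = fold (agl_step d h) xs (\<lambda>_. 0)"

definition agl_max_load :: "nat \<Rightarrow> nat \<Rightarrow> (nat \<Rightarrow> 'a \<Rightarrow> nat) \<Rightarrow> 'a list \<Rightarrow> nat" where
  "agl_max_load d N h xs = Max (agl_loads d h xs ` ({1..d} \<times> {..<N}))"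

subsection \<open>The growth rate\<close>

definition is_phi :: "nat \<Rightarrow> real \<Rightarrow> bool" where
  "is_phi d \<phi> \<longleftrightarrow> \<phi> > 1 \<and> \<phi> ^ d = (\<Sum>i<d. \<phi> ^ i)"

definition phi :: "nat \<Rightarrow> real" where
  "phi d = (THE \<phi>. is_phi d \<phi>)"

end

theory Submission
  imports Defs "HOL-Library.Nat_Bijection" "HOL-Real_Asymp.Real_Asymp"
begin

text \<open>
  A ball that has height \<open>v\<close> in its bin of group \<open>j\<close> gets the index \<open>d * v + (j - 1)\<close>. By the
  Always-Go-Left rule a ball of index \<open>q\<close> sees in its \<open>d\<close> bins earlier balls of the indices
  \<open>q - 1, \<dots>, q - d\<close>, so that a high load unfolds into a witness tree whose number of leaves
  grows like the powers of \<open>\<phi>\<^sub>d\<close>. The unfolding can fail to be a tree only if two descending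
  paths meet. If this happens below each of \<open>K\<close> consecutive balls of one bin, then
  \<open>O(log log n)\<close> balls span at least \<open>K - 1\<close> more hash collisions than there are balls; such a
  set exists with probability at most \<open>n powr (-c) / 3\<close>, because \<open>g\<close> makes the hash function exactly
  \<open>O(log log n)\<close>-wise independent. Otherwise there is a witness tree on
  \<open>O(log n)\<close> distinct balls. The first \<open>k\<close> levels split the balls evenly into buckets of
  polylogarithmically many bins: high moments of the bucket sizes involve few points at a time and are
  therefore almost those of a uniform function. Given the buckets, the last level is so close
  to uniform on any \<open>O(log n)\<close> balls that a union bound over witness trees inside the buckets
  applies, where each of the \<open>(c + 3) log n\<close> leaves costs a factor \<open>1 / 2\<close>.
\<close>

section \<open>The growth rate\<close>

text \<open>No single component of the hash family can control a whole witness tree. Making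
  \<open>g\<close> independent on O(log n) points would cost about log^2 n bits, so its independence
  is spent on sets of O(log log n) balls only. A level with b output bits is pointwise close to
  uniform on s balls once its bias is below 2^(-b s); for s = O(log n) a seed of O(log n log log n)
  bits allows b = O(log log n), which only the last level satisfies. The upper levels are therefore
  used through bucket sizes alone. Buckets depend on the first \<open>k\<close> levels and on
  \<open>g\<close>, and the last function is independent of all of these, so conditioning on them
  leaves it fresh for the union bound. The index orders the pairs (height, group) lexicographically.
  Breaking ties to the left makes the bins seen by a ball account for exactly the d preceding
  indices, and this yields the d-step Fibonacci recursion behind \<open>phi d\<close>. The expansion
  stops at a height of order m / n, where the factorial of \<open>b\<close> outweighs the average
  load; together with \<open>K\<close> = O(c) surplus collisions this gives the term O(c + m /
  n).\<close>

lemma is_phi_iff: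
  "is_phi d \<phi> \<longleftrightarrow> \<phi> > 1 \<and> (\<Sum>i=1..d. (1 / \<phi>) ^ i) = 1"
proof -
  have "(\<phi> ^ d = (\<Sum>i<d. \<phi> ^ i)) \<longleftrightarrow> (\<Sum>i=1..d. (1 / \<phi>) ^ i) = 1" if "\<phi> > 1"
  proof -
    have "(\<Sum>i=1..d. (1 / \<phi>) ^ i) * \<phi> ^ d = (\<Sum>i=1..d. \<phi> ^ (d - i))"
      using that by (auto simp: sum_distrib_right power_diff power_one_over intro!: sum.cong)
    also have "\<dots> = (\<Sum>i<d. \<phi> ^ i)"
      by (rule sum.reindex_bij_witness[of _ "\<lambda>i. d - i" "\<lambda>i. d - i"]) auto
    finally have "(\<Sum>i<d. \<phi> ^ i) = (\<Sum>i=1..d. (1 / \<phi>) ^ i) * \<phi> ^ d" by simp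
    then show ?thesis using that by auto
  qed
  then show ?thesis unfolding is_phi_def by auto
qed

text \<open>In the form of \<open>is_phi_iff\<close> the equation says that a strictly decreasing
  continuous function takes the value 1, which gives uniqueness and, by the intermediate value
  theorem, existence. The lower end 161 / 100 lies just below the golden ratio, so the first two
  terms already exceed 1 there; at 2 the sum is 1 - 2^(-d).\<close>

lemma phi_bounds:
  assumes "d \<ge> 2"
  shows "\<exists>!\<phi>. is_phi d \<phi>" and "is_phi d (phi d)" and "161 / 100 < phi d" and "phi d < 2"
proof -
  define f :: "real \<Rightarrow> real" where "f = (\<lambda>x. \<Sum>i=1..d. (1 / x) ^ i)"
  have anti: "f y < f x" if "1 < x" "x < y" for x y
    unfolding f_def
  proof (rule sum_strict_mono)
    show "(1 / y) ^ i < (1 / x) ^ i" if "i \<in> {1..d}" for i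
      using that \<open>1 < x\<close> \<open>x < y\<close> by (intro power_strict_mono) (auto simp: field_simps)
  qed (use assms in auto)
  have f2: "f 2 < 1"
  proof -
    have "f 2 = 1 - (1 / 2) ^ d"
      unfolding f_def by (induction d) auto
    then show ?thesis by simp
  qed
  have f161: "f (161 / 100) > 1"
  proof -
    have "(1::real) < (\<Sum>i\<in>{1, 2}. (100 / 161) ^ i)" by (simp add: power2_eq_square)
    also have "\<dots> \<le> f (161 / 100)"
      unfolding f_def using assms by (intro order.trans[OF _ sum_mono2[of "{1..d}" "{1, 2}"]]) auto
    finally show ?thesis .
  qed
  have "continuous_on {161 / 100..2} f"
    unfolding f_def by (intro continuous_intros) auto
  then obtain x where x: "161 / 100 \<le> x" "x \<le> 2" "f x = 1"
    using IVT2'[of f 2 1 "161 / 100"] f2 f161 by auto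
  have ph: "is_phi d y \<longleftrightarrow> y > 1 \<and> f y = 1" for y
    by (simp add: is_phi_iff f_def)
  have uniq: "y = x" if "is_phi d y" for y
  proof (rule ccontr)
    assume "y \<noteq> x"
    then consider "x < y" | "y < x" by linarith
    then show False
    proof cases
      case 1
      then show False using anti[of x y] that x(1,3) unfolding ph by linarith
    next
      case 2
      then show False using anti[of y x] that x(1,3) unfolding ph by linarith
    qed
  qed
  have isx: "is_phi d x" using x ph by auto
  show "\<exists>!\<phi>. is_phi d \<phi>" using isx uniq by blast
  have "phi d = x" unfolding phi_def by (rule the_equality[of "is_phi d", OF isx uniq])
  moreover have "x \<noteq> 161 / 100" "x \<noteq> 2" using x(3) f2 f161 by (metis less_irrefl)+
  ultimately show "is_phi d (phi d)" "161 / 100 < phi d" "phi d < 2"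
    using isx x(1,2) by simp_all
qed

text \<open>Nodes of index at least \<open>q0\<close> are expanded; the case \<open>q = 0\<close> only serves termination.\<close>

function tree_leaves :: "nat \<Rightarrow> nat \<Rightarrow> nat \<Rightarrow> nat" where
  "tree_leaves d q0 q = (if q < q0 \<or> q = 0 then 1 else \<Sum>i=1..d. tree_leaves d q0 (q - i))"
  by auto
termination by (relation "Wellfounded.measure (\<lambda>(d, q0, q). q)") auto

declare tree_leaves.simps [simp del]

lemma tree_leaves_rec:
  "q < q0 \<Longrightarrow> tree_leaves d q0 q = 1"
  "q0 \<le> q \<Longrightarrow> q \<noteq> 0 \<Longrightarrow> tree_leaves d q0 q = (\<Sum>i=1..d. tree_leaves d q0 (q - i))"
  by (subst tree_leaves.simps; simp)+

text \<open>Powers of \<open>phi d\<close> solve the recursion exactly because the powers of 1 /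
  \<open>phi d\<close> sum to 1, so only the leaves decide the offset. A leaf has an index below
  \<open>q0\<close>, where the exponent is at most 0; \<open>d \<le> q0\<close> keeps the natural
  subtraction exact.\<close>

lemma tree_leaves_ge:
  assumes "d \<ge> 2" "d \<le> q0" "q0 \<le> q + d"
  shows "phi d powr (real q - real q0) \<le> real (tree_leaves d q0 q)"
  using assms(3)
proof (induction q rule: less_induct)
  case (less q)
  note ph = phi_bounds[OF assms(1)]
  have pos: "phi d > 1" using ph(3) by simp
  show ?case
  proof (cases "q < q0 \<or> q = 0")
    case True
    then have "real q - real q0 \<le> 0" using assms by auto
    then have "phi d powr (real q - real q0) \<le> phi d powr 0"
      using pos by (intro powr_mono) auto
    then show ?thesis using True pos by (simp add: tree_leaves.simps)
  next
    case False
    have "phi d powr (real q - real q0) = phi d powr (real q - real q0) * (\<Sum>i=1..d. (1 / phi d) ^ i)"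
      using ph(2) unfolding is_phi_iff by simp
    also have "\<dots> = (\<Sum>i=1..d. phi d powr (real (q - i) - real q0))"
      unfolding sum_distrib_left
    proof (rule sum.cong)
      fix i assume "i \<in> {1..d}"
      then have "real (q - i) = real q - real i" using False assms by auto
      then show "phi d powr (real q - real q0) * (1 / phi d) ^ i = phi d powr (real (q - i) - real q0)"
        using pos by (simp add: powr_diff power_one_over powr_realpow)
    qed auto
    also have "\<dots> \<le> (\<Sum>i=1..d. real (tree_leaves d q0 (q - i)))"
      by (intro sum_mono less.IH) (use False less.prems in auto)
    finally show ?thesis using False by (simp add: tree_leaves.simps[of d q0 q])
  qed
qed

text \<open>The same solution shifted by \<open>d\<close>: leaf indices are at least
  \<open>q0\<close> - \<open>d\<close>, so the exponent is nonnegative there. The upper bound limits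
  the number of balls in a tree and through it the bias and the seed length of the last
  level.\<close>

lemma tree_leaves_le:
  assumes "d \<ge> 2" "d \<le> q0" "q0 \<le> q + d"
  shows "real (tree_leaves d q0 q) \<le> phi d powr (real q - real q0 + real d)"
  using assms(3)
proof (induction q rule: less_induct)
  case (less q)
  note ph = phi_bounds[OF assms(1)]
  have pos: "phi d > 1" using ph(3) by simp
  show ?case
  proof (cases "q < q0 \<or> q = 0")
    case True
    have "phi d powr 0 \<le> phi d powr (real q - real q0 + real d)"
      using pos less.prems by (intro powr_mono) auto
    then show ?thesis using True pos by (simp add: tree_leaves.simps)
  next
    case False
    have "real (tree_leaves d q0 q) = (\<Sum>i=1..d. real (tree_leaves d q0 (q - i)))"
      using False by (simp add: tree_leaves.simps[of d q0 q])
    also have "\<dots> \<le> (\<Sum>i=1..d. phi d powr (real (q - i) - real q0 + real d))"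
      by (intro sum_mono less.IH) (use False less.prems in auto)
    also have "\<dots> = phi d powr (real q - real q0 + real d) * (\<Sum>i=1..d. (1 / phi d) ^ i)"
      unfolding sum_distrib_left
    proof (rule sum.cong)
      fix i assume "i \<in> {1..d}"
      then have "real (q - i) = real q - real i" using False assms by auto
      then have e: "real (q - i) - real q0 + real d = (real q - real q0 + real d) - real i" by simp
      show "phi d powr (real (q - i) - real q0 + real d) = phi d powr (real q - real q0 + real d) * (1 / phi d) ^ i"
        using pos unfolding e by (subst powr_diff) (simp add: power_one_over powr_realpow)
    qed auto
    also have "\<dots> = phi d powr (real q - real q0 + real d)"
      using ph(2) unfolding is_phi_iff by simp
    finally show ?thesis .
  qed
qed

section \<open>The Always-Go-Left process\<close>

text \<open>The strict inequality of the third part is where breaking ties to the left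
  enters.\<close>

lemma agl_group:
  fixes h :: "nat \<Rightarrow> 'a \<Rightarrow> nat" and load :: "nat \<times> nat \<Rightarrow> nat" and x :: 'a
  assumes "d \<ge> 1"
  defines "g \<equiv> agl_group d h load x"
  shows "g \<in> {1..d}"
    and "i \<in> {1..d} \<Longrightarrow> load (g, h g x) \<le> load (i, h i x)"
    and "i \<in> {1..d} \<Longrightarrow> i < g \<Longrightarrow> load (g, h g x) < load (i, h i x)"
proof -
  let ?P = "\<lambda>j. j \<in> {1..d} \<and> (\<forall>i\<in>{1..d}. load (j, h j x) \<le> load (i, h i x))"
  let ?f = "\<lambda>j. load (j, h j x)"
  have "finite {1..d}" "{1..d} \<noteq> {}" using assms by auto
  then have "\<exists>j. ?P j" using arg_min_if_finite[of "{1..d}" ?f]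
    by (metis leI)
  then have P: "?P g" unfolding g_def agl_group_def by (rule LeastI_ex)
  have L: "g \<le> i" if "?P i" for i
    unfolding g_def agl_group_def by (rule Least_le) (rule that)
  show "g \<in> {1..d}" using P by simp
  show le: "load (g, h g x) \<le> load (i, h i x)" if "i \<in> {1..d}" for i using P that by auto
  show "load (g, h g x) < load (i, h i x)" if "i \<in> {1..d}" "i < g"
  proof (rule ccontr)
    assume "\<not> ?thesis"
    then have "load (i, h i x) = load (g, h g x)" using le[OF that(1)] by simp
    then have "?P i" using P that by simp
    then show False using L that by fastforce
  qed
qed

context
  fixes d :: nat and h :: "nat \<Rightarrow> 'a \<Rightarrow> nat" and xs :: "'a list"
begin

definition load_at :: "nat \<Rightarrow> nat \<times> nat \<Rightarrow> nat" where
  "load_at t = agl_loads d h (take t xs)"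

definition group_of :: "nat \<Rightarrow> nat" where
  "group_of t = agl_group d h (load_at t) (xs ! t)"

definition bin_of :: "nat \<Rightarrow> nat \<times> nat" where
  "bin_of t = (group_of t, h (group_of t) (xs ! t))"

text \<open>Heights start at 1, so every ball has index at least \<open>d\<close>, and the index
  modulo \<open>d\<close> plus 1 recovers the group.\<close>

definition agl_index :: "nat \<Rightarrow> nat" where
  "agl_index t = d * (load_at t (bin_of t) + 1) + (group_of t - 1)"

lemma load_at_Suc:
  assumes "t < length xs"
  shows "load_at (Suc t) = (load_at t)(bin_of t := load_at t (bin_of t) + 1)"
  using assms unfolding load_at_def bin_of_def group_of_def
  by (simp add: agl_loads_def take_Suc_conv_app_nth agl_step_def Let_def)

lemma load_at_ball:
  assumes "t \<le> length xs" "1 \<le> v" "v \<le> load_at t y"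
  shows "\<exists>t'<t. bin_of t' = y \<and> load_at t' y + 1 = v"
  using assms
proof (induction t)
  case 0
  then show ?case by (simp add: load_at_def agl_loads_def)
next
  case (Suc t)
  show ?case
  proof (cases "v \<le> load_at t y")
    case True
    then show ?thesis using Suc by (meson Suc_leD less_Suc_eq)
  next
    case False
    then have "bin_of t = y" "load_at t y + 1 = v"
      using Suc.prems load_at_Suc[of t] by (auto split: if_splits)
    then show ?thesis by auto
  qed
qed

text \<open>For a ball of height l + 1 in group g, the \<open>d\<close> preceding indices belong to
  height l + 1 in the groups left of g and to height l in all other groups. Minimality of the load
  provides l balls in the latter bins, strictness to the left provides l + 1 in the former. The
  condition on \<open>d + i\<close> excludes height 0.\<close>

lemma agl_index_child:
  assumes "d \<ge> 1" "t < length xs" "i \<in> {1..d}" "agl_index t \<ge> d + i"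
  shows "\<exists>t'<t. agl_index t' = agl_index t - i \<and>
    h (agl_index t' mod d + 1) (xs ! t') = h (agl_index t' mod d + 1) (xs ! t)"
proof -
  note g = agl_group[where h = h and load = "load_at t" and x = "xs ! t", OF assms(1), folded group_of_def]
  define q where "q = agl_index t - i"
  define v where "v = q div d"
  define j where "j = q mod d + 1"
  have q: "q = d * v + (j - 1)" unfolding v_def j_def by simp
  have j: "j \<in> {1..d}" using assms(1) unfolding j_def by (auto simp: Suc_le_eq)
  have v: "v \<ge> 1" unfolding v_def q_def using assms by (simp add: Suc_le_eq div_greater_zero_iff)
  define l where "l = load_at t (bin_of t)"
  have eq: "q + i = d * (l + 1) + (group_of t - 1)"
    unfolding q_def l_def using assms by (simp add: agl_index_def)
  have "v \<le> load_at t (j, h j (xs ! t))"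
  proof (cases "j < group_of t")
    case True
    have "d * v < d * (l + 2)" using eq q assms(3) g(1) by auto
    then have "v < l + 2" by (metis mult_less_cancel1)
    then show ?thesis using g(3)[OF j True] by (simp add: l_def bin_of_def)
  next
    case False
    have "q < d * (l + 1) + (group_of t - 1)" using eq assms(3) by auto
    then have "d * v < d * (l + 1)" using q False by linarith
    then have "v \<le> l" by (metis Suc_eq_plus1 less_Suc_eq_le mult_less_cancel1)
    then show ?thesis using g(2)[OF j] by (simp add: l_def bin_of_def)
  qed
  from load_at_ball[OF _ v this] assms(2) obtain t' where t': "t' < t"
    "bin_of t' = (j, h j (xs ! t))" "load_at t' (j, h j (xs ! t)) + 1 = v" by auto
  then have "group_of t' = j" "h j (xs ! t') = h j (xs ! t)" unfolding bin_of_def by auto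
  moreover have "agl_index t' = q" using t' q \<open>group_of t' = j\<close> unfolding agl_index_def by auto
  ultimately show ?thesis using t'(1) unfolding q_def[symmetric] j_def by auto
qed

lemma agl_max_load_index:
  assumes "d \<ge> 1" "N \<ge> 1" "v \<ge> 1" "v \<le> agl_max_load d N h xs"
  shows "\<exists>t<length xs. agl_index t \<ge> d * v"
proof -
  have "agl_max_load d N h xs \<in> agl_loads d h xs ` ({1..d} \<times> {..<N})"
    unfolding agl_max_load_def by (rule Max_in) (use assms in \<open>auto simp: lessThan_empty_iff\<close>)
  then obtain y where "v \<le> load_at (length xs) y"
    using assms(4) unfolding load_at_def by auto
  from load_at_ball[OF _ assms(3) this] obtain t where "t < length xs" "bin_of t = y"
    "load_at t y + 1 = v" by auto
  then show ?thesis unfolding agl_index_def by (intro exI[of _ t]) auto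
qed

end

section \<open>Witness trees\<close>

text \<open>An element \<open>(y, j, x)\<close> of a witness tree says that the ball \<open>y\<close> is a child of the ball \<open>x\<close>
  in their common bin of group \<open>j\<close>, where \<open>Y j x\<close> are the admissible children. A node of index
  below \<open>q0\<close> is a leaf; it carries \<open>b\<close> further balls of its bin, in no particular order, which
  gains the factor \<open>fact b\<close> in the number of trees.\<close>

inductive witness_tree :: "nat \<Rightarrow> nat \<Rightarrow> nat \<Rightarrow> (nat \<Rightarrow> nat \<Rightarrow> nat set) \<Rightarrow> nat \<Rightarrow> nat \<Rightarrow> (nat \<times> nat \<times> nat) set \<Rightarrow> bool"
  for d q0 b :: nat and Y :: "nat \<Rightarrow> nat \<Rightarrow> nat set" where
  leaf: "q < q0 \<Longrightarrow> Z \<subseteq> Y (q mod d + 1) t \<Longrightarrow> card Z = b \<Longrightarrow>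
    witness_tree d q0 b Y q t ((\<lambda>z. (z, q mod d + 1, t)) ` Z)"
| node: "q0 \<le> q \<Longrightarrow> (\<And>i. i \<in> {1..d} \<Longrightarrow> s i \<in> Y ((q - i) mod d + 1) t) \<Longrightarrow>
    (\<And>i. i \<in> {1..d} \<Longrightarrow> witness_tree d q0 b Y (q - i) (s i) (F i)) \<Longrightarrow>
    witness_tree d q0 b Y q t (\<Union>i\<in>{1..d}. insert (s i, (q - i) mod d + 1, t) (F i))"

lemma witness_tree_edge:
  assumes "witness_tree d q0 b Y q t E" "d \<ge> 1" "(y, j, x) \<in> E"
  shows "y \<in> Y j x \<and> j \<in> {1..d}"
  using assms by (induction) (auto simp: Suc_le_eq)

text \<open>This replaces the bins, which depend on the random functions, by larger sets known in
  advance, so that the trees can be counted before the last function is drawn. Children are earlier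
  balls, hence only balls up to the root matter.\<close>

lemma witness_tree_mono:
  assumes "witness_tree d q0 b Y q t E" "\<And>j x. x \<le> t \<Longrightarrow> j \<in> {1..d} \<Longrightarrow> Y j x \<subseteq> Y' j x"
    and "\<And>j x. Y j x \<subseteq> {..<x}" and "d \<ge> 1"
  shows "witness_tree d q0 b Y' q t E"
  using assms
proof induction
  case (leaf q Z t)
  then have "Y (q mod d + 1) t \<subseteq> Y' (q mod d + 1) t" by (auto simp: Suc_le_eq)
  then show ?case using leaf by (intro witness_tree.leaf) auto
next
  case (node q s t F)
  have j: "(q - i) mod d + 1 \<in> {1..d}" for i using node.prems by (auto simp: Suc_le_eq)
  have less: "s i < t" if "i \<in> {1..d}" for i using node.hyps(2)[OF that] node.prems(2) by blast
  show ?case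
  proof (rule witness_tree.node)
    show "s i \<in> Y' ((q - i) mod d + 1) t" if "i \<in> {1..d}" for i
      using node.hyps(2)[OF that] node.prems(1)[OF order.refl j] by blast
    show "witness_tree d q0 b Y' (q - i) (s i) (F i)" if "i \<in> {1..d}" for i
    proof (rule node.IH[OF that])
      show "Y j x \<subseteq> Y' j x" if "x \<le> s i" "j \<in> {1..d}" for j x
        using node.prems(1)[of x j] that less[OF \<open>i \<in> {1..d}\<close>] by simp
    qed (use node.prems in auto)
  qed (use node in auto)
qed

function tree_edges :: "nat \<Rightarrow> nat \<Rightarrow> nat \<Rightarrow> nat \<Rightarrow> nat" where
  "tree_edges d q0 b q = (if q < q0 \<or> q = 0 then b else \<Sum>i=1..d. 1 + tree_edges d q0 b (q - i))"
  by auto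
termination by (relation "Wellfounded.measure (\<lambda>(d, q0, b, q). q)") auto

declare tree_edges.simps [simp del]

lemma tree_edges_rec:
  "q < q0 \<Longrightarrow> tree_edges d q0 b q = b"
  "q0 \<le> q \<Longrightarrow> q \<noteq> 0 \<Longrightarrow> tree_edges d q0 b q = (\<Sum>i=1..d. 1 + tree_edges d q0 b (q - i))"
  by (subst tree_edges.simps; simp)+

text \<open>The summand 2 closes the induction: an inner node adds \<open>d\<close> edges, and d + 2
  is at most the sum of 2 over its \<open>d\<close> children.\<close>

lemma tree_edges_le:
  assumes "d \<ge> 2" "d \<le> q0" "q0 \<le> q + d"
  shows "tree_edges d q0 b q + 2 \<le> (b + 2) * tree_leaves d q0 q"
  using assms(3)
proof (induction q rule: less_induct)
  case (less q)
  show ?case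
  proof (cases "q < q0")
    case True
    then show ?thesis by (simp add: tree_leaves_rec tree_edges_rec)
  next
    case False
    then have q: "q0 \<le> q" "q \<noteq> 0" using assms by auto
    have "tree_edges d q0 b q + 2 = (\<Sum>i=1..d. 1 + tree_edges d q0 b (q - i)) + 2"
      using q by (simp add: tree_edges_rec)
    also have "\<dots> \<le> (\<Sum>i=1..d. tree_edges d q0 b (q - i) + 2)"
      using assms(1) unfolding sum.distrib by simp
    also have "\<dots> \<le> (\<Sum>i=1..d. (b + 2) * tree_leaves d q0 (q - i))"
      by (intro sum_mono less.IH) (use q less.prems in auto)
    also have "\<dots> = (b + 2) * tree_leaves d q0 q"
      using q by (simp add: tree_leaves_rec sum_distrib_left)
    finally show ?thesis .
  qed
qed

text \<open>The division by \<rho>^2 is the slack that makes the induction work. A leaf has weight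
  \<rho>^b / b!, which is at most 1 / (2 \<rho>^2). At an inner node each child brings a factor
  \<rho> for its choice in the bucket, so 1 / \<rho> per child remains, and at least two children
  restore \<rho>^(-2). Thus the leaves pay for the factors \<rho> of all edges above them.\<close>

lemma witness_tree_card:
  fixes \<rho> R :: real
  assumes d: "d \<ge> 2" "d \<le> q0" and Y: "\<And>j t. finite (Y j t)" "\<And>j t. real (card (Y j t)) \<le> \<rho> * R"
    and \<rho>: "\<rho> \<ge> 1" "\<rho> ^ (b + 2) / fact b \<le> 1 / 2" and R: "R > 0" and "q0 \<le> q + d"
  shows "finite {E. witness_tree d q0 b Y q t E} \<and>
    real (card {E. witness_tree d q0 b Y q t E}) \<le> R ^ tree_edges d q0 b q * (1 / 2) ^ tree_leaves d q0 q / \<rho>\<^sup>2"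
  using \<open>q0 \<le> q + d\<close>
proof (induction q arbitrary: t rule: less_induct)
  case (less q)
  show ?case
  proof (cases "q < q0")
    case True
    let ?j = "q mod d + 1"
    let ?S = "{Z. Z \<subseteq> Y ?j t \<and> card Z = b}"
    have sub: "{E. witness_tree d q0 b Y q t E} \<subseteq> (\<lambda>Z. (\<lambda>z. (z, ?j, t)) ` Z) ` ?S"
      using True by (auto elim!: witness_tree.cases)
    have fin: "finite ?S" using Y(1) by simp
    have "card {E. witness_tree d q0 b Y q t E} \<le> card ?S"
      using card_mono[OF finite_imageI[OF fin] sub] card_image_le[OF fin] le_trans by blast
    also have "card ?S = card (Y ?j t) choose b" using Y(1) by (rule n_subsets)
    finally have "real (card {E. witness_tree d q0 b Y q t E}) \<le> real (card (Y ?j t) choose b)" by simp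
    also have "\<dots> \<le> real (card (Y ?j t)) ^ b / fact b"
    proof -
      have "real ((card (Y ?j t) choose b) * fact b) \<le> real (card (Y ?j t) ^ b)"
        by (rule of_nat_mono[OF binomial_fact_pow])
      then show ?thesis by (simp add: field_simps)
    qed
    also have "\<dots> \<le> (\<rho> * R) ^ b / fact b"
      using Y(2) by (intro divide_right_mono power_mono) auto
    also have "\<dots> = R ^ b * (\<rho> ^ (b + 2) / fact b) / \<rho>\<^sup>2"
      using \<rho>(1) by (simp add: power_mult_distrib power_add power2_eq_square)
    also have "\<dots> \<le> R ^ b * (1 / 2) / \<rho>\<^sup>2"
      using \<rho> R by (intro divide_right_mono mult_left_mono) auto
    finally show ?thesis
      using True finite_subset[OF sub finite_imageI[OF fin]] by (simp add: tree_edges_rec tree_leaves_rec)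
  next
    case False
    then have q: "q0 \<le> q" "q \<noteq> 0" using d by auto
    let ?T = "\<lambda>i. SIGMA s : Y ((q - i) mod d + 1) t. {E. witness_tree d q0 b Y (q - i) s E}"
    let ?P = "PiE {1..d} ?T"
    let ?c = "\<lambda>i. R ^ tree_edges d q0 b (q - i) * (1 / 2) ^ tree_leaves d q0 (q - i) / \<rho>\<^sup>2"
    have IH: "finite {E. witness_tree d q0 b Y (q - i) s E}"
      "real (card {E. witness_tree d q0 b Y (q - i) s E}) \<le> ?c i" if "i \<in> {1..d}" for i s
      using less.IH[of "q - i" s] that q less.prems by auto
    have finT: "finite (?T i)" if "i \<in> {1..d}" for i
      using IH(1)[OF that] Y(1) by auto
    have cT: "real (card (?T i)) \<le> R ^ (1 + tree_edges d q0 b (q - i)) * (1 / 2) ^ tree_leaves d q0 (q - i) / \<rho>"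
      if "i \<in> {1..d}" for i
    proof -
      have "real (card (?T i)) = (\<Sum>s\<in>Y ((q - i) mod d + 1) t. real (card {E. witness_tree d q0 b Y (q - i) s E}))"
        using Y(1) IH(1)[OF that] by (subst card_SigmaI) auto
      also have "\<dots> \<le> real (card (Y ((q - i) mod d + 1) t)) * ?c i"
        using IH(2)[OF that] by (intro sum_bounded_above) auto
      also have "\<dots> \<le> (\<rho> * R) * ?c i"
        using Y(2) R by (intro mult_right_mono) auto
      also have "\<dots> = R ^ (1 + tree_edges d q0 b (q - i)) * (1 / 2) ^ tree_leaves d q0 (q - i) / \<rho>"
        using \<rho> by (simp add: power2_eq_square)
      finally show ?thesis .
    qed
    have sub: "{E. witness_tree d q0 b Y q t E} \<subseteq>
      (\<lambda>f. \<Union>i\<in>{1..d}. insert (fst (f i), (q - i) mod d + 1, t) (snd (f i))) ` ?P"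
    proof
      fix E assume "E \<in> {E. witness_tree d q0 b Y q t E}"
      then have "witness_tree d q0 b Y q t E" by simp
      then show "E \<in> (\<lambda>f. \<Union>i\<in>{1..d}. insert (fst (f i), (q - i) mod d + 1, t) (snd (f i))) ` ?P"
      proof cases
        case (node s F)
        show ?thesis
          by (rule image_eqI[of _ _ "\<lambda>i\<in>{1..d}. (s i, F i)"]) (use node in auto)
      qed (use q in auto)
    qed
    have finP: "finite ?P" using finT by (intro finite_PiE) auto
    have "real (card {E. witness_tree d q0 b Y q t E}) \<le> real (card ?P)"
      using card_mono[OF finite_imageI[OF finP] sub] card_image_le[OF finP] le_trans of_nat_mono by blast
    also have "\<dots> = (\<Prod>i=1..d. real (card (?T i)))" by (simp add: card_PiE)
    also have "\<dots> \<le> (\<Prod>i=1..d. R ^ (1 + tree_edges d q0 b (q - i)) * (1 / 2) ^ tree_leaves d q0 (q - i) / \<rho>)"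
      using cT by (intro prod_mono) auto
    also have "\<dots> = R ^ tree_edges d q0 b q * (1 / 2) ^ tree_leaves d q0 q / \<rho> ^ d"
      using q by (simp add: prod.distrib prod_dividef tree_edges_rec tree_leaves_rec power_sum)
    also have "\<dots> \<le> R ^ tree_edges d q0 b q * (1 / 2) ^ tree_leaves d q0 q / \<rho>\<^sup>2"
      using R \<rho> d by (intro divide_left_mono power_increasing mult_pos_pos) auto
    finally show ?thesis using finite_subset[OF sub finite_imageI[OF finP]] by simp
  qed
qed

section \<open>Colliding paths\<close>

text \<open>\<open>ch t i\<close> is the \<open>i\<close>-th child of the ball \<open>t\<close>, and a list of directions describes a
  descending path. An index is at least \<open>d\<close> iff the height is positive.\<close>

locale descent_dag =
  fixes d m :: nat and idx :: "nat \<Rightarrow> nat" and ch :: "nat \<Rightarrow> nat \<Rightarrow> nat"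
  assumes d: "d \<ge> 2"
    and ch: "t < m \<Longrightarrow> i \<in> {1..d} \<Longrightarrow> d + i \<le> idx t \<Longrightarrow> ch t i < t \<and> idx (ch t i) = idx t - i"
begin

text \<open>The bound keeps every ball on the path at an index of at least \<open>d\<close>, so the
  locale assumption on \<open>ch\<close> applies at each step.\<close>

definition legit :: "nat \<Rightarrow> nat list \<Rightarrow> bool" where
  "legit t p \<longleftrightarrow> set p \<subseteq> {1..d} \<and> d + sum_list p \<le> idx t"

abbreviation pos :: "nat \<Rightarrow> nat list \<Rightarrow> nat" where
  "pos \<equiv> foldl ch"

definition collide :: "nat \<Rightarrow> bool" where
  "collide t \<longleftrightarrow> (\<exists>p p'. legit t p \<and> legit t p' \<and> p \<noteq> p' \<and> pos t p = pos t p')"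

definition sub_dag :: "nat set \<Rightarrow> (nat \<times> nat) set \<Rightarrow> bool" where
  "sub_dag V D \<longleftrightarrow> finite V \<and> V \<subseteq> {..<m} \<and> D \<subseteq> V \<times> {1..d} \<and>
     (\<forall>(t, i)\<in>D. d + i \<le> idx t \<and> ch t i \<in> V)"

lemma legit_append:
  "legit t (p @ p') \<Longrightarrow> legit t p"
  by (auto simp: legit_def)

lemma pos_less:
  assumes "t < m" "legit t p"
  shows "pos t p \<le> t \<and> idx (pos t p) = idx t - sum_list p"
  using assms(2)
proof (induction p rule: rev_induct)
  case (snoc i p)
  then have "pos t p \<le> t" "idx (pos t p) = idx t - sum_list p" "i \<in> {1..d}" "d + i \<le> idx (pos t p)"
    using legit_append by (auto simp: legit_def)
  then show ?case using ch[of "pos t p" i] assms(1) by auto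
qed simp

lemma legit_Cons:
  assumes "t < m"
  shows "legit t (i # p) \<longleftrightarrow> i \<in> {1..d} \<and> d + i \<le> idx t \<and> legit (ch t i) p"
  using ch[OF assms, of i] by (auto simp: legit_def)

lemma legit_concat:
  assumes "t < m" "legit t p" "legit (pos t p) p'"
  shows "legit t (p @ p')"
proof -
  have "sum_list p \<le> idx t" using assms(2) by (simp add: legit_def)
  then show ?thesis using pos_less[OF assms(1,2)] assms(2,3) by (auto simp: legit_def)
qed

lemma length_le_sum_list:
  "set p \<subseteq> {1..d} \<Longrightarrow> length p \<le> sum_list p"
  by (induction p) auto

lemma pos_eq_root:
  assumes "t < m" "legit t p" "pos t p = t"
  shows "p = []"
proof -
  have "sum_list p \<le> idx t" "idx t = idx t - sum_list p" "d \<le> idx t"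
    using pos_less[OF assms(1,2)] assms(2,3) by (auto simp: legit_def)
  then have "sum_list p = 0" using d assms(2) unfolding legit_def by linarith
  then have "length p \<le> 0" using length_le_sum_list[of p] assms(2) unfolding legit_def by metis
  then show ?thesis by simp
qed

text \<open>Every new vertex but \<open>X\<close> is entered by a new edge, and \<open>X\<close> pays for its edge into \<open>V\<close>. One
  more edge appears where a path enters \<open>V\<close> or, if this never happens, where the two paths meet.\<close>

lemma sub_dag_extend:
  assumes X: "X < m" "2 * d \<le> idx X"
    and VD: "sub_dag V D" "ch X d \<in> V" "V \<subseteq> {v. idx v < idx X}"
    and p: "legit X (1 # p1)" "legit X (1 # p2)" "p1 \<noteq> p2" "pos X (1 # p1) = pos X (1 # p2)"
  shows "\<exists>V' D'. sub_dag V' D' \<and> X \<in> V' \<and> V' \<subseteq> {v. idx v \<le> idx X} \<and>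
    card V' \<le> card V + 2 * idx X \<and> card V' + card D + 1 \<le> card V + card D'"
proof -
  define pre :: "nat list \<Rightarrow> nat list set" where "pre = (\<lambda>p. (\<lambda>n. take n p) ` {..length p})"
  define A where "A = pre (1 # p1) \<union> pre (1 # p2)"
  have finA: "finite A" unfolding A_def pre_def by simp
  have cpre: "card (pre p) \<le> length p + 1" for p
    unfolding pre_def by (rule order.trans[OF card_image_le]) auto
  have len: "length (1 # p) + 1 \<le> idx X" if "legit X (1 # p)" for p
    using that length_le_sum_list[of "1 # p"] d unfolding legit_def by linarith
  have cA: "card A \<le> 2 * idx X"
  proof -
    have "card A \<le> card (pre (1 # p1)) + card (pre (1 # p2))" unfolding A_def by (rule card_Un_le)
    then show ?thesis using cpre[of "1 # p1"] cpre[of "1 # p2"] len[OF p(1)] len[OF p(2)] by linarith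
  qed
  have legA: "legit X a" if a: "a \<in> A" for a
  proof -
    obtain p n where "legit X p" "a = take n p" using a p(1,2) unfolding A_def pre_def by auto
    then show ?thesis using legit_append[of X "take n p" "drop n p"] by simp
  qed
  have butA: "butlast a \<in> A" if a: "a \<in> A" for a
  proof -
    obtain p where pr: "pre p \<subseteq> A" "a \<in> pre p" using a unfolding A_def by blast
    then obtain n where p: "a = take n p" "n \<le> length p" unfolding pre_def by auto
    then have "butlast a = take (n - 1) p" by (simp add: butlast_take)
    then have "butlast a \<in> pre p" using p(2) unfolding pre_def by auto
    then show ?thesis using pr(1) by auto
  qed
  have nilA: "[] \<in> A" unfolding A_def pre_def by (auto intro: image_eqI[of _ _ 0])
  have pA: "1 # p1 \<in> A" "1 # p2 \<in> A"
    unfolding A_def pre_def by (auto intro: image_eqI[of _ _ "length (1 # p1)"] image_eqI[of _ _ "length (1 # p2)"])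
  have hdA: "hd a = 1" if "a \<in> A" "a \<noteq> []" for a
    using that unfolding A_def pre_def by (auto simp: take_Cons')
  define edge where "edge = (\<lambda>a. (pos X (butlast a), last a))"
  have snoc: "pos X a = ch (pos X (butlast a)) (last a)" if "a \<noteq> []" for a
    using that by (metis append_butlast_last_id foldl_Cons foldl_Nil foldl_append)
  define \<tau> where "\<tau> = (\<lambda>(t, i). ch t i)"
  have \<tau>: "\<tau> (edge a) = pos X a" if "a \<noteq> []" for a using snoc[OF that] by (simp add: \<tau>_def edge_def)
  define E where "E = edge ` (A - {[]})"
  define E1 where "E1 = E - D"
  define V' where "V' = V \<union> pos X ` A"
  define D' where "D' = insert (X, d) (D \<union> E)"
  define N where "N = pos X ` A - V - {X}"
  have fin: "finite V" "finite D" "finite E" "finite E1" "finite N"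
    using VD(1) finA finite_subset[of D "V \<times> {1..d}"] unfolding sub_dag_def E_def E1_def N_def by auto
  have XV: "X \<notin> V" using VD(3) by auto
  have posA: "pos X a < m" "idx (pos X a) \<le> idx X" if "a \<in> A" for a
    using pos_less[OF X(1) legA[OF that]] X(1) by auto
  have edge_legit: "fst (edge a) \<in> pos X ` A \<and> snd (edge a) \<in> {1..d} \<and> d + snd (edge a) \<le> idx (fst (edge a))"
    if "a \<in> A" "a \<noteq> []" for a
  proof -
    have l: "legit X (butlast a @ [last a])" using legA[OF that(1)] that(2) by simp
    then have "idx (pos X (butlast a)) = idx X - sum_list (butlast a)"
      using pos_less[OF X(1)] legit_append by blast
    then show ?thesis using butA[OF that(1)] l by (auto simp: edge_def legit_def)
  qed
  have sub: "sub_dag V' D'"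
    unfolding sub_dag_def
  proof (intro conjI)
    show "finite V'" using fin finA unfolding V'_def by auto
    show "V' \<subseteq> {..<m}" using posA VD(1) unfolding V'_def sub_dag_def by auto
    have XV': "X \<in> V'" using nilA unfolding V'_def by (auto intro: image_eqI[of _ _ "[]"])
    show "D' \<subseteq> V' \<times> {1..d}"
    proof -
      have "edge a \<in> V' \<times> {1..d}" if "a \<in> A" "a \<noteq> []" for a
        using edge_legit[OF that] unfolding V'_def mem_Times_iff by blast
      then have "E \<subseteq> V' \<times> {1..d}" unfolding E_def by blast
      moreover have "D \<subseteq> V' \<times> {1..d}" using VD(1) unfolding sub_dag_def V'_def by blast
      moreover have "(X, d) \<in> V' \<times> {1..d}" using XV' d by simp
      ultimately show ?thesis unfolding D'_def by blast
    qed
    show "\<forall>(t, i)\<in>D'. d + i \<le> idx t \<and> ch t i \<in> V'"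
    proof (clarify)
      fix t i assume ti: "(t, i) \<in> D'"
      consider "(t, i) = (X, d)" | "(t, i) \<in> D" | a where "a \<in> A" "a \<noteq> []" "(t, i) = edge a"
        using ti unfolding D'_def E_def by auto
      then show "d + i \<le> idx t \<and> ch t i \<in> V'"
      proof cases
        case 1
        then show ?thesis using X VD(2) unfolding V'_def by auto
      next
        case 2
        then show ?thesis using VD(1) unfolding V'_def sub_dag_def by auto
      next
        case 3
        then show ?thesis using edge_legit[of a] \<tau>[of a] unfolding V'_def \<tau>_def
          by (metis (no_types, lifting) UnI2 case_prod_conv fst_conv imageI snd_conv)
      qed
    qed
  qed
  have Nsub: "N \<subseteq> \<tau> ` E1"
  proof
    fix v assume "v \<in> N"
    then obtain a where a: "a \<in> A" "v = pos X a" "v \<notin> V" "v \<noteq> X" unfolding N_def by auto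
    then have "a \<noteq> []" by auto
    moreover have "edge a \<notin> D"
      using VD(1) a(2,3) \<tau>[OF \<open>a \<noteq> []\<close>] unfolding sub_dag_def \<tau>_def by (auto split: prod.splits)
    ultimately show "v \<in> \<tau> ` E1" using a \<tau>[of a] unfolding E1_def E_def by force
  qed
  have less: "card N < card E1"
  proof (rule ccontr)
    assume "\<not> ?thesis"
    then have ge: "card E1 \<le> card N" by simp
    have "card (\<tau> ` E1) \<le> card E1" using fin by (intro card_image_le) auto
    \<comment> \<open>In the case of equality \<tau> maps the new edges bijectively onto the new
      vertices. Then no new edge ends in \<open>V\<close> or returns to X, and each position has
      only one incoming edge, so following the edges backwards recovers the address.\<close>
    then have eq: "N = \<tau> ` E1" using card_subset_eq[OF _ Nsub] ge card_mono[OF _ Nsub] fin by auto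
    then have inj: "inj_on \<tau> E1" using ge fin \<open>card (\<tau> ` E1) \<le> card E1\<close>
      by (intro eq_card_imp_inj_on) auto
    have notV: "pos X a \<notin> V" if "a \<in> A" for a
      using that
    proof (induction "length a" arbitrary: a)
      case 0
      then show ?case using XV by simp
    next
      case (Suc n)
      then have "pos X (butlast a) \<notin> V" "a \<noteq> []" using butA by auto
      then have "edge a \<in> E1" using Suc.prems VD(1) unfolding E1_def E_def sub_dag_def
        by (auto simp: edge_def)
      then show ?case using eq \<tau>[OF \<open>a \<noteq> []\<close>] unfolding N_def by (metis Diff_iff imageI)
    qed
    have inE1: "edge a \<in> E1" if "a \<in> A" "a \<noteq> []" for a
      using that notV[OF butA[OF that(1)]] VD(1) unfolding E1_def E_def sub_dag_def
      by (auto simp: edge_def)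
    have "a = a'" if "a \<in> A" "a' \<in> A" "pos X a = pos X a'" for a a'
      using that
    proof (induction "length a" arbitrary: a a')
      case 0
      then show ?case using pos_eq_root[OF X(1) legA[of a']] by simp
    next
      case (Suc n)
      then have a: "a \<noteq> []" by auto
      then have a': "a' \<noteq> []" using pos_eq_root[OF X(1) legA[of a]] Suc.prems by auto
      have "edge a = edge a'"
        using inj inE1[OF Suc.prems(1) a] inE1[OF Suc.prems(2) a'] Suc.prems(3) \<tau>[OF a] \<tau>[OF a']
        by (metis inj_onD)
      then have "pos X (butlast a) = pos X (butlast a')" "last a = last a'" by (auto simp: edge_def)
      moreover have "butlast a = butlast a'"
        by (rule Suc.hyps(1)) (use Suc.hyps(2) butA Suc.prems calculation in auto)
      ultimately show ?case using a a' by (metis append_butlast_last_id)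
    qed
    then show False using p(3,4) pA by blast
  qed
  \<comment> \<open>Both paths leave X in direction 1, which differs from \<open>d\<close>, so the
    edge along the bin is not among theirs. The head 1 of the paths serves this purpose.\<close>
  have XdE: "(X, d) \<notin> E"
  proof
    assume "(X, d) \<in> E"
    then obtain a where "a \<in> A - {[]}" "(X, d) = edge a" unfolding E_def by (elim imageE)
    then have a: "a \<in> A" "a \<noteq> []" "pos X (butlast a) = X" "last a = d"
      unfolding edge_def by simp_all
    then have "butlast a = []" using pos_eq_root[OF X(1) legA[OF butA]] by auto
    then have "a = [d]" using a(2,4) by (metis append_Nil append_butlast_last_id)
    then show False using hdA[OF a(1,2)] d by simp
  qed
  have cD': "card D' = card D + card E1 + 1"
  proof -
    have "(X, d) \<notin> D" using VD(1) XV unfolding sub_dag_def by auto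
    then have "card D' = card (D \<union> E) + 1" using XdE fin unfolding D'_def by simp
    also have "D \<union> E = D \<union> E1" unfolding E1_def by auto
    also have "card \<dots> = card D + card E1"
      using fin unfolding E1_def by (intro card_Un_disjoint) auto
    finally show ?thesis .
  qed
  have V'eq: "V' = insert X (V \<union> N)" unfolding V'_def N_def
    using nilA by (auto intro: image_eqI[of _ _ "[]"])
  have "card (V \<union> N) = card V + card N" using fin unfolding N_def by (intro card_Un_disjoint) auto
  then have "card V' = card V + card N + 1" using XV fin unfolding V'eq N_def by simp
  then have c: "card V' + card D + 1 \<le> card V + card D'" using less cD' by linarith
  have "card V' \<le> card V + card (pos X ` A)" unfolding V'_def by (rule card_Un_le)
  then have "card V' \<le> card V + 2 * idx X" using card_image_le[OF finA, of "pos X"] cA by linarith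
  moreover have "V' \<subseteq> {v. idx v \<le> idx X}" using VD(3) posA unfolding V'_def by auto
  ultimately show ?thesis using sub c V'eq by blast
qed

text \<open>Direction \<open>d\<close> stays in a bin, so it leads from X through balls of indices q
  + K * d + 1, ..., q + 1 of one bin. From each of them but the last, one step in direction 1 and
  further steps in direction \<open>d\<close> reach a ball of index \<open>q\<close>; the offset 1
  exists for this first step. If all of these balls have colliding paths, the sub-DAG is built from
  the bottom of the chain upwards and gains one surplus edge per ball. It starts as a single vertex
  without edges, whence \<open>card D + 1\<close>.\<close>

lemma collision_free_or_dense:
  assumes "d \<le> q" "X < m" "idx X = q + K * d + 1"
  shows "(\<exists>r<m. idx r = q \<and> \<not> collide r) \<or>
    (\<exists>V D. sub_dag V D \<and> X \<in> V \<and> V \<subseteq> {v. idx v \<le> idx X} \<and>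
       card V \<le> 1 + K * (2 * (q + K * d + 1)) \<and> card V + K \<le> card D + 1)"
  using assms(2,3)
proof (induction K arbitrary: X)
  case 0
  have "sub_dag {X} {}" using 0 by (simp add: sub_dag_def)
  then show ?case by (intro disjI2 exI[of _ "{X}"] exI[of _ "{}"]) auto
next
  case (Suc K)
  define y where "y = ch X d"
  have "d \<in> {1..d}" "d + d \<le> idx X" using d assms(1) Suc.prems by auto
  then have y: "y < X" "idx y = q + K * d + 1"
    using ch[OF Suc.prems(1), of d] Suc.prems(2) unfolding y_def by auto
  define p where "p = 1 # replicate (Suc K) d"
  have lp: "legit X p"
    using d assms(1) Suc.prems(2) by (auto simp: legit_def p_def sum_list_replicate)
  define r where "r = pos X p"
  have r: "r < m" "idx r = q"
    using pos_less[OF Suc.prems(1) lp] Suc.prems unfolding r_def[symmetric] by (auto simp: p_def sum_list_replicate)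
  show ?case
  proof (cases "collide r")
    case False
    then show ?thesis using r by blast
  next
    case True
    then obtain s s' where s: "legit r s" "legit r s'" "s \<noteq> s'" "pos r s = pos r s'"
      unfolding collide_def by blast
    have "(\<exists>r<m. idx r = q \<and> \<not> collide r) \<or>
      (\<exists>V D. sub_dag V D \<and> y \<in> V \<and> V \<subseteq> {v. idx v \<le> idx y} \<and>
       card V \<le> 1 + K * (2 * (q + K * d + 1)) \<and> card V + K \<le> card D + 1)"
      using Suc.IH[of y] y Suc.prems by auto
    then show ?thesis
    proof
      assume "\<exists>V D. sub_dag V D \<and> y \<in> V \<and> V \<subseteq> {v. idx v \<le> idx y} \<and>
       card V \<le> 1 + K * (2 * (q + K * d + 1)) \<and> card V + K \<le> card D + 1"
      then obtain V D where VD: "sub_dag V D" "y \<in> V" "V \<subseteq> {v. idx v \<le> idx y}"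
        "card V \<le> 1 + K * (2 * (q + K * d + 1))" "card V + K \<le> card D + 1" by blast
      have l: "legit X (p @ s)" "legit X (p @ s')"
        using legit_concat[OF Suc.prems(1) lp] s unfolding r_def by auto
      have "\<exists>V' D'. sub_dag V' D' \<and> X \<in> V' \<and> V' \<subseteq> {v. idx v \<le> idx X} \<and>
        card V' \<le> card V + 2 * idx X \<and> card V' + card D + 1 \<le> card V + card D'"
      proof (rule sub_dag_extend[of X V D "replicate (Suc K) d @ s" "replicate (Suc K) d @ s'"])
        show "V \<subseteq> {v. idx v < idx X}" using VD(3) y Suc.prems(2) d by auto
        show "pos X (1 # replicate (Suc K) d @ s) = pos X (1 # replicate (Suc K) d @ s')"
          using s(4) unfolding r_def p_def by simp
      qed (use l VD s \<open>d + d \<le> idx X\<close> Suc.prems y_def p_def in auto)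
      then obtain V' D' where V': "sub_dag V' D'" "X \<in> V'" "V' \<subseteq> {v. idx v \<le> idx X}"
        "card V' \<le> card V + 2 * idx X" "card V' + card D + 1 \<le> card V + card D'" by blast
      have "card V' \<le> 1 + Suc K * (2 * (q + Suc K * d + 1))"
      proof -
        have "K * (2 * (q + K * d + 1)) \<le> K * (2 * (q + Suc K * d + 1))" by simp
        then have "card V \<le> 1 + K * (2 * (q + Suc K * d + 1))" using VD(4) by linarith
        then show ?thesis using V'(4) unfolding Suc.prems(2) by simp
      qed
      moreover have "card V' + Suc K \<le> card D' + 1" using V'(5) VD(5) by linarith
      ultimately show ?thesis using V' by blast
    qed blast
  qed
qed

lemma collision_free_child:
  assumes "\<not> collide t" "t < m" "i \<in> {1..d}" "d + i \<le> idx t"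
  shows "\<not> collide (ch t i)"
proof
  assume "collide (ch t i)"
  then obtain p p' where "legit (ch t i) p" "legit (ch t i) p'" "p \<noteq> p'" "pos (ch t i) p = pos (ch t i) p'"
    unfolding collide_def by blast
  then have "legit t (i # p)" "legit t (i # p')" "i # p \<noteq> i # p'" "pos t (i # p) = pos t (i # p')"
    using legit_Cons[OF assms(2)] assms(3,4) by auto
  then show False using assms(1) unfolding collide_def by blast
qed

text \<open>Without colliding paths distinct addresses are distinct balls, so the unfolding is a
  genuine tree with an exact edge count and one parent per ball. The claim that all its balls have
  nonempty addresses below \<open>t\<close> is carried along to separate the subtrees: their
  addresses start with different directions.\<close>

lemma collision_free_witness_tree:
  assumes "\<not> collide t" "t < m" "idx t = q" "(b + 1) * d \<le> q" "q0 = (b + 2) * d"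
    and hv: "\<And>t i. t < m \<Longrightarrow> i \<in> {1..d} \<Longrightarrow> d + i \<le> idx t \<Longrightarrow>
      hv ((idx t - i) mod d + 1) (ch t i) = hv ((idx t - i) mod d + 1) t"
  shows "\<exists>E. witness_tree d q0 b (\<lambda>j x. {y. y < x \<and> hv j y = hv j x}) q t E \<and> finite E \<and> inj_on fst E \<and>
    card E = tree_edges d q0 b q \<and> fst ` E \<subseteq> {pos t p | p. p \<noteq> [] \<and> legit t p}"
  using assms(1-4)
proof (induction q arbitrary: t rule: less_induct)
  case (less q)
  let ?Y = "\<lambda>j x. {y. y < x \<and> hv j y = hv j x}"
  have inj: "p = p'" if "legit t p" "legit t p'" "pos t p = pos t p'" for p p'
    using that less.prems(1) unfolding collide_def by blast
  show ?case
  proof (cases "q < q0")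
    case True
    let ?j = "q mod d + 1"
    \<comment> \<open>Each step in direction \<open>d\<close> goes one ball down in the bin of
      \<open>t\<close>. A leaf index is at least (b + 1) * d, which leaves room for \<open>b\<close>
      such steps.\<close>
    define z where "z = (\<lambda>n. pos t (replicate n d))"
    have leg: "legit t (replicate n d)" if "n \<le> b" for n
    proof -
      have "n * d \<le> b * d" using that by (rule mult_le_mono1)
      then have "d + n * d \<le> q" using less.prems(4) unfolding add_mult_distrib by linarith
      then show ?thesis using less.prems(3) d by (auto simp: legit_def sum_list_replicate)
    qed
    have zz: "z n \<le> t \<and> (n > 0 \<longrightarrow> z n < t) \<and> hv ?j (z n) = hv ?j t" if "n \<le> b" for n
      using that
    proof (induction n)
      case (Suc n)
      then have IH: "z n \<le> t" "hv ?j (z n) = hv ?j t" by auto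
      have i: "idx (z n) = q - n * d"
        using pos_less[OF less.prems(2) leg[of n]] Suc.prems less.prems(3)
        by (simp add: z_def sum_list_replicate)
      have "legit t (replicate n d @ [d])" using leg[OF Suc.prems] by (simp add: replicate_append_same)
      then have "d + (n * d + d) \<le> q" using less.prems(3) by (simp add: legit_def sum_list_replicate)
      then have le: "d + d \<le> idx (z n)" using i by linarith
      have zS: "z (Suc n) = ch (z n) d"
      proof -
        have "replicate (Suc n) d = replicate n d @ [d]" by (simp add: replicate_append_same)
        then show ?thesis unfolding z_def by (simp del: replicate.simps)
      qed
      have dd: "d \<in> {1..d}" using d by simp
      have "(idx (z n) - d) mod d = q mod d"
      proof -
        have "n * d + d \<le> q" using le i d by linarith
        then have "q = (idx (z n) - d) + (n + 1) * d" using i by simp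
        then show ?thesis by (metis mod_mult_self1)
      qed
      then show ?case using hv[of "z n" d, OF _ dd le] ch[of "z n" d, OF _ dd le] IH less.prems(2) zS by auto
    qed (simp add: z_def)
    define Z where "Z = z ` {1..b}"
    have "inj_on z {1..b}"
      by (rule inj_onI) (use inj leg in \<open>fastforce simp: z_def dest: arg_cong[of _ _ length]\<close>)
    then have cZ: "card Z = b" unfolding Z_def by (simp add: card_image)
    have "Z \<subseteq> ?Y ?j t" using zz unfolding Z_def by auto
    from witness_tree.leaf[where Y = ?Y and d = d, OF True this cZ]
    have e: "witness_tree d q0 b ?Y q t ((\<lambda>z. (z, ?j, t)) ` Z)" .
    have "fst ` (\<lambda>z. (z, ?j, t)) ` Z \<subseteq> {pos t p | p. p \<noteq> [] \<and> legit t p}"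
      using leg by (auto simp: image_image Z_def z_def intro!: exI[of _ "replicate _ d"])
    moreover have "card ((\<lambda>z. (z, ?j, t)) ` Z) = tree_edges d q0 b q"
      using cZ True by (simp add: card_image inj_on_def tree_edges_rec)
    ultimately show ?thesis using e
      by (intro exI[of _ "(\<lambda>z. (z, ?j, t)) ` Z"]) (auto simp: inj_on_def Z_def)
  next
    case False
    have qd: "2 * d \<le> q0" "q0 \<le> q" using False assms(5) by auto
    then have q: "q \<noteq> 0" using d by auto
    have ii: "d + i \<le> idx t" if "i \<in> {1..d}" for i using that qd less.prems(3) by auto
    let ?P = "\<lambda>i E. witness_tree d q0 b ?Y (q - i) (ch t i) E \<and> finite E \<and> inj_on fst E \<and>
      card E = tree_edges d q0 b (q - i) \<and> fst ` E \<subseteq> {pos (ch t i) p | p. p \<noteq> [] \<and> legit (ch t i) p}"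
    have "\<forall>i\<in>{1..d}. \<exists>E. ?P i E"
    proof
      fix i assume i: "i \<in> {1..d}"
      have "(b + 1) * d \<le> q - i" using i False assms(5) by auto
      then show "\<exists>E. ?P i E"
        using less.IH[of "q - i" "ch t i"] i q collision_free_child[OF less.prems(1,2) i ii[OF i]]
          ch[OF less.prems(2) i ii[OF i]] less.prems(2,3) by auto
    qed
    then have "\<exists>F. \<forall>i\<in>{1..d}. ?P i (F i)" by (rule bchoice)
    then obtain F where "\<forall>i\<in>{1..d}. ?P i (F i)" by (elim exE)
    then have F: "?P i (F i)" if "i \<in> {1..d}" for i using that by (rule bspec)
    define G where "G = (\<lambda>i. insert (ch t i, (q - i) mod d + 1, t) (F i))"
    have addr: "\<exists>p. x = pos t (i # p) \<and> legit t (i # p)" if "i \<in> {1..d}" "x \<in> fst ` G i" for i x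
    proof (cases "x = ch t i")
      case True
      then show ?thesis using that ii[OF that(1)] by (intro exI[of _ "[]"]) (auto simp: legit_def)
    next
      case False
      then have "x \<in> fst ` F i" using that unfolding G_def by auto
      moreover have "fst ` F i \<subseteq> {pos (ch t i) p | p. p \<noteq> [] \<and> legit (ch t i) p}"
        using F[OF that(1)] by blast
      ultimately obtain p where "x = pos (ch t i) p" "legit (ch t i) p" by blast
      then have "x = pos t (i # p) \<and> legit t (i # p)"
        using that(1) ii[OF that(1)] legit_Cons[OF less.prems(2), of i p] by simp
      then show ?thesis by blast
    qed
    have notin: "ch t i \<notin> fst ` F i" if i: "i \<in> {1..d}" for i
    proof
      assume "ch t i \<in> fst ` F i"
      moreover have "fst ` F i \<subseteq> {pos (ch t i) p | p. p \<noteq> [] \<and> legit (ch t i) p}"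
        using F[OF i] by blast
      ultimately obtain p where "p \<noteq> []" "ch t i = pos (ch t i) p" "legit (ch t i) p" by blast
      moreover have "ch t i < m" using ch[OF less.prems(2) i ii[OF i]] less.prems(2) by linarith
      ultimately show False using pos_eq_root[of "ch t i" p] by metis
    qed
    have dis: "fst ` G i \<inter> fst ` G i' = {}" if "i \<in> {1..d}" "i' \<in> {1..d}" "i \<noteq> i'" for i i'
    proof (rule ccontr)
      assume "\<not> ?thesis"
      then obtain x where "x \<in> fst ` G i" "x \<in> fst ` G i'" by blast
      then show False using addr that inj by (metis list.inject)
    qed
    have injG: "inj_on fst (G i)" "finite (G i)" "card (G i) = 1 + tree_edges d q0 b (q - i)"
      if "i \<in> {1..d}" for i
    proof -
      have F': "finite (F i)" "inj_on fst (F i)" "card (F i) = tree_edges d q0 b (q - i)"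
        using F[OF that] by blast+
      have n: "(ch t i, (q - i) mod d + 1, t) \<notin> F i" using notin[OF that] by force
      show "inj_on fst (G i)" using F'(2) notin[OF that] unfolding G_def by (auto simp: inj_on_insert)
      show "finite (G i)" using F'(1) unfolding G_def by simp
      show "card (G i) = 1 + tree_edges d q0 b (q - i)" using F' n unfolding G_def by simp
    qed
    define E where "E = (\<Union>i\<in>{1..d}. G i)"
    have "witness_tree d q0 b ?Y q t E"
      unfolding E_def G_def
    proof (rule witness_tree.node)
      fix i assume i: "i \<in> {1..d}"
      show "ch t i \<in> ?Y ((q - i) mod d + 1) t"
        using hv[OF less.prems(2) i ii[OF i]] ch[OF less.prems(2) i ii[OF i]] less.prems(3) by auto
    qed (use F qd in auto)
    moreover have "finite E" using injG unfolding E_def by auto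
    moreover have "inj_on fst E"
    proof (rule inj_onI)
      fix e e' assume e: "e \<in> E" "e' \<in> E" "fst e = fst e'"
      then obtain i i' where i: "i \<in> {1..d}" "e \<in> G i" "i' \<in> {1..d}" "e' \<in> G i'"
        unfolding E_def by blast
      then have "i = i'" using dis[of i i'] e(3) by (metis disjoint_iff imageI)
      then show "e = e'" using i e(3) injG(1)[of i] by (auto dest: inj_onD)
    qed
    moreover have "card E = tree_edges d q0 b q"
    proof -
      have "card E = (\<Sum>i\<in>{1..d}. card (G i))"
        unfolding E_def
      proof (rule card_UN_disjoint)
        show "\<forall>i\<in>{1..d}. \<forall>j\<in>{1..d}. i \<noteq> j \<longrightarrow> G i \<inter> G j = {}"
          using dis by blast
      qed (use injG in auto)
      then show ?thesis using injG(3) qd(2) q by (simp add: tree_edges_rec)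
    qed
    moreover have "fst ` E \<subseteq> {pos t p | p. p \<noteq> [] \<and> legit t p}"
    proof
      fix x assume "x \<in> fst ` E"
      then obtain i where i: "i \<in> {1..d}" "x \<in> fst ` G i" unfolding E_def by blast
      from addr[OF this] obtain p where "x = pos t (i # p)" "legit t (i # p)" by blast
      then show "x \<in> {pos t p | p. p \<noteq> [] \<and> legit t p}" by blast
    qed
    ultimately show ?thesis by blast
  qed
qed

end

section \<open>Small-bias spaces\<close>

definition bit_character :: "nat \<Rightarrow> nat \<Rightarrow> real" where
  "bit_character a x = (-1) ^ card {j. bit a j \<and> bit x j}"

lemma character_eq: "character U \<alpha> x = (\<Prod>u\<in>U. bit_character (\<alpha> u) (x u))"
  by (simp add: character_def bit_character_def)

lemma bit_character_0 [simp]: "bit_character 0 x = 1"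
  by (simp add: bit_character_def)

lemma abs_bit_character [simp]: "\<bar>bit_character a x\<bar> = 1"
  by (simp add: bit_character_def power_abs)

lemma set_decode_eq_bits: "set_decode a = {j. bit a j}"
  by (auto simp: set_decode_def bit_iff_odd)

lemma finite_bits_nat [simp]: "finite {j. bit (a :: nat) j}"
  using finite_set_decode[of a] by (simp add: set_decode_eq_bits)

lemma bit_character_prod:
  "bit_character a x = (\<Prod>j | bit a j. if bit x j then -1 else 1)"
proof -
  have "(\<Prod>j | bit a j. if bit x j then -1 else 1 :: real) = (\<Prod>j \<in> {j. bit a j} \<inter> {j. bit x j}. -1)"
    by (simp add: prod.If_cases)
  then show ?thesis by (simp add: bit_character_def Collect_conj_eq)
qed

lemma bit_nat_less:
  assumes "(x::nat) < 2 ^ b" "bit x j"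
  shows "j < b"
  using assms by (metis bit_take_bit_iff take_bit_nat_eq_self)

lemma bij_betw_bits: "bij_betw (\<lambda>a :: nat. {j. bit a j}) {..<2 ^ b} (Pow {..<b})"
proof (rule bij_betw_imageI)
  show "inj_on (\<lambda>a :: nat. {j. bit a j}) {..<2 ^ b}"
    by (rule inj_onI) (auto intro!: bit_eqI)
  show "(\<lambda>a :: nat. {j. bit a j}) ` {..<2 ^ b} = Pow {..<b}"
  proof (intro equalityI subsetI)
    fix A assume A: "A \<in> Pow {..<b}"
    define a where "a = take_bit b (set_encode A)"
    have "finite A" using A finite_subset by auto
    then have "{j. bit a j} = A"
      using set_encode_inverse[of A] A unfolding a_def set_decode_eq_bits by (auto simp: bit_take_bit_iff)
    moreover have "a < 2 ^ b" unfolding a_def by simp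
    ultimately show "A \<in> (\<lambda>a :: nat. {j. bit a j}) ` {..<2 ^ b}" by blast
  qed (auto dest: bit_nat_less)
qed

text \<open>Orthogonality of characters: the bits of a vary independently, so the sum factors over
  the positions, and a position where x and z differ contributes 1 - 1.\<close>

lemma sum_bit_character:
  assumes "x < 2 ^ b" "z < 2 ^ b"
  shows "(\<Sum>a<2 ^ b. bit_character a x * bit_character a z) = (if x = z then 2 ^ b else 0)"
proof -
  define \<sigma> :: "nat \<Rightarrow> real" where
    "\<sigma> = (\<lambda>j. (if bit x j then -1 else 1) * (if bit z j then -1 else 1))"
  have "(\<Sum>a<2 ^ b. bit_character a x * bit_character a z) = (\<Sum>a\<in>{..<2 ^ b :: nat}. \<Prod>j\<in>{j. bit a j}. \<sigma> j)"
    by (simp add: bit_character_prod \<sigma>_def prod.distrib)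
  also have "\<dots> = (\<Sum>A\<in>Pow {..<b}. \<Prod>j\<in>A. \<sigma> j)"
    by (rule sum.reindex_bij_betw[OF bij_betw_bits])
  also have "\<dots> = (\<Prod>j<b. 1 + \<sigma> j)" by (subst add.commute, simp add: prod_add)
  also have "\<dots> = (if x = z then 2 ^ b else 0)"
  proof (cases "x = z")
    case True
    then have "1 + \<sigma> j = 2" for j by (simp add: \<sigma>_def)
    then show ?thesis using True by simp
  next
    case False
    then obtain j where j: "bit x j \<noteq> bit z j" using bit_eqI by blast
    then have "j < b" using assms bit_nat_less by blast
    moreover have "1 + \<sigma> j = 0" using j by (auto simp: \<sigma>_def)
    ultimately show ?thesis using False by (auto intro!: prod_zero)
  qed
  finally show ?thesis .
qed

text \<open>Fourier expansion of the indicator: it is the average, over all indices on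
  \<open>S\<close>, of characters with signs. The trivial index yields the uniform probability; any
  other has nonempty support inside \<open>S\<close>, hence of size at most \<open>w\<close>, and
  changes the average by at most its share of \<delta>.\<close>

lemma biased_space_point:
  assumes P: "biased_space U b w \<delta> P" and U: "finite U" and S: "S \<subseteq> U" "card S \<le> w"
    and z: "\<And>u. u \<in> S \<Longrightarrow> z u < 2 ^ b" and \<delta>: "\<delta> \<ge> 0"
  shows "\<bar>measure_pmf.prob P {x. \<forall>u\<in>S. x u = z u} - (1 / 2 ^ b) ^ card S\<bar> \<le> \<delta>"
proof -
  let ?A = "S \<rightarrow>\<^sub>E {..<2 ^ b :: nat}"
  let ?r = "(1 / 2 ^ b :: real) ^ card S"
  have finS: "finite S" using U S finite_subset by auto
  have finA: "finite ?A" using finS by (intro finite_PiE) auto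
  have sP: "set_pmf P \<subseteq> U \<rightarrow>\<^sub>E {..<2 ^ b}" using P unfolding biased_space_def by auto
  have finP: "finite (set_pmf P)" by (rule finite_subset[OF sP]) (use U in \<open>auto intro!: finite_PiE\<close>)
  define ext where "ext = (\<lambda>\<alpha> :: 'a \<Rightarrow> nat. \<lambda>u\<in>U. if u \<in> S then \<alpha> u else 0)"
  define c where "c = (\<lambda>\<alpha>. \<Prod>u\<in>S. bit_character (\<alpha> u) (z u))"
  define \<alpha>0 where "\<alpha>0 = (\<lambda>u\<in>S. 0 :: nat)"
  have ext: "character U (ext \<alpha>) x = (\<Prod>u\<in>S. bit_character (\<alpha> u) (x u))" for \<alpha> x
  proof -
    have "character U (ext \<alpha>) x = (\<Prod>u\<in>U. if u \<in> S then bit_character (\<alpha> u) (x u) else 1)"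
      unfolding character_eq ext_def by (intro prod.cong) auto
    also have "\<dots> = (\<Prod>u\<in>S. bit_character (\<alpha> u) (x u))"
      using U S by (simp add: prod.If_cases Int_absorb1)
    finally show ?thesis .
  qed
  have ind: "indicator {x. \<forall>u\<in>S. x u = z u} x = ?r * (\<Sum>\<alpha>\<in>?A. c \<alpha> * character U (ext \<alpha>) x)"
    if "x \<in> set_pmf P" for x
  proof -
    have x: "x u < 2 ^ b" if "u \<in> S" for u using sP \<open>x \<in> set_pmf P\<close> S that by auto
    have "(\<Sum>\<alpha>\<in>?A. c \<alpha> * character U (ext \<alpha>) x) =
      (\<Sum>\<alpha>\<in>?A. \<Prod>u\<in>S. bit_character (\<alpha> u) (x u) * bit_character (\<alpha> u) (z u))"
      unfolding c_def ext by (simp add: prod.distrib mult.commute)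
    also have "\<dots> = (\<Prod>u\<in>S. \<Sum>a<2 ^ b. bit_character a (x u) * bit_character a (z u))"
      using finS by (simp add: prod_sum_PiE)
    also have "\<dots> = (\<Prod>u\<in>S. if x u = z u then 2 ^ b else 0)"
      by (intro prod.cong refl sum_bit_character x z)
    also have "\<dots> = (if \<forall>u\<in>S. x u = z u then (2 ^ b) ^ card S else 0)"
      using finS by (auto intro: prod_zero)
    finally show ?thesis by (auto simp: indicator_def power_one_over)
  qed
  have "measure_pmf.prob P {x. \<forall>u\<in>S. x u = z u} = measure_pmf.expectation P (indicator {x. \<forall>u\<in>S. x u = z u})"
    by simp
  also have "\<dots> = measure_pmf.expectation P (\<lambda>x. ?r * (\<Sum>\<alpha>\<in>?A. c \<alpha> * character U (ext \<alpha>) x))"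
    by (rule integral_cong_AE) (use ind in \<open>auto simp: AE_measure_pmf_iff\<close>)
  also have "\<dots> = ?r * (\<Sum>\<alpha>\<in>?A. c \<alpha> * measure_pmf.expectation P (character U (ext \<alpha>)))"
    using finP by (simp add: integrable_measure_pmf_finite)
  also have "\<dots> = ?r * (1 + (\<Sum>\<alpha>\<in>?A - {\<alpha>0}. c \<alpha> * measure_pmf.expectation P (character U (ext \<alpha>))))"
  proof -
    have "\<alpha>0 \<in> ?A" unfolding \<alpha>0_def by auto
    moreover have "character U (ext \<alpha>0) = (\<lambda>_. 1)" "c \<alpha>0 = 1"
      by (auto simp: ext c_def \<alpha>0_def)
    ultimately show ?thesis by (subst sum.remove[OF finA, of \<alpha>0]) auto
  qed
  finally have eq: "measure_pmf.prob P {x. \<forall>u\<in>S. x u = z u} - ?r =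
    ?r * (\<Sum>\<alpha>\<in>?A - {\<alpha>0}. c \<alpha> * measure_pmf.expectation P (character U (ext \<alpha>)))"
    by (simp add: algebra_simps)
  have "\<bar>c \<alpha> * measure_pmf.expectation P (character U (ext \<alpha>))\<bar> \<le> \<delta>" if "\<alpha> \<in> ?A - {\<alpha>0}" for \<alpha>
  proof -
    have "\<bar>c \<alpha>\<bar> = 1" unfolding c_def by (simp add: abs_prod)
    moreover have "ext \<alpha> \<in> U \<rightarrow>\<^sub>E {..<2 ^ b}" using that unfolding ext_def by (auto simp: PiE_iff)
    moreover have sup: "char_support U (ext \<alpha>) \<subseteq> S" unfolding char_support_def ext_def by auto
    moreover have "card (char_support U (ext \<alpha>)) \<le> w" using card_mono[OF finS sup] S by simp
    moreover have "char_support U (ext \<alpha>) \<noteq> {}"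
    proof
      assume "char_support U (ext \<alpha>) = {}"
      then have "\<alpha> u = 0" if "u \<in> S" for u
        using that S unfolding char_support_def ext_def by auto
      then have "\<alpha> = \<alpha>0" using that unfolding \<alpha>0_def by (auto intro!: PiE_ext[of _ S])
      then show False using that by simp
    qed
    ultimately show ?thesis using P unfolding biased_space_def by (simp add: abs_mult)
  qed
  then have "\<bar>\<Sum>\<alpha>\<in>?A - {\<alpha>0}. c \<alpha> * measure_pmf.expectation P (character U (ext \<alpha>))\<bar> \<le> real (card (?A - {\<alpha>0})) * \<delta>"
    by (intro order.trans[OF sum_abs] sum_bounded_above)
  also have "\<dots> \<le> real (card ?A) * \<delta>"
    using finA \<delta> by (intro mult_right_mono) (auto intro: card_mono)
  also have "real (card ?A) = (2 ^ b) ^ card S" using finS by (simp add: card_PiE)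
  finally show ?thesis unfolding eq by (simp add: abs_mult power_one_over field_simps)
qed

abbreviation uniform_fun :: "'a set \<Rightarrow> nat \<Rightarrow> ('a \<Rightarrow> nat) pmf" where
  "uniform_fun U r \<equiv> Pi_pmf U undefined (\<lambda>_. pmf_of_set {..<r})"

lemma uniform_fun_point:
  assumes "finite U" "S \<subseteq> U" "\<And>u. u \<in> S \<Longrightarrow> z u < r" "r > 0"
  shows "measure_pmf.prob (uniform_fun U r) {x. \<forall>u\<in>S. x u = z u} = (1 / r) ^ card S"
proof -
  have "{x. \<forall>u\<in>S. x u = z u} = Pi U (\<lambda>u. if u \<in> S then {z u} else UNIV)"
    using assms(2) by (auto simp: Pi_iff split: if_splits)
  then have "measure_pmf.prob (uniform_fun U r) {x. \<forall>u\<in>S. x u = z u} =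
    (\<Prod>u\<in>U. measure_pmf.prob (pmf_of_set {..<r}) (if u \<in> S then {z u} else UNIV))"
    by (simp add: measure_Pi_pmf_Pi[OF assms(1)])
  also have "\<dots> = (\<Prod>u\<in>U. if u \<in> S then 1 / r else 1)"
    using assms(3,4) by (intro prod.cong) (auto simp: measure_pmf_single lessThan_empty_iff)
  also have "\<dots> = (1 / r) ^ card S"
    using assms(1,2) by (simp add: prod.If_cases Int_absorb1)
  finally show ?thesis .
qed

lemma set_uniform_fun:
  assumes "finite U" "r > 0"
  shows "set_pmf (uniform_fun U r) \<subseteq> U \<rightarrow>\<^sub>E {..<r}"
  using assms by (auto simp: set_Pi_pmf PiE_dflt_def lessThan_empty_iff extensional_def)

lemma expectation_local:
  fixes F :: "('a \<Rightarrow> nat) \<Rightarrow> real"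
  assumes P: "set_pmf P \<subseteq> U \<rightarrow>\<^sub>E {..<r}" and "finite U" "S \<subseteq> U"
    and F: "\<And>x y. (\<And>u. u \<in> S \<Longrightarrow> x u = y u) \<Longrightarrow> F x = F y"
  shows "measure_pmf.expectation P F =
    (\<Sum>z\<in>S \<rightarrow>\<^sub>E {..<r}. F z * measure_pmf.prob P {x. \<forall>u\<in>S. x u = z u})"
proof -
  have finS: "finite S" using assms(2,3) finite_subset by auto
  have "measure_pmf.expectation P F = measure_pmf.expectation (map_pmf (\<lambda>x. restrict x S) P) F"
    by (simp, intro Bochner_Integration.integral_cong refl F) auto
  also have "\<dots> = (\<Sum>z\<in>S \<rightarrow>\<^sub>E {..<r}. F z * pmf (map_pmf (\<lambda>x. restrict x S) P) z)"
  proof (rule integral_measure_pmf_real)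
    show "z \<in> S \<rightarrow>\<^sub>E {..<r}" if z: "z \<in> set_pmf (map_pmf (\<lambda>x. restrict x S) P)" for z
    proof -
      obtain x where x: "x \<in> set_pmf P" "z = restrict x S" using z by auto
      then show ?thesis using subsetD[OF P x(1)] \<open>S \<subseteq> U\<close> by (auto simp: PiE_iff)
    qed
  qed (use finS in \<open>auto intro: finite_PiE\<close>)
  also have "\<dots> = (\<Sum>z\<in>S \<rightarrow>\<^sub>E {..<r}. F z * measure_pmf.prob P {x. \<forall>u\<in>S. x u = z u})"
  proof (intro sum.cong refl arg_cong2[of _ _ _ _ "(*)"])
    fix z assume z: "z \<in> S \<rightarrow>\<^sub>E {..<r}"
    have "(\<lambda>x. restrict x S) -` {z} = {x. \<forall>u\<in>S. x u = z u}"
    proof (intro set_eqI iffI)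
      fix x assume "x \<in> {x. \<forall>u\<in>S. x u = z u}"
      then have "restrict x S = z" by (intro extensionalityI[of _ S]) (use z in \<open>auto simp: PiE_iff\<close>)
      then show "x \<in> (\<lambda>x. restrict x S) -` {z}" by simp
    qed (auto simp: restrict_def split: if_splits)
    then show "pmf (map_pmf (\<lambda>x. restrict x S) P) z = measure_pmf.prob P {x. \<forall>u\<in>S. x u = z u}"
      by (simp add: pmf_map)
  qed
  finally show ?thesis .
qed

text \<open>The factor counts the value assignments on \<open>S\<close>, each of which is off by at
  most \<delta>. It is affordable only for small \<open>S\<close>; therefore loads are treated by
  moments, whose terms see few points, instead of exponentials, which see all of them.\<close>

lemma biased_space_expectation:
  fixes F :: "('a \<Rightarrow> nat) \<Rightarrow> real"
  assumes P: "biased_space U b w \<delta> P" and U: "finite U" and S: "S \<subseteq> U" "card S \<le> w" and \<delta>: "\<delta> \<ge> 0"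
    and F: "\<And>x y. (\<And>u. u \<in> S \<Longrightarrow> x u = y u) \<Longrightarrow> F x = F y" and F1: "\<And>x. \<bar>F x\<bar> \<le> 1"
  shows "\<bar>measure_pmf.expectation P F - measure_pmf.expectation (uniform_fun U (2 ^ b)) F\<bar>
    \<le> 2 ^ (b * card S) * \<delta>"
proof -
  let ?A = "S \<rightarrow>\<^sub>E {..<2 ^ b :: nat}"
  have finS: "finite S" using U S finite_subset by auto
  have sP: "set_pmf P \<subseteq> U \<rightarrow>\<^sub>E {..<2 ^ b}" using P unfolding biased_space_def by auto
  have sU: "set_pmf (uniform_fun U (2 ^ b)) \<subseteq> U \<rightarrow>\<^sub>E {..<2 ^ b}" using U by (intro set_uniform_fun) auto
  have "measure_pmf.expectation Q F =
    (\<Sum>z\<in>?A. F z * measure_pmf.prob Q {x. \<forall>u\<in>S. x u = z u})"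
    if "set_pmf Q \<subseteq> U \<rightarrow>\<^sub>E {..<2 ^ b}" for Q
    using that U S(1) by (rule expectation_local) (rule F)
  note eq = this[OF sP] this[OF sU]
  have "measure_pmf.expectation P F - measure_pmf.expectation (uniform_fun U (2 ^ b)) F =
    (\<Sum>z\<in>?A. F z * (measure_pmf.prob P {x. \<forall>u\<in>S. x u = z u} - (1 / 2 ^ b) ^ card S))"
    unfolding eq sum_subtractf[symmetric]
    by (intro sum.cong refl, subst uniform_fun_point) (use U S in \<open>auto simp: algebra_simps PiE_iff\<close>)
  also have "\<bar>\<dots>\<bar> \<le> (\<Sum>z\<in>?A. \<delta>)"
  proof (intro order.trans[OF sum_abs] sum_mono)
    fix z assume "z \<in> ?A"
    then have "\<bar>measure_pmf.prob P {x. \<forall>u\<in>S. x u = z u} - (1 / 2 ^ b) ^ card S\<bar> \<le> \<delta>"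
      by (intro biased_space_point[OF P U S _ \<delta>]) auto
    from mult_mono[OF F1[of z] this] show
      "\<bar>F z * (measure_pmf.prob P {x. \<forall>u\<in>S. x u = z u} - (1 / 2 ^ b) ^ card S)\<bar> \<le> \<delta>"
      by (simp add: abs_mult)
  qed
  also have "\<dots> = 2 ^ (b * card S) * \<delta>" using finS by (simp add: card_PiE power_mult)
  finally show ?thesis .
qed

section \<open>Moments of bucket loads under uniform and small-bias functions\<close>

lemma exp_le_quadratic:
  fixes x :: real
  assumes "\<bar>x\<bar> \<le> 1"
  shows "exp x \<le> 1 + x + x\<^sup>2"
proof (cases "x \<ge> 0")
  case True
  then show ?thesis using exp_bound[of x] assms by simp
next
  case False
  define y where "y = -x"
  have y: "y \<ge> 0" using False by (simp add: y_def)
  \<comment> \<open>The quadratic Taylor lower bound of exp y times the claimed bound is at least 1,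
    which is the claim for -y.\<close>
  have "(1 + y + y\<^sup>2 / 2) * (1 - y + y\<^sup>2) = 1 + y ^ 2 / 2 + y ^ 3 / 2 + y ^ 4 / 2"
    by (simp add: field_simps power2_eq_square power3_eq_cube power4_eq_xxxx)
  then have "1 \<le> (1 + y + y\<^sup>2 / 2) * (1 - y + y\<^sup>2)" using y by simp
  also have "\<dots> \<le> exp y * (1 - y + y\<^sup>2)"
  proof (intro mult_right_mono exp_lower_Taylor_quadratic y)
    have "0 \<le> (y - 1 / 2)\<^sup>2" by simp
    then show "0 \<le> 1 - y + y\<^sup>2" by (simp add: power2_eq_square algebra_simps)
  qed
  finally have "1 \<le> exp (- x) * (1 + x + x\<^sup>2)" by (simp add: y_def)
  then have "exp x * 1 \<le> exp x * (exp (- x) * (1 + x + x\<^sup>2))"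
    by (intro mult_left_mono) auto
  also have "\<dots> = 1 + x + x\<^sup>2"
    unfolding mult.assoc[symmetric] exp_minus_inverse by simp
  finally show ?thesis by simp
qed

lemma power_le_fact_exp:
  fixes y :: real
  assumes "y \<ge> 0"
  shows "y ^ p \<le> fact p * exp y"
proof -
  have s: "(\<lambda>n. y ^ n /\<^sub>R fact n) sums exp y" by (rule exp_converges)
  have "(\<Sum>n\<in>{p}. y ^ n /\<^sub>R fact n) \<le> (\<Sum>n. y ^ n /\<^sub>R fact n)"
    using assms by (intro sum_le_suminf sums_summable[OF s]) auto
  then show ?thesis using sums_unique[OF s] by (simp add: field_simps)
qed

text \<open>\<open>deviation r \<tau> S x\<close> is the number of points of \<open>S\<close> at which \<open>x\<close> agrees with \<open>\<tau>\<close>,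
  minus its expectation for a uniformly random \<open>x\<close> with values in \<open>{..<r}\<close>.\<close>

definition deviation :: "nat \<Rightarrow> ('a \<Rightarrow> nat) \<Rightarrow> 'a set \<Rightarrow> ('a \<Rightarrow> nat) \<Rightarrow> real" where
  "deviation r \<tau> S x = (\<Sum>u\<in>S. of_bool (x u = \<tau> u) - 1 / r)"

lemma deviation_eq:
  "finite S \<Longrightarrow> deviation r \<tau> S x = real (card {u \<in> S. x u = \<tau> u}) - card S / r"
  unfolding deviation_def sum_subtractf by (simp add: sum_of_bool_eq Int_def)

text \<open>The contribution of each point is centred, bounded by 1 and has variance at most 1 / r,
  so the quadratic bound on exp costs at most a factor 1 + l^2 / r per point of
  \<open>S\<close>.\<close>

lemma uniform_fun_exp_deviation:
  assumes U: "finite U" "S \<subseteq> U" and r: "\<And>u. u \<in> S \<Longrightarrow> \<tau> u < r" "r > 0"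
    and l: "\<bar>l\<bar> \<le> 1"
  shows "measure_pmf.expectation (uniform_fun U r) (\<lambda>x. exp (l * deviation r \<tau> S x)) \<le> exp (l\<^sup>2 * card S / r)"
proof -
  let ?f = "\<lambda>u v. of_bool (v = \<tau> u) - 1 / real r"
  have one: "measure_pmf.expectation (pmf_of_set {..<r}) (\<lambda>v. exp (l * ?f u v)) \<le> exp (l\<^sup>2 / r)"
    if u: "u \<in> S" for u
  proof -
    have f1: "\<bar>l * ?f u v\<bar> \<le> 1" for v
    proof -
      have "\<bar>?f u v\<bar> \<le> 1" using r by (auto simp: of_bool_def)
      then show ?thesis using l by (simp add: abs_mult mult_le_one)
    qed
    have s1: "(\<Sum>v<r. of_bool (v = \<tau> u) :: real) = 1"
      using r(1)[OF u] by (simp add: of_bool_def)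
    have "(\<Sum>v<r. exp (l * ?f u v)) \<le> (\<Sum>v<r. 1 + l * ?f u v + (l * ?f u v)\<^sup>2)"
      using f1 by (intro sum_mono exp_le_quadratic)
    also have "\<dots> = r + l * (\<Sum>v<r. ?f u v) + l\<^sup>2 * (\<Sum>v<r. (?f u v)\<^sup>2)"
      by (simp add: sum.distrib sum_distrib_left power_mult_distrib)
    also have "(\<Sum>v<r. ?f u v) = 0"
      using r(2) s1 by (simp add: sum_subtractf)
    also have "(\<Sum>v<r. (?f u v)\<^sup>2) = 1 - 1 / r"
    proof -
      have "(?f u v)\<^sup>2 = of_bool (v = \<tau> u) * (1 - 2 / r) + 1 / r ^ 2" for v
        by (auto simp: of_bool_def power2_eq_square algebra_simps)
      then have "(\<Sum>v<r. (?f u v)\<^sup>2) = (\<Sum>v<r. of_bool (v = \<tau> u)) * (1 - 2 / r) + r / r ^ 2"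
        by (simp only: sum.distrib sum_distrib_right) simp
      then show ?thesis using r(2) unfolding s1 by (simp add: power2_eq_square field_simps)
    qed
    also have "real r + l * 0 + l\<^sup>2 * (1 - 1 / r) \<le> r * (1 + l\<^sup>2 / r)"
      using r(2) by (simp add: algebra_simps)
    also have "\<dots> \<le> r * exp (l\<^sup>2 / r)"
      by (intro mult_left_mono exp_ge_add_one_self) auto
    finally show ?thesis
      using r(2) by (subst integral_pmf_of_set) (auto simp: lessThan_empty_iff field_simps)
  qed
  have "exp (l * deviation r \<tau> S x) = (\<Prod>u\<in>U. if u \<in> S then exp (l * ?f u (x u)) else 1)" for x
  proof -
    have "exp (l * deviation r \<tau> S x) = (\<Prod>u\<in>S. exp (l * ?f u (x u)))"
      using finite_subset[OF U(2,1)] by (simp add: deviation_def sum_distrib_left exp_sum)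
    then show ?thesis using U by (simp add: prod.If_cases Int_absorb1)
  qed
  then have "measure_pmf.expectation (uniform_fun U r) (\<lambda>x. exp (l * deviation r \<tau> S x)) =
    measure_pmf.expectation (uniform_fun U r) (\<lambda>x. \<Prod>u\<in>U. (\<lambda>u v. if u \<in> S then exp (l * ?f u v) else 1) u (x u))"
    by simp
  also have "\<dots> = (\<Prod>u\<in>U. measure_pmf.expectation (pmf_of_set {..<r}) (\<lambda>v. if u \<in> S then exp (l * ?f u v) else 1))"
    by (rule expectation_prod_Pi_pmf[OF U(1)])
      (use r(2) in \<open>auto intro!: integrable_measure_pmf_finite simp: lessThan_empty_iff\<close>)
  also have "\<dots> \<le> (\<Prod>u\<in>U. if u \<in> S then exp (l\<^sup>2 / r) else 1)"
    using one by (intro prod_mono) auto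
  also have "\<dots> = exp (l\<^sup>2 / r) ^ card S"
    using U by (simp add: prod.If_cases Int_absorb1)
  also have "\<dots> = exp (l\<^sup>2 * card S / r)" by (simp flip: exp_of_nat_mult add: mult_ac)
  finally show ?thesis .
qed

text \<open>The scale l = 1 / sqrt \<mu> is chosen so that both exponential moments, at l and -l,
  stay below e, hence below 3; their sum is the constant 6. The estimate of y^p by p! exp y, applied
  to the modulus, converts them into a p-th moment, with p^p in place of p!.\<close>

lemma uniform_fun_moment:
  assumes U: "finite U" "S \<subseteq> U" and r: "\<And>u. u \<in> S \<Longrightarrow> \<tau> u < r" "r > 0"
    and p: "even p"
    and \<mu>: "\<mu> \<ge> 1" "real (card S) \<le> r * \<mu>"
  shows "measure_pmf.expectation (uniform_fun U r) (\<lambda>x. deviation r \<tau> S x ^ p) \<le> 6 * (p * sqrt \<mu>) ^ p"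
proof -
  let ?E = "measure_pmf.expectation (uniform_fun U r)"
  define l where "l = 1 / sqrt \<mu>"
  have l: "0 < l" "\<bar>l\<bar> \<le> 1" using \<mu> by (auto simp: l_def)
  have int: "integrable (uniform_fun U r) f" for f :: "('a \<Rightarrow> nat) \<Rightarrow> real"
  proof (rule integrable_measure_pmf_finite)
    show "finite (set_pmf (uniform_fun U r))"
      by (rule finite_subset[OF set_uniform_fun]) (use U r in \<open>auto intro: finite_PiE\<close>)
  qed
  have e3: "?E (\<lambda>x. exp (l' * deviation r \<tau> S x)) \<le> 3" if "\<bar>l'\<bar> = l" for l'
  proof -
    have "?E (\<lambda>x. exp (l' * deviation r \<tau> S x)) \<le> exp (l'\<^sup>2 * card S / r)"
      using that l by (intro uniform_fun_exp_deviation U r) auto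
    also have "l'\<^sup>2 = 1 / \<mu>" using that \<mu> by (metis abs_of_nonneg l_def less_eq_real_def
      order.trans power2_abs power_one_over real_sqrt_pow2 zero_le_one)
    also have "exp (1 / \<mu> * card S / r) \<le> exp 1"
      using \<mu> r by (simp add: field_simps)
    also have "\<dots> \<le> 3" by (rule exp_le)
    finally show ?thesis .
  qed
  have pt: "deviation r \<tau> S x ^ p \<le> fact p * sqrt \<mu> ^ p * (exp (l * deviation r \<tau> S x) + exp (- l * deviation r \<tau> S x))" for x
  proof -
    let ?y = "deviation r \<tau> S x"
    have "(l * ?y) ^ p = \<bar>l * ?y\<bar> ^ p" using p by (simp add: power_even_abs)
    also have "\<dots> \<le> fact p * exp \<bar>l * ?y\<bar>" by (rule power_le_fact_exp) simp
    also have "\<dots> \<le> fact p * (exp (l * ?y) + exp (- l * ?y))"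
      by (intro mult_left_mono) (auto simp: abs_if)
    finally have "(l * ?y) ^ p * sqrt \<mu> ^ p \<le> fact p * (exp (l * ?y) + exp (- l * ?y)) * sqrt \<mu> ^ p"
      using \<mu> by (intro mult_right_mono) auto
    moreover have "(l * ?y) ^ p * sqrt \<mu> ^ p = ?y ^ p"
      unfolding power_mult_distrib[symmetric] using \<mu> by (simp add: l_def)
    ultimately show ?thesis by (simp add: mult_ac)
  qed
  have "?E (\<lambda>x. deviation r \<tau> S x ^ p) \<le>
    ?E (\<lambda>x. fact p * sqrt \<mu> ^ p * (exp (l * deviation r \<tau> S x) + exp (- l * deviation r \<tau> S x)))"
    by (intro integral_mono int pt)
  also have "\<dots> = fact p * sqrt \<mu> ^ p * (?E (\<lambda>x. exp (l * deviation r \<tau> S x)) + ?E (\<lambda>x. exp (- l * deviation r \<tau> S x)))"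
    by (simp add: int)
  also have "\<dots> \<le> fact p * sqrt \<mu> ^ p * (3 + 3)"
    using e3[of l] e3[of "-l"] l \<mu> by (intro mult_left_mono add_mono) auto
  also have "\<dots> \<le> real (p ^ p) * (sqrt \<mu> ^ p * (3 + 3))"
    unfolding mult.assoc using \<mu> by (intro mult_right_mono fact_le_power) auto
  finally show ?thesis by (simp add: power_mult_distrib mult_ac)
qed

text \<open>The \<open>p\<close>-th power of the deviation is a sum of products that depend on at most \<open>p\<close> points each,
  so its expectation is close to the one for a uniform function.\<close>

lemma biased_space_load:
  assumes P: "biased_space U b w \<delta> P" and U: "finite U" "S \<subseteq> U" and \<delta>: "\<delta> \<ge> 0"
    and p: "even p" "p \<le> w" and \<mu>: "\<mu> \<ge> 1" "real (card S) \<le> 2 ^ b * \<mu>" and \<epsilon>: "\<epsilon> > 0" and \<tau>: "\<And>u. u \<in> S \<Longrightarrow> \<tau> u < 2 ^ b"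
  shows "measure_pmf.prob P {x. real (card {u \<in> S. x u = \<tau> u}) > (1 + \<epsilon>) * \<mu>}
    \<le> 6 * (p / (\<epsilon> * sqrt \<mu>)) ^ p + (4 ^ b / \<epsilon>) ^ p * \<delta>"
proof -
  let ?E = "measure_pmf.expectation P" and ?Q = "uniform_fun U (2 ^ b)" and ?D = "deviation (2 ^ b) \<tau> S"
  let ?EQ = "measure_pmf.expectation ?Q"
  let ?T = "{..<p} \<rightarrow>\<^sub>E S"
  have finS: "finite S" using U finite_subset by auto
  have finT: "finite ?T" using finS by (intro finite_PiE) auto
  have fin: "finite (U \<rightarrow>\<^sub>E {..<2 ^ b :: nat})" using U by (intro finite_PiE) auto
  have sP: "set_pmf P \<subseteq> U \<rightarrow>\<^sub>E {..<2 ^ b}" using P unfolding biased_space_def by auto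
  have int: "integrable P f" "integrable ?Q f" for f :: "('a \<Rightarrow> nat) \<Rightarrow> real"
    by (rule integrable_measure_pmf_finite, rule finite_subset[OF _ fin],
        use sP set_uniform_fun[OF U(1), of "2 ^ b"] in simp)+
  define f where "f = (\<lambda>t (x :: 'a \<Rightarrow> nat). \<Prod>i<p. of_bool (x (t i) = \<tau> (t i)) - 1 / real (2 ^ b))"
  have expand: "?D x ^ p = (\<Sum>t\<in>?T. f t x)" for x
  proof -
    have "?D x ^ p = (\<Prod>i<p. \<Sum>u\<in>S. of_bool (x u = \<tau> u) - 1 / real (2 ^ b))"
      by (simp add: deviation_def)
    also have "\<dots> = (\<Sum>t\<in>?T. f t x)"
      unfolding f_def by (rule prod_sum_PiE) (use finS in auto)
    finally show ?thesis .
  qed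
  have "\<bar>?E (f t) - ?EQ (f t)\<bar> \<le> 2 ^ (b * p) * \<delta>" if "t \<in> ?T" for t
  proof -
    have sub: "t ` {..<p} \<subseteq> S" using that by auto
    have cp: "card (t ` {..<p}) \<le> p" using card_image_le[of "{..<p}" t] by simp
    have "\<bar>?E (f t) - ?EQ (f t)\<bar> \<le> 2 ^ (b * card (t ` {..<p})) * \<delta>"
    proof (rule biased_space_expectation[OF P U(1) _ _ \<delta>])
      show "\<bar>f t x\<bar> \<le> 1" for x
        unfolding f_def abs_prod by (intro prod_le_1) (auto simp: of_bool_def)
      show "f t x = f t y" if "\<And>u. u \<in> t ` {..<p} \<Longrightarrow> x u = y u" for x y
        unfolding f_def by (intro prod.cong) (use that in auto)
    qed (use sub cp U p in auto)
    also have "\<dots> \<le> 2 ^ (b * p) * \<delta>"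
      using cp \<delta> by (intro mult_right_mono power_increasing) auto
    finally show ?thesis .
  qed
  then have "(\<Sum>t\<in>?T. ?E (f t) - ?EQ (f t)) \<le> real (card ?T) * (2 ^ (b * p) * \<delta>)"
    by (intro sum_bounded_above) (simp add: abs_le_iff)
  then have "(\<Sum>t\<in>?T. ?E (f t) - ?EQ (f t)) \<le> real (card S) ^ p * (2 ^ (b * p) * \<delta>)"
    by (simp add: card_PiE)
  moreover have "?E (\<lambda>x. ?D x ^ p) - ?EQ (\<lambda>x. ?D x ^ p) = (\<Sum>t\<in>?T. ?E (f t) - ?EQ (f t))"
    unfolding expand by (simp add: int sum_subtractf)
  moreover have "?EQ (\<lambda>x. ?D x ^ p) \<le> 6 * (p * sqrt \<mu>) ^ p"
    using \<mu> p U \<tau> by (intro uniform_fun_moment) auto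
  moreover have "real (card S) ^ p * (2 ^ (b * p) * \<delta>) \<le> (2 ^ b * \<mu>) ^ p * (2 ^ (b * p) * \<delta>)"
    using \<mu> \<delta> by (intro mult_right_mono power_mono) auto
  ultimately have main: "?E (\<lambda>x. ?D x ^ p) \<le> 6 * (p * sqrt \<mu>) ^ p + (2 ^ b * \<mu>) ^ p * (2 ^ (b * p) * \<delta>)"
    by linarith
  let ?B = "{x. real (card {u \<in> S. x u = \<tau> u}) > (1 + \<epsilon>) * \<mu>}"
  have em: "\<epsilon> * \<mu> > 0" using \<epsilon> \<mu> by simp
  \<comment> \<open>Markov's inequality for the p-th power; as \<open>p\<close> is even, the
    right-hand side is nonnegative off the event as well.\<close>
  have "indicator ?B x \<le> ?D x ^ p / (\<epsilon> * \<mu>) ^ p" for x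
  proof (cases "x \<in> ?B")
    case True
    have "card S / 2 ^ b \<le> \<mu>" using \<mu> by (simp add: field_simps)
    then have "\<epsilon> * \<mu> \<le> ?D x" using True by (simp add: deviation_eq[OF finS] algebra_simps)
    then have "(\<epsilon> * \<mu>) ^ p \<le> ?D x ^ p" using em by (intro power_mono) auto
    then show ?thesis using em True by simp
  next
    case False
    have "?D x ^ p / (\<epsilon> * \<mu>) ^ p \<ge> 0"
      using em p by (intro divide_nonneg_nonneg zero_le_even_power) auto
    then show ?thesis using False by simp
  qed
  then have "?E (indicator ?B) \<le> ?E (\<lambda>x. ?D x ^ p / (\<epsilon> * \<mu>) ^ p)"
    by (intro integral_mono int)
  then have "measure_pmf.prob P ?B \<le> ?E (\<lambda>x. ?D x ^ p) / (\<epsilon> * \<mu>) ^ p" by simp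
  also have "\<dots> \<le> (6 * (p * sqrt \<mu>) ^ p + (2 ^ b * \<mu>) ^ p * (2 ^ (b * p) * \<delta>)) / (\<epsilon> * \<mu>) ^ p"
    using em main by (intro divide_right_mono) auto
  also have "\<dots> = 6 * (p * sqrt \<mu> / (\<epsilon> * \<mu>)) ^ p + (2 ^ b * \<mu> * 2 ^ b / (\<epsilon> * \<mu>)) ^ p * \<delta>"
    by (simp add: add_divide_distrib power_mult_distrib power_divide power_mult)
  also have "p * sqrt \<mu> / (\<epsilon> * \<mu>) = p / (\<epsilon> * sqrt \<mu>)"
    using \<mu> \<epsilon> by (simp add: field_simps)
  also have "2 ^ b * \<mu> * 2 ^ b / (\<epsilon> * \<mu>) = 4 ^ b / \<epsilon>"
    using \<mu> by (simp flip: power_mult_distrib)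
  finally show ?thesis .
qed

section \<open>Short seeds\<close>

lemma uniform_fun_eq: 
  assumes "finite U" "r > 0"
  shows "uniform_fun U r = pmf_of_set (U \<rightarrow>\<^sub>E {..<r})"
proof -
  have "PiE_dflt U undefined (\<lambda>_. {..<r}) = U \<rightarrow>\<^sub>E {..<r}"
    by (auto simp: PiE_dflt_def extensional_def)
  then show ?thesis using assms by (subst Pi_pmf_of_set) (auto simp: lessThan_empty_iff)
qed

lemma uniform_fun_character:
  assumes U: "finite U" and \<alpha>: "\<alpha> \<in> U \<rightarrow>\<^sub>E {..<2 ^ b}" "char_support U \<alpha> \<noteq> {}"
  shows "measure_pmf.expectation (uniform_fun U (2 ^ b)) (character U \<alpha>) = 0"
proof -
  have fin: "finite (U \<rightarrow>\<^sub>E {..<2 ^ b :: nat})" using U by (intro finite_PiE) auto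
  obtain u where u: "u \<in> U" "\<alpha> u \<noteq> 0" using \<alpha>(2) by (auto simp: char_support_def)
  have "(\<Sum>v<2 ^ b. bit_character (\<alpha> u) v) = (\<Sum>v<2 ^ b. bit_character v (\<alpha> u) * bit_character v 0)"
    by (simp add: bit_character_def conj_commute)
  also have "\<dots> = 0" using u \<alpha>(1) by (subst sum_bit_character) auto
  finally have "(\<Prod>u\<in>U. \<Sum>v<2 ^ b. bit_character (\<alpha> u) v) = 0"
    using u(1) U by (auto intro!: prod_zero)
  moreover have "(\<Prod>u\<in>U. \<Sum>v<2 ^ b. bit_character (\<alpha> u) v) = (\<Sum>x\<in>U \<rightarrow>\<^sub>E {..<2 ^ b}. character U \<alpha> x)"
    unfolding character_eq using U by (intro prod_sum_PiE) auto
  ultimately show ?thesis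
    using U fin by (simp add: uniform_fun_eq integral_pmf_of_set PiE_eq_empty_iff lessThan_empty_iff)
qed

lemma abs_character [simp]: "\<bar>character U \<alpha> x\<bar> = 1"
  by (simp add: character_eq abs_prod)

abbreviation bit_strings :: "nat \<Rightarrow> bool list set" where
  "bit_strings s \<equiv> {bs. length bs = s}"

lemma card_bit_strings: "finite (bit_strings s)" "card (bit_strings s) = 2 ^ s"
  using finite_lists_length_eq[of "UNIV :: bool set" s] card_lists_length_eq[of "UNIV :: bool set" s]
  by (auto simp: card_UNIV_bool)

lemma bit_strings_nonempty: "bit_strings s \<noteq> {}"
  using card_bit_strings[of s] by (metis card.empty power_not_zero zero_neq_numeral)

text \<open>An exponential moment bound with parameter l = \<delta> / 2: a nontrivial character has
  mean 0 and square 1, so each sample costs exp(l^2) and gains exp(-l \<delta>). The sign \<sigma>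
  covers both tails.\<close>

lemma sample_average_tail:
  fixes \<delta> \<sigma> :: real
  assumes U: "finite U" and \<alpha>: "\<alpha> \<in> U \<rightarrow>\<^sub>E {..<2 ^ b}" "char_support U \<alpha> \<noteq> {}"
    and \<delta>: "0 < \<delta>" "\<delta> \<le> 1" and I: "finite I" and \<sigma>: "\<bar>\<sigma>\<bar> = 1"
  shows "measure_pmf.prob (Pi_pmf I undefined (\<lambda>_. uniform_fun U (2 ^ b)))
    {\<Psi>. \<sigma> * (\<Sum>i\<in>I. character U \<alpha> (\<Psi> i)) \<ge> \<delta> * card I} \<le> exp (- (\<delta>\<^sup>2 / 4 * card I))"
proof -
  let ?Q = "uniform_fun U (2 ^ b)" and ?c = "character U \<alpha>"
  let ?M = "Pi_pmf I undefined (\<lambda>_. ?Q)"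
  define l where "l = \<delta> / 2"
  have fin: "finite (U \<rightarrow>\<^sub>E {..<2 ^ b :: nat})" using U by (intro finite_PiE) auto
  have finQ: "finite (set_pmf ?Q)" using set_uniform_fun[OF U, of "2 ^ b"] fin finite_subset by auto
  have finM: "finite (set_pmf ?M)" using I finQ by (auto simp: set_Pi_pmf)
  have int: "integrable ?Q f" "integrable ?M g" for f g :: "_ \<Rightarrow> real"
    using finQ finM by (auto intro: integrable_measure_pmf_finite)
  let ?S = "\<lambda>\<Psi>. \<sigma> * (\<Sum>i\<in>I. ?c (\<Psi> i))"
  have one: "measure_pmf.expectation ?Q (\<lambda>x. exp (l * \<sigma> * ?c x)) \<le> exp (l\<^sup>2)"
  proof -
    have abs: "\<bar>l * \<sigma> * ?c x\<bar> = l" for x using \<sigma> \<delta> by (simp add: abs_mult l_def)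
    have "measure_pmf.expectation ?Q (\<lambda>x. exp (l * \<sigma> * ?c x)) \<le>
      measure_pmf.expectation ?Q (\<lambda>x. 1 + l * \<sigma> * ?c x + l\<^sup>2)"
    proof (intro integral_mono int)
      fix x
      have "exp (l * \<sigma> * ?c x) \<le> 1 + l * \<sigma> * ?c x + (l * \<sigma> * ?c x)\<^sup>2"
        using abs \<delta> by (intro exp_le_quadratic) (simp add: l_def)
      also have "(l * \<sigma> * ?c x)\<^sup>2 = l\<^sup>2" by (metis abs power2_abs)
      finally show "exp (l * \<sigma> * ?c x) \<le> 1 + l * \<sigma> * ?c x + l\<^sup>2" .
    qed
    also have "\<dots> = 1 + l\<^sup>2" using uniform_fun_character[OF U \<alpha>] by (simp add: int)
    also have "\<dots> \<le> exp (l\<^sup>2)" by (rule exp_ge_add_one_self)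
    finally show ?thesis .
  qed
  have "measure_pmf.prob ?M {\<Psi>. ?S \<Psi> \<ge> \<delta> * card I} =
    measure_pmf.expectation ?M (indicator {\<Psi>. ?S \<Psi> \<ge> \<delta> * card I})" by simp
  also have "\<dots> \<le> measure_pmf.expectation ?M (\<lambda>\<Psi>. exp (- l * \<delta> * card I) * exp (l * ?S \<Psi>))"
  proof (intro integral_mono int)
    fix \<Psi>
    show "indicator {\<Psi>. ?S \<Psi> \<ge> \<delta> * card I} \<Psi> \<le> exp (- l * \<delta> * card I) * exp (l * ?S \<Psi>)"
    proof (cases "?S \<Psi> \<ge> \<delta> * card I")
      case True
      then have "l * (\<delta> * card I) \<le> l * ?S \<Psi>" using \<delta> by (intro mult_left_mono) (auto simp: l_def)
      then show ?thesis using True by (simp flip: exp_add)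
    qed auto
  qed
  also have "\<dots> = exp (- l * \<delta> * card I) * measure_pmf.expectation ?M (\<lambda>\<Psi>. \<Prod>i\<in>I. exp (l * \<sigma> * ?c (\<Psi> i)))"
    using I by (simp add: exp_sum sum_distrib_left mult_ac)
  also have "measure_pmf.expectation ?M (\<lambda>\<Psi>. \<Prod>i\<in>I. exp (l * \<sigma> * ?c (\<Psi> i))) =
    (\<Prod>i\<in>I. measure_pmf.expectation ?Q (\<lambda>x. exp (l * \<sigma> * ?c x)))"
    by (rule expectation_prod_Pi_pmf[OF I]) (auto intro: int)
  also have "\<dots> \<le> (\<Prod>i\<in>I. exp (l\<^sup>2))" using one by (intro prod_mono) auto
  also have "\<dots> = exp (card I * l\<^sup>2)" by (simp add: exp_of_nat_mult)
  finally have "measure_pmf.prob ?M {\<Psi>. ?S \<Psi> \<ge> \<delta> * card I} \<le> exp (- l * \<delta> * card I) * exp (card I * l\<^sup>2)"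
    by simp
  also have "\<dots> = exp (- (\<delta>\<^sup>2 / 4 * card I))"
    by (simp flip: exp_add add: l_def power2_eq_square field_simps)
  finally show ?thesis .
qed

text \<open>Probabilistic method: a table of 2^s independent uniform functions, with the seed as the
  position in the table. The condition on \<open>s\<close> makes each tail at most exp(-(b |U| +
  2)), which beats the union over both signs and all of the at most 2^(b |U|) nontrivial characters,
  so that every \<open>w\<close> is served at once. A table that merely exists is enough since
  \<open>sampled_with_bits\<close> counts seed bits only.\<close>

lemma biased_space_exists:
  assumes U: "finite U" and \<delta>: "0 < \<delta>" "\<delta> \<le> 1"
    and s: "4 * (real b * card U + 2) \<le> \<delta>\<^sup>2 * 2 ^ s"
  shows "\<exists>P. biased_space U b w \<delta> P \<and> sampled_with_bits s P"
proof -
  let ?I = "bit_strings s"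
  let ?Q = "uniform_fun U (2 ^ b)"
  let ?M = "Pi_pmf ?I undefined (\<lambda>_. ?Q)"
  let ?A = "{\<alpha> \<in> U \<rightarrow>\<^sub>E {..<2 ^ b}. char_support U \<alpha> \<noteq> {}}"
  define B where "B = (\<lambda>(\<alpha>, \<sigma>). {\<Psi>. \<sigma> * (\<Sum>i\<in>?I. character U \<alpha> (\<Psi> i)) \<ge> \<delta> * card ?I})"
  let ?J = "?A \<times> {1, -1 :: real}"
  have fin: "finite (U \<rightarrow>\<^sub>E {..<2 ^ b :: nat})" using U by (intro finite_PiE) auto
  then have finA: "finite ?A" by simp
  have "card ?A \<le> card (U \<rightarrow>\<^sub>E {..<2 ^ b :: nat})" using fin by (intro card_mono) auto
  also have "\<dots> = 2 ^ (b * card U)" using U by (simp add: card_PiE power_mult)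
  finally have "real (card ?A) \<le> real (2 ^ (b * card U))" by (rule of_nat_mono)
  then have cA: "real (card ?A) \<le> 2 ^ (b * card U)" by simp
  have "measure_pmf.prob ?M (\<Union>j\<in>?J. B j) \<le> (\<Sum>j\<in>?J. measure_pmf.prob ?M (B j))"
    using finA by (intro measure_pmf.finite_measure_subadditive_finite) auto
  also have "\<dots> \<le> (\<Sum>j\<in>?J. exp (- (\<delta>\<^sup>2 / 4 * card ?I)))"
  proof (rule sum_mono)
    fix j assume "j \<in> ?J"
    then obtain \<alpha> \<sigma> where "j = (\<alpha>, \<sigma>)" "\<alpha> \<in> ?A" "\<sigma> \<in> {1, -1}" by blast
    then have j: "j = (\<alpha>, \<sigma>)" "\<alpha> \<in> U \<rightarrow>\<^sub>E {..<2 ^ b}" "char_support U \<alpha> \<noteq> {}" "\<bar>\<sigma>\<bar> = 1" by auto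
    show "measure_pmf.prob ?M (B j) \<le> exp (- (\<delta>\<^sup>2 / 4 * card ?I))"
      unfolding B_def j(1) prod.case by (rule sample_average_tail[OF U j(2,3) \<delta> card_bit_strings(1) j(4)])
  qed
  also have "\<dots> = 2 * card ?A * exp (- (\<delta>\<^sup>2 / 4 * card ?I))"
    using finA by (simp add: card_cartesian_product)
  also have "\<dots> \<le> 2 * 2 ^ (b * card U) * exp (- (real b * card U + 2))"
    using cA s card_bit_strings(2)[of s] by (intro mult_mono) auto
  also have "\<dots> < 1"
  proof -
    have "exp 1 \<ge> (2::real)" using exp_ge_add_one_self[of 1] by simp
    then have "(2::real) ^ (b * card U + 1) \<le> exp 1 ^ (b * card U + 1)" by (intro power_mono) auto
    also have "\<dots> = exp (real (b * card U + 1) * 1)" by (rule exp_of_nat_mult[symmetric])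
    also have "\<dots> = exp (real b * card U + 1)" by simp
    also have "\<dots> < exp (real b * card U + 2)" by simp
    finally have "2 * 2 ^ (b * card U) * exp (- (real b * card U + 2)) <
      exp (real b * card U + 2) * exp (- (real b * card U + 2))"
      by (intro mult_strict_right_mono) auto
    then show ?thesis unfolding exp_minus_inverse .
  qed
  finally have less: "measure_pmf.prob ?M (\<Union>j\<in>?J. B j) < 1" .
  have "\<exists>\<Psi>\<in>set_pmf ?M. \<Psi> \<notin> (\<Union>j\<in>?J. B j)"
  proof (rule ccontr)
    assume "\<not> ?thesis"
    then have "measure_pmf.prob ?M (\<Union>j\<in>?J. B j) = 1"
      by (subst measure_pmf.prob_eq_1) (auto simp: AE_measure_pmf_iff)
    then show False using less by simp
  qed
  then obtain \<Psi> where \<Psi>: "\<Psi> \<in> set_pmf ?M" "\<And>\<alpha> \<sigma>. \<alpha> \<in> ?A \<Longrightarrow> \<sigma> \<in> {1, -1} \<Longrightarrow> \<Psi> \<notin> B (\<alpha>, \<sigma>)"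
    by blast
  define P where "P = map_pmf \<Psi> (pmf_of_set ?I)"
  have "\<Psi> i \<in> U \<rightarrow>\<^sub>E {..<2 ^ b}" if "i \<in> ?I" for i
    using \<Psi>(1) that set_uniform_fun[OF U, of "2 ^ b"] card_bit_strings(1)[of s]
    by (auto simp: set_Pi_pmf PiE_dflt_def)
  then have supp: "set_pmf P \<subseteq> U \<rightarrow>\<^sub>E {..<2 ^ b}"
    using card_bit_strings(1) bit_strings_nonempty unfolding P_def by (auto simp: set_pmf_of_set)
  have "\<bar>measure_pmf.expectation P (character U \<alpha>)\<bar> \<le> \<delta>" if "\<alpha> \<in> ?A" for \<alpha>
  proof -
    have "\<bar>\<Sum>i\<in>?I. character U \<alpha> (\<Psi> i)\<bar> \<le> \<delta> * card ?I"
      using \<Psi>(2)[OF that, of 1] \<Psi>(2)[OF that, of "-1"] unfolding B_def by auto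
    moreover have "measure_pmf.expectation P (character U \<alpha>) = (\<Sum>i\<in>?I. character U \<alpha> (\<Psi> i)) / card ?I"
      unfolding P_def using card_bit_strings(1) bit_strings_nonempty by (simp add: integral_pmf_of_set)
    ultimately show ?thesis using card_bit_strings(2)[of s] by (simp add: abs_divide pos_divide_le_eq)
  qed
  then have "biased_space U b w \<delta> P" using supp unfolding biased_space_def by auto
  then show ?thesis unfolding P_def sampled_with_bits_def by blast
qed

section \<open>Seeds of composed samplers and exact limited independence\<close>

lemma sampled_map: "sampled_with_bits s P \<Longrightarrow> sampled_with_bits s (map_pmf f P)"
  unfolding sampled_with_bits_def by (metis pmf.map_comp)

lemma sampled_return: "sampled_with_bits 0 (return_pmf x)"
proof -
  have "pmf_of_set (bit_strings 0) = return_pmf []" by (simp add: pmf_of_set_singleton)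
  then show ?thesis unfolding sampled_with_bits_def by (intro exI[of _ "\<lambda>_. x"]) simp
qed

lemma sampled_pair:
  assumes "sampled_with_bits s P" "sampled_with_bits s' P'"
  shows "sampled_with_bits (s + s') (pair_pmf P P')"
proof -
  obtain F F' where F: "P = map_pmf F (pmf_of_set (bit_strings s))" "P' = map_pmf F' (pmf_of_set (bit_strings s'))"
    using assms unfolding sampled_with_bits_def by blast
  have bij: "bij_betw (\<lambda>bs. (take s bs, drop s bs)) (bit_strings (s + s')) (bit_strings s \<times> bit_strings s')"
    by (rule bij_betwI[of _ _ _ "\<lambda>(x, y). x @ y"]) auto
  have "pair_pmf P P' = map_pmf (\<lambda>(x, y). (F x, F' y)) (pair_pmf (pmf_of_set (bit_strings s)) (pmf_of_set (bit_strings s')))"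
    unfolding F by (simp add: map_pair)
  also have "pair_pmf (pmf_of_set (bit_strings s)) (pmf_of_set (bit_strings s')) = pmf_of_set (bit_strings s \<times> bit_strings s')"
    using card_bit_strings(1) bit_strings_nonempty
    by (intro pmf_eqI) (auto simp: pmf_pair indicator_def card_cartesian_product)
  also have "\<dots> = map_pmf (\<lambda>bs. (take s bs, drop s bs)) (pmf_of_set (bit_strings (s + s')))"
    using card_bit_strings(1) bit_strings_nonempty by (intro map_pmf_of_set_bij_betw[OF bij, symmetric])
  finally show ?thesis unfolding sampled_with_bits_def by (auto simp: pmf.map_comp)
qed

lemma sampled_Pi:
  assumes "finite A" "\<And>i. i \<in> A \<Longrightarrow> sampled_with_bits (s i) (P i)"
  shows "sampled_with_bits (\<Sum>i\<in>A. s i) (Pi_pmf A dflt P)"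
  using assms
proof (induction A)
  case empty
  then show ?case by (simp add: sampled_return)
next
  case (insert i A)
  then show ?case by (simp add: Pi_pmf_insert sampled_map sampled_pair)
qed

text \<open>With bias 0 the error in \<open>biased_space_point\<close> vanishes, so every
  restriction to at most \<open>kg\<close> points is exactly uniform.\<close>

lemma kwise_independent_of_unbiased:
  assumes "biased_space U l kg 0 G" "finite U"
  shows "kwise_independent U (2 ^ l) kg G"
  unfolding kwise_independent_def
proof (intro conjI allI impI)
  show sG: "set_pmf G \<subseteq> U \<rightarrow>\<^sub>E {..<2 ^ l}" using assms(1) unfolding biased_space_def by simp
  fix S assume S: "S \<subseteq> U \<and> card S \<le> kg"
  then have finS: "finite S" using assms(2) finite_subset by auto
  have fin: "finite (S \<rightarrow>\<^sub>E {..<2 ^ l :: nat})" using finS by (intro finite_PiE) auto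
  show "map_pmf (\<lambda>f. restrict f S) G = pmf_of_set (S \<rightarrow>\<^sub>E {..<2 ^ l})"
  proof (rule pmf_eqI)
    fix z
    show "pmf (map_pmf (\<lambda>f. restrict f S) G) z = pmf (pmf_of_set (S \<rightarrow>\<^sub>E {..<2 ^ l})) z"
    proof (cases "z \<in> S \<rightarrow>\<^sub>E {..<2 ^ l}")
      case True
      have "(\<lambda>x. restrict x S) -` {z} = {x. \<forall>u\<in>S. x u = z u}"
      proof (intro set_eqI iffI)
        fix x assume "x \<in> {x. \<forall>u\<in>S. x u = z u}"
        then have "restrict x S = z" by (intro extensionalityI[of _ S]) (use True in \<open>auto simp: PiE_iff\<close>)
        then show "x \<in> (\<lambda>x. restrict x S) -` {z}" by simp
      qed (auto simp: restrict_def split: if_splits)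
      then have "pmf (map_pmf (\<lambda>f. restrict f S) G) z = measure_pmf.prob G {x. \<forall>u\<in>S. x u = z u}"
        by (simp add: pmf_map)
      also have "\<dots> = (1 / 2 ^ l) ^ card S"
        using biased_space_point[OF assms, of S z] S True by auto
      also have "\<dots> = pmf (pmf_of_set (S \<rightarrow>\<^sub>E {..<2 ^ l})) z"
        using True fin finS by (subst pmf_of_set) (auto simp: card_PiE power_one_over)
      finally show ?thesis .
    next
      case False
      have "z \<notin> set_pmf (map_pmf (\<lambda>f. restrict f S) G)"
      proof
        assume "z \<in> set_pmf (map_pmf (\<lambda>f. restrict f S) G)"
        then obtain x where x: "x \<in> set_pmf G" "z = restrict x S" by auto
        then show False using subsetD[OF sG x(1)] S False by (auto simp: PiE_iff)
      qed
      then have "pmf (map_pmf (\<lambda>f. restrict f S) G) z = 0" by (simp add: pmf_eq_0_set_pmf)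
      moreover have "S \<rightarrow>\<^sub>E {..<2 ^ l :: nat} \<noteq> {}" by (simp add: PiE_eq_empty_iff lessThan_empty_iff)
      ultimately show ?thesis using False fin by simp
    qed
  qed
qed

text \<open>An index of larger support arises from one of smaller support by overwriting a single
  coordinate, which multiplies the count by at most 1 + |U| r.\<close>

lemma card_small_support:
  assumes U: "finite U" and r: "r > 0"
  shows "finite {\<alpha> \<in> U \<rightarrow>\<^sub>E {..<r}. card (char_support U \<alpha>) \<le> w} \<and>
    card {\<alpha> \<in> U \<rightarrow>\<^sub>E {..<r}. card (char_support U \<alpha>) \<le> w} \<le> (1 + card U * r) ^ w"
proof (induction w)
  have fin: "finite (U \<rightarrow>\<^sub>E {..<r})" using U by (intro finite_PiE) auto
  let ?S = "\<lambda>w. {\<alpha> \<in> U \<rightarrow>\<^sub>E {..<r}. card (char_support U \<alpha>) \<le> w}"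
  have finS: "finite (?S w)" for w using fin by simp
  have finsup: "finite (char_support U \<alpha>)" for \<alpha> using U by (simp add: char_support_def)
  {
    case 0
    have "?S 0 \<subseteq> {\<lambda>u\<in>U. 0}"
    proof
      fix \<alpha> assume \<alpha>: "\<alpha> \<in> ?S 0"
      then have "char_support U \<alpha> = {}" using finsup by simp
      then have "\<alpha> u = 0" if "u \<in> U" for u using that by (auto simp: char_support_def)
      then show "\<alpha> \<in> {\<lambda>u\<in>U. 0}" using \<alpha> by (auto intro!: PiE_ext[of _ U])
    qed
    then show ?case using finS[of 0] card_mono[of "{\<lambda>u\<in>U. 0 :: nat}" "?S 0"] by simp
  next
    case (Suc w)
    let ?g = "\<lambda>(\<alpha>, u, v). \<alpha>(u := v)"
    have "?S (Suc w) \<subseteq> ?S w \<union> ?g ` (?S w \<times> U \<times> {..<r})"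
    proof
      fix \<alpha> assume \<alpha>: "\<alpha> \<in> ?S (Suc w)"
      show "\<alpha> \<in> ?S w \<union> ?g ` (?S w \<times> U \<times> {..<r})"
      proof (cases "card (char_support U \<alpha>) \<le> w")
        case False
        then have "char_support U \<alpha> \<noteq> {}" by auto
        then obtain u where u: "u \<in> char_support U \<alpha>" by blast
        then have uU: "u \<in> U" by (simp add: char_support_def)
        have sup: "char_support U (\<alpha>(u := 0)) = char_support U \<alpha> - {u}" by (auto simp: char_support_def)
        have "card (char_support U (\<alpha>(u := 0))) \<le> w"
          unfolding sup using \<alpha> u finsup by auto
        moreover have "\<alpha>(u := 0) \<in> U \<rightarrow>\<^sub>E {..<r}"
          using \<alpha> uU r by (auto simp: PiE_iff extensional_def)
        moreover have "\<alpha> u < r" using \<alpha> uU by auto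
        ultimately have "(\<alpha>(u := 0), u, \<alpha> u) \<in> ?S w \<times> U \<times> {..<r}" using uU by simp
        moreover have "?g (\<alpha>(u := 0), u, \<alpha> u) = \<alpha>" by simp
        ultimately show ?thesis by (metis (no_types, lifting) UnI2 image_eqI)
      qed (use \<alpha> in auto)
    qed
    then have "card (?S (Suc w)) \<le> card (?S w \<union> ?g ` (?S w \<times> U \<times> {..<r}))"
      using finS U by (intro card_mono finite_UnI finite_imageI finite_cartesian_product) auto
    also have "\<dots> \<le> card (?S w) + card (?g ` (?S w \<times> U \<times> {..<r}))" by (rule card_Un_le)
    also have "card (?g ` (?S w \<times> U \<times> {..<r})) \<le> card (?S w \<times> U \<times> {..<r})"
      using finS U by (intro card_image_le finite_cartesian_product) auto
    also have "\<dots> = card (?S w) * (card U * r)" by (simp add: card_cartesian_product)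
    also have "card (?S w) + card (?S w) * (card U * r) = card (?S w) * (1 + card U * r)"
      by (simp add: algebra_simps)
    also have "\<dots> \<le> (1 + card U * r) ^ w * (1 + card U * r)"
      using Suc by (intro mult_right_mono) auto
    finally have "card (?S (Suc w)) \<le> (1 + card U * r) ^ Suc w" by (simp add: mult.commute)
    then show ?case using finS by simp
  }
qed

text \<open>Bit \<open>t\<close> of the value at \<open>u\<close> is the inner product of the seed \<open>D\<close> with a vector \<open>v (u, t)\<close>. A
  character of this space is unbiased unless the vectors in its support sum up to zero, and
  a counting argument provides vectors avoiding this for all small supports.\<close>

lemma unbiased_space_exists:
  fixes U :: "'a set"
  assumes U: "finite U" and s: "(1 + card U * 2 ^ l) ^ kg < 2 ^ s"
  shows "\<exists>G. biased_space U l kg 0 G \<and> sampled_with_bits s G"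
proof -
  define I where "I = U \<times> {..<l}"
  define X where "X = (I \<rightarrow>\<^sub>E Pow {..<s})"
  define A where "A = (\<lambda>\<alpha> :: 'a \<Rightarrow> nat. SIGMA u : U. {t. bit (\<alpha> u) t})"
  define S where "S = {\<alpha> \<in> U \<rightarrow>\<^sub>E {..<2 ^ l}. card (char_support U \<alpha>) \<le> kg \<and> char_support U \<alpha> \<noteq> {}}"
  define sg where "sg = (\<lambda>\<alpha> v (i :: nat). \<Prod>e\<in>A \<alpha>. if i \<in> v e then -1 else 1 :: real)"
  define bad where "bad = (\<lambda>\<alpha>. {v \<in> X. \<forall>i<s. sg \<alpha> v i = 1})"
  have finI: "finite I" using U by (simp add: I_def)
  have finX: "finite X" unfolding X_def using finI by (intro finite_PiE) auto
  have cX: "card X = (2 ^ s) ^ card I" unfolding X_def using finI by (simp add: card_PiE card_Pow)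
  have finA: "finite (A \<alpha>)" for \<alpha> unfolding A_def using U by auto
  have AI: "A \<alpha> \<subseteq> I" "A \<alpha> \<noteq> {}" if "\<alpha> \<in> S" for \<alpha>
  proof -
    show "A \<alpha> \<subseteq> I" using that unfolding A_def I_def S_def by (auto dest: bit_nat_less[rotated])
    have "char_support U \<alpha> \<noteq> {}" using that unfolding S_def by blast
    then obtain u where u: "u \<in> U" "\<alpha> u \<noteq> 0" unfolding char_support_def by blast
    then obtain t where "bit (\<alpha> u) t" by (metis bit_0_eq bit_eqI bot_apply bot_bool_def)
    then show "A \<alpha> \<noteq> {}" using u unfolding A_def by auto
  qed
  \<comment> \<open>For one \<open>e\<close> in the support, the sign conditions at the
    \<open>s\<close> seed positions determine \<open>v e\<close> from the other vectors. So \<alpha>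
    rules out at most a 2^(-s) fraction of all choices, and fewer than 2^s indices have to be
    avoided.\<close>
  have cbad: "card (bad \<alpha>) * 2 ^ s \<le> card X" if \<alpha>: "\<alpha> \<in> S" for \<alpha>
  proof -
    obtain e where e: "e \<in> A \<alpha>" using AI(2)[OF \<alpha>] by blast
    have inj: "inj_on (\<lambda>v. restrict v (I - {e})) (bad \<alpha>)"
    proof (rule inj_onI)
      fix v v' assume v: "v \<in> bad \<alpha>" "v' \<in> bad \<alpha>" "restrict v (I - {e}) = restrict v' (I - {e})"
      have off: "v x = v' x" if "x \<in> I" "x \<noteq> e" for x
        using v(3) that by (metis DiffI empty_iff insert_iff restrict_apply')
      have "i \<in> v e \<longleftrightarrow> i \<in> v' e" for i
      proof (cases "i < s")
        case True
        let ?r = "\<lambda>v. \<Prod>e\<in>A \<alpha> - {e}. if i \<in> v e then -1 else 1 :: real"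
        have "sg \<alpha> v i = (if i \<in> v e then -1 else 1) * ?r v" "sg \<alpha> v' i = (if i \<in> v' e then -1 else 1) * ?r v'"
          unfolding sg_def by (rule prod.remove[OF finA e])+
        moreover have "?r v = ?r v'" using off AI(1)[OF \<alpha>] by (intro prod.cong) auto
        moreover have "sg \<alpha> v i = 1" "sg \<alpha> v' i = 1" using v True unfolding bad_def by auto
        ultimately show ?thesis by (auto split: if_splits)
      next
        case False
        have "v e \<subseteq> {..<s}" "v' e \<subseteq> {..<s}"
          using v(1,2) e AI(1)[OF \<alpha>] unfolding bad_def X_def by (auto simp: PiE_iff)
        then show ?thesis using False by auto
      qed
      then have "v e = v' e" by blast
      then show "v = v'" using off v(1,2) unfolding bad_def X_def by (auto intro!: PiE_ext[of _ I])
    qed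
    have "card (bad \<alpha>) \<le> card ((I - {e}) \<rightarrow>\<^sub>E Pow {..<s})"
    proof (rule card_inj_on_le[OF inj])
      show "(\<lambda>v. restrict v (I - {e})) ` bad \<alpha> \<subseteq> (I - {e}) \<rightarrow>\<^sub>E Pow {..<s}"
        unfolding bad_def X_def by (rule image_subsetI) (simp add: PiE_iff)
    qed (use finI in \<open>auto intro!: finite_PiE\<close>)
    also have "\<dots> = (2 ^ s) ^ (card I - 1)"
      using finI e AI(1)[OF \<alpha>] by (subst card_PiE) (auto simp: card_Pow)
    finally have "card (bad \<alpha>) * 2 ^ s \<le> (2 ^ s) ^ (card I - 1) * 2 ^ s" by (rule mult_le_mono1)
    also have "card I > 0" using e AI(1)[OF \<alpha>] finI card_gt_0_iff by blast
    then have "(2 ^ s) ^ (card I - 1) * 2 ^ s = card X" unfolding cX by (metis mult.commute power_minus_mult)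
    finally show ?thesis .
  qed
  have finS: "finite S" and cS: "card S < 2 ^ s"
  proof -
    note * = card_small_support[OF U, of "2 ^ l" kg]
    have sub: "S \<subseteq> {\<alpha> \<in> U \<rightarrow>\<^sub>E {..<2 ^ l}. card (char_support U \<alpha>) \<le> kg}" unfolding S_def by auto
    show "finite S" using * sub finite_subset by auto
    have "card S \<le> (1 + card U * 2 ^ l) ^ kg" using * card_mono[OF _ sub] by auto
    then show "card S < 2 ^ s" using s by simp
  qed
  have "card (\<Union>\<alpha>\<in>S. bad \<alpha>) < card X"
  proof -
    have "card (\<Union>\<alpha>\<in>S. bad \<alpha>) * 2 ^ s \<le> (\<Sum>\<alpha>\<in>S. card (bad \<alpha>)) * 2 ^ s"
      by (intro mult_le_mono1 card_UN_le finS)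
    also have "\<dots> \<le> (\<Sum>\<alpha>\<in>S. card X)" unfolding sum_distrib_right by (intro sum_mono cbad)
    also have "\<dots> = card S * card X" by simp
    also have "\<dots> < 2 ^ s * card X" using cS cX by simp
    finally show ?thesis by simp
  qed
  moreover have "finite (\<Union>\<alpha>\<in>S. bad \<alpha>)" using finS finX unfolding bad_def by auto
  ultimately have "\<not> X \<subseteq> (\<Union>\<alpha>\<in>S. bad \<alpha>)" using card_mono leD by blast
  then obtain v where v: "v \<in> X" "\<And>\<alpha>. \<alpha> \<in> S \<Longrightarrow> v \<notin> bad \<alpha>" by blast
  define g where "g = (\<lambda>D. \<lambda>u\<in>U. horner_sum of_bool (2 :: nat) (map (\<lambda>t. odd (card (v (u, t) \<inter> D))) [0..<l]))"
  define G where "G = map_pmf g (pmf_of_set (Pow {..<s}))"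
  have ne: "Pow {..<s} \<noteq> {}" by auto
  have supp: "set_pmf G \<subseteq> U \<rightarrow>\<^sub>E {..<2 ^ l}"
  proof -
    have "g D \<in> U \<rightarrow>\<^sub>E {..<2 ^ l}" for D
      unfolding g_def using horner_sum_of_bool_2_less[of "map (\<lambda>t. odd (card (v (_, t) \<inter> D))) [0..<l]"] by auto
    then show ?thesis unfolding G_def by auto
  qed
  have char0: "measure_pmf.expectation G (character U \<alpha>) = 0" if \<alpha>: "\<alpha> \<in> S" for \<alpha>
  proof -
    have c: "character U \<alpha> (g D) = (\<Prod>i\<in>D. sg \<alpha> v i)" if D: "D \<subseteq> {..<s}" for D
    proof -
      have finD: "finite D" using D finite_subset by auto
      have "character U \<alpha> (g D) = (\<Prod>u\<in>U. \<Prod>t | bit (\<alpha> u) t. if odd (card (v (u, t) \<inter> D)) then -1 else 1)"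
        unfolding character_eq bit_character_prod
      proof (intro prod.cong refl)
        fix u t assume u: "u \<in> U" "t \<in> {t. bit (\<alpha> u) t}"
        then have "t < l" using \<alpha> unfolding S_def by (auto dest: bit_nat_less[rotated])
        then show "(if bit (g D u) t then -1 else 1 :: real) = (if odd (card (v (u, t) \<inter> D)) then -1 else 1)"
          using u by (simp add: g_def bit_horner_sum_bit_iff)
      qed
      also have "\<dots> = (\<Prod>e\<in>A \<alpha>. if odd (card (v e \<inter> D)) then -1 else 1)"
        unfolding A_def using U by (simp add: prod.Sigma case_prod_beta')
      also have "\<dots> = (\<Prod>e\<in>A \<alpha>. \<Prod>i\<in>D. if i \<in> v e then -1 else 1)"
      proof (rule prod.cong[OF refl])
        fix e
        have "(\<Prod>i\<in>D. if i \<in> v e then -1 else 1 :: real) = (-1) ^ card (v e \<inter> D)"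
          using finD by (simp add: prod.If_cases Int_commute)
        then show "(if odd (card (v e \<inter> D)) then -1 else 1 :: real) = (\<Prod>i\<in>D. if i \<in> v e then -1 else 1)"
          by simp
      qed
      also have "\<dots> = (\<Prod>i\<in>D. sg \<alpha> v i)" unfolding sg_def by (rule prod.swap)
      finally show ?thesis .
    qed
    \<comment> \<open>The sum over all seeds factors over the seed positions, and a position with
      sign -1 makes its factor vanish.\<close>
    have "(\<Sum>D\<in>Pow {..<s}. character U \<alpha> (g D)) = (\<Sum>D\<in>Pow {..<s}. \<Prod>i\<in>D. sg \<alpha> v i)"
      using c by (intro sum.cong) auto
    also have "\<dots> = (\<Prod>i<s. sg \<alpha> v i + 1)" by (simp add: prod_add)
    also have "\<dots> = 0"
    proof -
      obtain i where i: "i < s" "sg \<alpha> v i \<noteq> 1" using v \<alpha> unfolding bad_def by auto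
      have "\<bar>sg \<alpha> v i\<bar> = 1" unfolding sg_def abs_prod by (intro prod.neutral) auto
      then have "sg \<alpha> v i + 1 = 0" using i(2) by auto
      then show ?thesis using i(1) by (auto intro!: prod_zero)
    qed
    finally show ?thesis unfolding G_def using ne by (simp add: integral_pmf_of_set)
  qed
  have "biased_space U l kg 0 G"
    unfolding biased_space_def using supp char0 by (auto simp: S_def)
  moreover have "sampled_with_bits s G"
  proof -
    have bij: "bij_betw (\<lambda>bs. {i. i < s \<and> bs ! i}) (bit_strings s) (Pow {..<s})"
    proof (rule bij_betwI[of _ _ _ "\<lambda>D. map (\<lambda>i. i \<in> D) [0..<s]"])
      show "map (\<lambda>i. i \<in> {i. i < s \<and> bs ! i}) [0..<s] = bs" if "bs \<in> bit_strings s" for bs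
        using that by (auto intro: nth_equalityI)
    qed auto
    have "pmf_of_set (Pow {..<s}) = map_pmf (\<lambda>bs. {i. i < s \<and> bs ! i}) (pmf_of_set (bit_strings s))"
      using card_bit_strings(1) bit_strings_nonempty by (intro map_pmf_of_set_bij_betw[OF bij, symmetric])
    then show ?thesis unfolding G_def sampled_with_bits_def by (auto simp: pmf.map_comp)
  qed
  ultimately show ?thesis by blast
qed

section \<open>Union bounds\<close>

lemma prob_union_bound:
  assumes "finite I" "A \<inter> set_pmf M \<subseteq> (\<Union>i\<in>I. B i)" "\<And>i. i \<in> I \<Longrightarrow> measure_pmf.prob M (B i) \<le> c"
  shows "measure_pmf.prob M A \<le> real (card I) * c"
proof -
  have "measure_pmf.prob M A = measure_pmf.prob M (A \<inter> set_pmf M)" by (simp add: measure_Int_set_pmf)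
  also have "\<dots> \<le> measure_pmf.prob M (\<Union>i\<in>I. B i)"
    using assms(2) by (intro measure_pmf.finite_measure_mono) auto
  also have "\<dots> \<le> (\<Sum>i\<in>I. measure_pmf.prob M (B i))"
    using assms(1) by (intro measure_pmf.finite_measure_subadditive_finite) auto
  also have "\<dots> \<le> real (card I) * c" using assms(3) by (rule sum_bounded_above)
  finally show ?thesis .
qed

text \<open>The equations of the event determine the values on \<open>D\<close> from the remaining ones, because
  \<open>e\<close> decreases the rank.\<close>

lemma determined_prob:
  fixes M :: "(nat \<Rightarrow> 'b \<Rightarrow> nat) pmf" and rk :: "'b \<Rightarrow> nat"
  assumes fin: "finite J" "finite S" and R: "R > 0"
    and vals: "\<And>h j x. h \<in> set_pmf M \<Longrightarrow> j \<in> J \<Longrightarrow> x \<in> S \<Longrightarrow> h j x < R"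
    and pt: "\<And>z. measure_pmf.prob M {h. \<forall>j\<in>J. \<forall>x\<in>S. h j x = z j x} \<le> K / real R ^ (card J * card S)"
    and D: "D \<subseteq> J \<times> S" "\<And>j x. (j, x) \<in> D \<Longrightarrow> e j x \<in> S \<and> rk (e j x) < rk x" and K: "K \<ge> 0"
  shows "measure_pmf.prob M {h. \<forall>(j, x)\<in>D. h j x = \<Phi> j x (h j (e j x))} \<le> K / real R ^ card D"
proof -
  let ?I = "J \<times> S"
  define Z where "Z = {z \<in> ?I \<rightarrow>\<^sub>E {..<R}. \<forall>(j, x)\<in>D. z (j, x) = \<Phi> j x (z (j, e j x))}"
  have finI: "finite ?I" using fin by simp
  have finD: "finite D" using D(1) finI finite_subset by auto
  have finZ: "finite Z" unfolding Z_def using finI by (auto intro!: finite_PiE finite_Collect_conjI)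
  have "inj_on (\<lambda>z. restrict z (?I - D)) Z"
  proof (rule inj_onI)
    fix z z' assume z: "z \<in> Z" "z' \<in> Z" "restrict z (?I - D) = restrict z' (?I - D)"
    have "z (j, x) = z' (j, x)" if "j \<in> J" "x \<in> S" for j x
      using that(2)
    proof (induction "rk x" arbitrary: x rule: less_induct)
      case less
      show ?case
      proof (cases "(j, x) \<in> D")
        case True
        then have "z (j, e j x) = z' (j, e j x)" using less D(2) by blast
        moreover have "z (j, x) = \<Phi> j x (z (j, e j x))" "z' (j, x) = \<Phi> j x (z' (j, e j x))"
          using z(1,2) True unfolding Z_def by blast+
        ultimately show ?thesis by simp
      next
        case False
        then show ?thesis using z(3) less.prems \<open>j \<in> J\<close>
          by (metis DiffI SigmaI restrict_apply')
      qed
    qed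
    moreover have "z \<in> ?I \<rightarrow>\<^sub>E {..<R}" "z' \<in> ?I \<rightarrow>\<^sub>E {..<R}" using z(1,2) unfolding Z_def by blast+
    ultimately show "z = z'" by (intro PiE_ext[of z ?I _ z']) auto
  qed
  then have "card Z \<le> card ((?I - D) \<rightarrow>\<^sub>E {..<R})"
  proof (rule card_inj_on_le)
    show "(\<lambda>z. restrict z (?I - D)) ` Z \<subseteq> (?I - D) \<rightarrow>\<^sub>E {..<R}"
    proof (rule image_subsetI)
      fix z assume "z \<in> Z"
      then have "z \<in> ?I \<rightarrow>\<^sub>E {..<R}" unfolding Z_def by blast
      then have "\<forall>i\<in>?I. z i < R" using PiE_mem by fastforce
      then show "restrict z (?I - D) \<in> (?I - D) \<rightarrow>\<^sub>E {..<R}" by (auto simp: restrict_PiE_iff)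
    qed
    show "finite ((?I - D) \<rightarrow>\<^sub>E {..<R})" using finI by (intro finite_PiE) auto
  qed
  also have "\<dots> = R ^ (card J * card S - card D)"
    using finI D(1) finD by (simp add: card_PiE card_Diff_subset card_cartesian_product)
  finally have "real (card Z) \<le> real (R ^ (card J * card S - card D))" by (rule of_nat_mono)
  then have cZ: "real (card Z) \<le> real R ^ (card J * card S - card D)" by simp
  have le: "card D \<le> card J * card S"
    using card_mono[OF finI D(1)] by (simp add: card_cartesian_product)
  let ?E = "{h. \<forall>(j, x)\<in>D. h j x = \<Phi> j x (h j (e j x))}"
  have "measure_pmf.prob M ?E \<le> real (card Z) * (K / real R ^ (card J * card S))"
  proof (rule prob_union_bound[OF finZ _ pt])
    show "?E \<inter> set_pmf M \<subseteq> (\<Union>z\<in>Z. {h. \<forall>j\<in>J. \<forall>x\<in>S. h j x = z (j, x)})"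
    proof
      fix h assume h: "h \<in> ?E \<inter> set_pmf M"
      let ?z = "\<lambda>(j, x)\<in>?I. h j x"
      have "?z \<in> ?I \<rightarrow>\<^sub>E {..<R}" using h vals by (auto simp: restrict_PiE_iff)
      moreover have "\<forall>(j, x)\<in>D. ?z (j, x) = \<Phi> j x (?z (j, e j x))"
      proof clarify
        fix j x assume jx: "(j, x) \<in> D"
        then have "h j x = \<Phi> j x (h j (e j x))" using h by blast
        then show "?z (j, x) = \<Phi> j x (?z (j, e j x))" using jx D(1) D(2)[OF jx] by auto
      qed
      ultimately have "?z \<in> Z" unfolding Z_def by blast
      moreover have "h \<in> {h. \<forall>j\<in>J. \<forall>x\<in>S. h j x = ?z (j, x)}" by auto
      ultimately show "h \<in> (\<Union>z\<in>Z. {h. \<forall>j\<in>J. \<forall>x\<in>S. h j x = z (j, x)})" by blast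
    qed
  qed
  also have "\<dots> \<le> real R ^ (card J * card S - card D) * (K / real R ^ (card J * card S))"
    using cZ K by (intro mult_right_mono) auto
  also have "\<dots> = K / real R ^ card D"
    using R le by (simp add: power_diff)
  finally show ?thesis .
qed

text \<open>Few balls with many collisions: \<open>e j t\<close> is an earlier ball in the bin of \<open>t\<close> of group \<open>j\<close>.\<close>

definition dense :: "nat \<Rightarrow> nat \<Rightarrow> nat \<Rightarrow> nat \<Rightarrow> (nat \<Rightarrow> nat \<Rightarrow> nat) \<Rightarrow> bool" where
  "dense d m kg c h \<longleftrightarrow> (\<exists>V D e. V \<subseteq> {..<m} \<and> card V \<le> kg \<and> D \<subseteq> {1..d} \<times> V \<and> card V + c \<le> card D \<and>
     (\<forall>(j, t)\<in>D. e j t \<in> V \<and> e j t < t \<and> h j t = h j (e j t)))"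

text \<open>On v balls there are at most m^v choices of \<open>V\<close>, 2^(d v) of the equations
  and v^(v + c) of the earlier balls, whereas v + c equations have probability N^(-(v + c)). Each
  ball is compensated up to the factor (m / N) 2^d v, and the \<open>c\<close> surplus equations
  supply the decay N^(-c).\<close>

lemma dense_prob:
  fixes M :: "(nat \<Rightarrow> nat \<Rightarrow> nat) pmf"
  assumes vals: "\<And>h j t. h \<in> set_pmf M \<Longrightarrow> j \<in> {1..d} \<Longrightarrow> t < m \<Longrightarrow> h j t < N"
    and pt: "\<And>V z. V \<subseteq> {..<m} \<Longrightarrow> card V \<le> kg \<Longrightarrow>
      measure_pmf.prob M {h. \<forall>j\<in>{1..d}. \<forall>t\<in>V. h j t = z j t} \<le> 1 / real N ^ (d * card V)"
    and N: "0 < N" "N \<le> m" and c: "c \<ge> 1" and kg: "kg \<ge> 1"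
  shows "measure_pmf.prob M {h. dense d m kg c h}
    \<le> real kg * ((real m / real N) * 2 ^ d * real kg) ^ kg * real kg ^ c / real N ^ c"
proof -
  define VS where "VS = (\<lambda>v. {V. V \<subseteq> {..<m} \<and> card V = v})"
  define DS where "DS = (\<lambda>V :: nat set. {D. D \<subseteq> {1..d} \<times> V \<and> card D = card V + c})"
  define ev where "ev = (\<lambda>(V :: nat set) D e. {h. \<forall>(j, t)\<in>D. h j t = h j (e (j, t))} :: (nat \<Rightarrow> nat \<Rightarrow> nat) set)"
  define W where "W = (\<lambda>(V :: nat set) (D :: (nat \<times> nat) set). {e \<in> D \<rightarrow>\<^sub>E V. \<forall>(j, t)\<in>D. e (j, t) < t})"
  define X where "X = (real m / real N) * 2 ^ d * real kg"
  have finV: "finite V" if "V \<in> VS v" for V v using that finite_subset unfolding VS_def by auto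
  have finVS: "finite (VS v)" for v unfolding VS_def by simp
  have finDS: "finite (DS V)" if "V \<in> VS v" for V v using finV[OF that] unfolding DS_def by simp
  have finD: "finite D" if "D \<in> DS V" "V \<in> VS v" for D V v
    using that finV[OF that(2)] finite_subset[of D "{1..d} \<times> V"] unfolding DS_def by auto
  have one: "measure_pmf.prob M (ev V D e) \<le> 1 / real N ^ (v + c)"
    if "V \<in> VS v" "v \<le> kg" "D \<in> DS V" "e \<in> W V D" for V v D e
  proof -
    have V: "V \<subseteq> {..<m}" "card V = v" using that(1) by (auto simp: VS_def)
    have "measure_pmf.prob M {h. \<forall>(j, t)\<in>D. h j t = (\<lambda>j x y. y) j t (h j ((\<lambda>j t. e (j, t)) j t))} \<le> 1 / real N ^ card D"
    proof (rule determined_prob[where rk = "\<lambda>t. t" and J = "{1..d}" and S = V])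
      show "measure_pmf.prob M {h. \<forall>j\<in>{1..d}. \<forall>t\<in>V. h j t = z j t} \<le> 1 / real N ^ (card {1..d} * card V)" for z
        using pt[of V z] V that(2) by simp
      show "e (j, x) \<in> V \<and> e (j, x) < x" if "(j, x) \<in> D" for j x
        using \<open>e \<in> W V D\<close> that unfolding W_def by (auto simp: PiE_iff)
    qed (use finV[OF that(1)] N vals V that(3) in \<open>auto simp: DS_def\<close>)
    then show ?thesis using that(3) V unfolding ev_def DS_def by simp
  qed
  have cardW: "card (W V D) \<le> v ^ (v + c)" "finite (W V D)" if "V \<in> VS v" "D \<in> DS V" for V v D
  proof -
    have fin: "finite (D \<rightarrow>\<^sub>E V)" using finV[OF that(1)] finD[OF that(2,1)] by (intro finite_PiE) auto
    then show "finite (W V D)" unfolding W_def by simp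
    have "card (W V D) \<le> card (D \<rightarrow>\<^sub>E V)" unfolding W_def using fin by (intro card_mono) auto
    also have "\<dots> = v ^ (v + c)" using that finD[OF that(2,1)] by (simp add: card_PiE DS_def VS_def)
    finally show "card (W V D) \<le> v ^ (v + c)" .
  qed
  have cardDS: "card (DS V) \<le> 2 ^ (d * v)" if "V \<in> VS v" for V v
  proof -
    have "card (DS V) \<le> card (Pow ({1..d} \<times> V))"
      using finV[OF that] unfolding DS_def by (intro card_mono) auto
    also have "\<dots> = 2 ^ (d * v)" using finV[OF that] that by (simp add: card_Pow card_cartesian_product VS_def)
    finally show ?thesis .
  qed
  have cardVS: "card (VS v) \<le> m ^ v" for v
  proof -
    have "card (VS v) = m choose v" unfolding VS_def using n_subsets[of "{..<m}" v] by simp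
    also have "\<dots> \<le> (m choose v) * fact v" by (simp add: Suc_le_eq)
    also have "\<dots> \<le> m ^ v" by (rule binomial_fact_pow)
    finally show ?thesis .
  qed
  define T where "T = (\<lambda>v. SIGMA V : VS v. SIGMA D : DS V. W V D)"
  have finT: "finite (T v)" for v
    unfolding T_def using finVS finDS cardW(2) by (intro finite_SigmaI) auto
  have cardT: "real (card (T v)) \<le> real (m ^ v * (2 ^ (d * v) * v ^ (v + c)))" for v
  proof (rule of_nat_mono)
    have "card (T v) = (\<Sum>V\<in>VS v. \<Sum>D\<in>DS V. card (W V D))"
      unfolding T_def using finVS finDS cardW(2) by (subst card_SigmaI; (intro ballI sum.cong refl card_SigmaI finite_SigmaI)?; auto)
    also have "\<dots> \<le> (\<Sum>V\<in>VS v. 2 ^ (d * v) * v ^ (v + c))"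
    proof (rule sum_mono)
      fix V assume V: "V \<in> VS v"
      have "(\<Sum>D\<in>DS V. card (W V D)) \<le> card (DS V) * v ^ (v + c)"
        using cardW(1)[OF V] sum_bounded_above[of "DS V" "\<lambda>D. card (W V D)" "v ^ (v + c)"] by simp
      also have "\<dots> \<le> 2 ^ (d * v) * v ^ (v + c)" using cardDS[OF V] by (rule mult_le_mono1)
      finally show "(\<Sum>D\<in>DS V. card (W V D)) \<le> 2 ^ (d * v) * v ^ (v + c)" .
    qed
    also have "\<dots> \<le> m ^ v * (2 ^ (d * v) * v ^ (v + c))"
      using cardVS[of v] by simp
    finally show "card (T v) \<le> m ^ v * (2 ^ (d * v) * v ^ (v + c))" .
  qed
  have X1: "X \<ge> 1"
  proof -
    have "1 \<le> real m / real N" using N by simp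
    moreover have "(1::real) \<le> 2 ^ d * real kg" using kg mult_mono[of 1 "2 ^ d :: real" 1 "real kg"] by simp
    ultimately show ?thesis unfolding X_def using mult_mono[of 1 "real m / real N" 1 "2 ^ d * real kg"] by (simp add: mult.assoc)
  qed
  have lev: "measure_pmf.prob M (\<Union>(V, D, e)\<in>T v. ev V D e) \<le> X ^ kg * real kg ^ c / real N ^ c"
    if "v \<in> {1..kg}" for v
  proof -
    have "measure_pmf.prob M (\<Union>(V, D, e)\<in>T v. ev V D e) \<le> real (card (T v)) * (1 / real N ^ (v + c))"
    proof (rule prob_union_bound[OF finT])
      fix i assume "i \<in> T v"
      then obtain V D e where "i = (V, D, e)" "V \<in> VS v" "D \<in> DS V" "e \<in> W V D" unfolding T_def by blast
      then show "measure_pmf.prob M (case i of (V, D, e) \<Rightarrow> ev V D e) \<le> 1 / real N ^ (v + c)"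
        using one[of V v D e] that by simp
    qed blast
    also have "\<dots> \<le> real (m ^ v * (2 ^ (d * v) * v ^ (v + c))) * (1 / real N ^ (v + c))"
      by (intro mult_right_mono cardT) simp
    also have "\<dots> = ((real m / real N) * 2 ^ d * real v) ^ v * real v ^ c / real N ^ c"
      by (simp add: power_mult_distrib power_divide power_add power_mult)
    also have "\<dots> \<le> X ^ v * real kg ^ c / real N ^ c"
      unfolding X_def using that by (intro divide_right_mono mult_mono power_mono) auto
    also have "\<dots> \<le> X ^ kg * real kg ^ c / real N ^ c"
      using that X1 by (intro divide_right_mono mult_right_mono power_increasing) auto
    finally show ?thesis .
  qed
  have "measure_pmf.prob M {h. dense d m kg c h} \<le> real (card {1..kg}) * (X ^ kg * real kg ^ c / real N ^ c)"
  proof (rule prob_union_bound[OF _ _ lev])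
    show "{h. dense d m kg c h} \<inter> set_pmf M \<subseteq> (\<Union>v\<in>{1..kg}. \<Union>(V, D, e)\<in>T v. ev V D e)"
    proof
      fix h assume "h \<in> {h. dense d m kg c h} \<inter> set_pmf M"
      then obtain V D e where V: "V \<subseteq> {..<m}" "card V \<le> kg" "D \<subseteq> {1..d} \<times> V" "card V + c \<le> card D"
        "\<forall>(j, t)\<in>D. e j t \<in> V \<and> e j t < t \<and> h j t = h j (e j t)"
        unfolding dense_def by blast
      have "finite V" using V(1) finite_subset by auto
      \<comment> \<open>Trimming to exactly this many equations makes the bound depend on the number
        of balls alone.\<close>
      obtain D' where D': "D' \<subseteq> D" "card D' = card V + c"
        using obtain_subset_with_card_n[OF V(4)] by blast
      then have "V \<noteq> {}" using c V(3) by auto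
      then have v: "card V \<in> {1..kg}" using \<open>finite V\<close> V(2) by (simp add: Suc_le_eq card_gt_0_iff)
      let ?e = "\<lambda>(j, t)\<in>D'. e j t"
      have e: "\<forall>(j, t)\<in>D'. e j t \<in> V \<and> e j t < t \<and> h j t = h j (e j t)" using V(5) D'(1) by blast
      then have "?e \<in> W V D'" unfolding W_def by (auto simp: restrict_PiE_iff)
      moreover have "D' \<in> DS V" "V \<in> VS (card V)" using D' V(1,3) by (auto simp: DS_def VS_def)
      ultimately have "(V, D', ?e) \<in> T (card V)" unfolding T_def by blast
      moreover have "h \<in> ev V D' ?e" unfolding ev_def using e by auto
      ultimately show "h \<in> (\<Union>v\<in>{1..kg}. \<Union>(V, D, e)\<in>T v. ev V D e)" using v by blast
    qed
  qed simp_all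
  then show ?thesis unfolding X_def by simp
qed

text \<open>\<open>pre\<close> is the bucket of a ball, fixed in advance; admissible children come
  from the same bucket, so the family of candidate trees is not random. With n edges, the factor R^n
  in the number of trees cancels against R^(-n) from \<open>determined_prob\<close>, and 1 / 2 per
  leaf remains. \<Phi> expresses that equal hash values tie the random value of a ball to that of
  its parent, up to known shifts. The bound 2 n on the points counts both ends of each edge.\<close>

lemma tree_prob:
  fixes M :: "(nat \<Rightarrow> nat \<Rightarrow> nat) pmf" and \<rho> :: real and \<Phi> :: "nat \<Rightarrow> nat \<Rightarrow> nat \<Rightarrow> nat \<Rightarrow> nat"
  assumes d: "d \<ge> 2" "d \<le> q0" "q0 \<le> q + d" and R: "R > 0"
    and \<rho>: "\<rho> \<ge> 1" "\<rho> ^ (b + 2) / fact b \<le> 1 / 2" and K: "K \<ge> 0"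
    and bucket: "\<And>j t. j \<in> {1..d} \<Longrightarrow> t < m \<Longrightarrow> real (card {y. y < m \<and> pre j y = pre j t}) \<le> \<rho> * R"
    and vals: "\<And>h j t. h \<in> set_pmf M \<Longrightarrow> j \<in> {1..d} \<Longrightarrow> t < m \<Longrightarrow> h j t < R"
    and pt: "\<And>V z. V \<subseteq> {..<m} \<Longrightarrow> card V \<le> 2 * tree_edges d q0 b q \<Longrightarrow>
      measure_pmf.prob M {h. \<forall>j\<in>{1..d}. \<forall>t\<in>V. h j t = z j t} \<le> K / real R ^ (d * card V)"
    and hv: "\<And>h j x y. h \<in> set_pmf M \<Longrightarrow> j \<in> {1..d} \<Longrightarrow> x < m \<Longrightarrow> y < m \<Longrightarrow> hv h j y = hv h j x \<Longrightarrow>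
      pre j y = pre j x \<and> h j y = \<Phi> j y x (h j x)"
  shows "measure_pmf.prob M {h. \<exists>t<m. \<exists>E. witness_tree d q0 b (\<lambda>j x. {y. y < x \<and> hv h j y = hv h j x}) q t E \<and>
      finite E \<and> inj_on fst E \<and> card E = tree_edges d q0 b q} \<le> K * m * (1 / 2) ^ tree_leaves d q0 q"
proof -
  let ?n = "tree_edges d q0 b q"
  define Y where "Y = (\<lambda>j x. {y. y < x \<and> x < m \<and> j \<in> {1..d} \<and> pre j y = pre j x})"
  have finY: "finite (Y j x)" for j x unfolding Y_def by simp
  have cY: "real (card (Y j x)) \<le> \<rho> * R" for j x
  proof (cases "x < m \<and> j \<in> {1..d}")
    case True
    have "card (Y j x) \<le> card {y. y < m \<and> pre j y = pre j x}"
      unfolding Y_def by (intro card_mono) auto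
    then show ?thesis using bucket[of j x] True by linarith
  next
    case False
    then have "Y j x = {}" unfolding Y_def by auto
    then show ?thesis using \<rho> by simp
  qed
  have R': "real R > 0" using R by simp
  define EE where "EE = (\<lambda>t. {E. witness_tree d q0 b Y q t E})"
  have EE: "finite (EE t)" "real (card (EE t)) \<le> real R ^ ?n * (1 / 2) ^ tree_leaves d q0 q / \<rho>\<^sup>2" for t
    unfolding EE_def using witness_tree_card[OF d(1,2) finY cY \<rho> R' d(3)] by auto
  define I where "I = (SIGMA t : {..<m}. {E \<in> EE t. finite E \<and> inj_on fst E \<and> card E = ?n})"
  have finI: "finite I" unfolding I_def using EE(1) by auto
  have "real (card I) \<le> real m * (real R ^ ?n * (1 / 2) ^ tree_leaves d q0 q / \<rho>\<^sup>2)"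
  proof -
    have "real (card I) = (\<Sum>t<m. real (card {E \<in> EE t. finite E \<and> inj_on fst E \<and> card E = ?n}))"
      unfolding I_def using EE(1) by (subst card_SigmaI) auto
    also have "\<dots> \<le> (\<Sum>t<m. real R ^ ?n * (1 / 2) ^ tree_leaves d q0 q / \<rho>\<^sup>2)"
    proof (rule sum_mono)
      fix t
      have "card {E \<in> EE t. finite E \<and> inj_on fst E \<and> card E = ?n} \<le> card (EE t)"
        using EE(1) by (intro card_mono) auto
      then show "real (card {E \<in> EE t. finite E \<and> inj_on fst E \<and> card E = ?n}) \<le> real R ^ ?n * (1 / 2) ^ tree_leaves d q0 q / \<rho>\<^sup>2"
        using EE(2)[of t] by linarith
    qed
    finally show ?thesis by simp
  qed
  also have "\<dots> \<le> real m * (real R ^ ?n * (1 / 2) ^ tree_leaves d q0 q / 1)"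
    using \<rho> by (intro mult_left_mono divide_left_mono) auto
  finally have cI: "real (card I) \<le> real m * (real R ^ ?n * (1 / 2) ^ tree_leaves d q0 q)" by simp
  define ev where "ev = (\<lambda>(t :: nat, E). {h. \<forall>(y, j, x)\<in>E. h j y = \<Phi> j y x (h j x)} :: (nat \<Rightarrow> nat \<Rightarrow> nat) set)"
  have one: "measure_pmf.prob M (ev i) \<le> K / real R ^ ?n" if i: "i \<in> I" for i
  proof -
    obtain t E where tE: "i = (t, E)" "t < m" "witness_tree d q0 b Y q t E" "finite E" "inj_on fst E" "card E = ?n"
      using i unfolding I_def EE_def by auto
    have edge: "y < x \<and> x < m \<and> j \<in> {1..d}" if "(y, j, x) \<in> E" for y j x
      using witness_tree_edge[OF tE(3) _ that] d unfolding Y_def by auto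
    define S where "S = fst ` E \<union> (snd \<circ> snd) ` E"
    define D where "D = (\<lambda>(y, j, x). (j, y)) ` E"
    \<comment> \<open>The parent is unique because \<open>fst\<close> is injective on the
      edges.\<close>
    define e where "e = (\<lambda>(j :: nat) y. THE x. \<exists>j. (y, j, x) \<in> E)"
    have e: "e j y = x" if "(y, j, x) \<in> E" for j y x
      unfolding e_def
    proof (rule the_equality)
      show "\<exists>j. (y, j, x) \<in> E" using that by blast
      fix x' assume "\<exists>j. (y, j, x') \<in> E"
      then obtain j' where "(y, j', x') \<in> E" by blast
      then have "(y, j', x') = (y, j, x)" using inj_onD[OF tE(5) _ _ that, of "(y, j', x')"] by simp
      then show "x' = x" by simp
    qed
    have S: "S \<subseteq> {..<m}" unfolding S_def using edge by fastforce
    have "card S \<le> card (fst ` E) + card ((snd \<circ> snd) ` E)" unfolding S_def by (rule card_Un_le)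
    then have cS: "card S \<le> 2 * ?n"
      using card_image_le[OF tE(4), of fst] card_image_le[OF tE(4), of "snd \<circ> snd"] tE(6) by linarith
    have "inj_on (\<lambda>(y, j, x). (j, y)) E"
      using e by (intro inj_onI) (clarsimp, metis)
    then have cD: "card D = ?n" unfolding D_def using tE(6) by (simp add: card_image)
    have "measure_pmf.prob M {h. \<forall>(j, y)\<in>D. h j y = (\<lambda>j y. \<Phi> j y (e j y)) j y (h j (e j y))} \<le> K / real R ^ card D"
    \<comment> \<open>Here the value of a ball is determined by its parent, a later ball, so the
      rank counts down from \<open>m\<close>.\<close>
    proof (rule determined_prob[where rk = "\<lambda>t. m - t" and J = "{1..d}" and S = S])
      show "finite S" using S finite_subset by auto
      show "measure_pmf.prob M {h. \<forall>j\<in>{1..d}. \<forall>t\<in>S. h j t = z j t} \<le> K / real R ^ (card {1..d} * card S)" for z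
        using pt[OF S cS, of z] by simp
      show "D \<subseteq> {1..d} \<times> S" unfolding D_def S_def using edge by force
      show "e j y \<in> S \<and> m - e j y < m - y" if "(j, y) \<in> D" for j y
      proof -
        obtain x where x: "(y, j, x) \<in> E" using \<open>(j, y) \<in> D\<close> unfolding D_def by auto
        then have "x \<in> S" unfolding S_def by force
        then show ?thesis using edge[OF x] e[OF x] by auto
      qed
    qed (use R K vals S in auto)
    moreover have "{h. \<forall>(j, y)\<in>D. h j y = (\<lambda>j y. \<Phi> j y (e j y)) j y (h j (e j y))} = ev i"
    proof -
      have "(\<forall>(j, y)\<in>D. h j y = \<Phi> j y (e j y) (h j (e j y))) \<longleftrightarrow> (\<forall>(y, j, x)\<in>E. h j y = \<Phi> j y x (h j x))" for h
      proof
        assume a: "\<forall>(j, y)\<in>D. h j y = \<Phi> j y (e j y) (h j (e j y))"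
        show "\<forall>(y, j, x)\<in>E. h j y = \<Phi> j y x (h j x)"
        proof clarify
          fix y j x assume x: "(y, j, x) \<in> E"
          then have "(j, y) \<in> D" unfolding D_def by force
          then show "h j y = \<Phi> j y x (h j x)" using a e[OF x] by auto
        qed
      next
        assume a: "\<forall>(y, j, x)\<in>E. h j y = \<Phi> j y x (h j x)"
        show "\<forall>(j, y)\<in>D. h j y = \<Phi> j y (e j y) (h j (e j y))"
        proof clarify
          fix j y assume "(j, y) \<in> D"
          then obtain x where x: "(y, j, x) \<in> E" unfolding D_def by auto
          then show "h j y = \<Phi> j y (e j y) (h j (e j y))" using a e[OF x] by auto
        qed
      qed
      then show ?thesis unfolding ev_def tE(1) by simp
    qed
    ultimately show ?thesis unfolding cD by simp
  qed
  have "measure_pmf.prob M {h. \<exists>t<m. \<exists>E. witness_tree d q0 b (\<lambda>j x. {y. y < x \<and> hv h j y = hv h j x}) q t E \<and>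
      finite E \<and> inj_on fst E \<and> card E = ?n} \<le> real (card I) * (K / real R ^ ?n)"
  proof (rule prob_union_bound[OF finI _ one])
    show "{h. \<exists>t<m. \<exists>E. witness_tree d q0 b (\<lambda>j x. {y. y < x \<and> hv h j y = hv h j x}) q t E \<and>
      finite E \<and> inj_on fst E \<and> card E = ?n} \<inter> set_pmf M \<subseteq> (\<Union>i\<in>I. ev i)"
    proof
      fix h assume "h \<in> {h. \<exists>t<m. \<exists>E. witness_tree d q0 b (\<lambda>j x. {y. y < x \<and> hv h j y = hv h j x}) q t E \<and>
        finite E \<and> inj_on fst E \<and> card E = ?n} \<inter> set_pmf M"
      then obtain t E where h: "h \<in> set_pmf M" and tE: "t < m"
        "witness_tree d q0 b (\<lambda>j x. {y. y < x \<and> hv h j y = hv h j x}) q t E" "finite E" "inj_on fst E" "card E = ?n" by auto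
      have "witness_tree d q0 b Y q t E"
      proof (rule witness_tree_mono[OF tE(2)])
        fix j x assume x: "x \<le> t" "j \<in> {1..d}"
        then show "{y. y < x \<and> hv h j y = hv h j x} \<subseteq> Y j x"
          unfolding Y_def using hv[OF h] tE(1) by auto
      qed (use d in auto)
      then have "(t, E) \<in> I" unfolding I_def EE_def using tE by auto
      moreover have "h \<in> ev (t, E)"
        unfolding ev_def
      proof (clarsimp)
        fix y j x assume e: "(y, j, x) \<in> E"
        have 1: "y < x \<and> hv h j y = hv h j x \<and> j \<in> {1..d}" using witness_tree_edge[OF tE(2) _ e] d by auto
        have "x < m" using witness_tree_edge[OF \<open>witness_tree d q0 b Y q t E\<close> _ e] d unfolding Y_def by auto
        then show "h j y = \<Phi> j y x (h j x)" using hv[OF h, of j x y] 1 by auto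
      qed
      ultimately show "h \<in> (\<Union>i\<in>I. ev i)" by blast
    qed
  qed
  also have "\<dots> \<le> real m * (real R ^ ?n * (1 / 2) ^ tree_leaves d q0 q) * (K / real R ^ ?n)"
    using cI K by (intro mult_right_mono) auto
  also have "\<dots> = K * m * (1 / 2) ^ tree_leaves d q0 q" using R by simp
  finally show ?thesis .
qed

section \<open>Bucket loads\<close>

abbreviation bxor :: "nat \<Rightarrow> nat \<Rightarrow> nat" where
  "bxor \<equiv> semiring_bit_operations_class.xor"

lemma prob_bind_le_add:
  assumes "\<And>x. x \<in> set_pmf M \<Longrightarrow> x \<notin> B \<Longrightarrow> measure_pmf.prob (N x) A \<le> c" "c \<ge> 0"
  shows "measure_pmf.prob (bind_pmf M N) A \<le> measure_pmf.prob M B + c"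
proof -
  have "emeasure (measure_pmf (bind_pmf M N)) A = (\<integral>\<^sup>+x. emeasure (measure_pmf (N x)) A \<partial>measure_pmf M)"
    by (simp add: emeasure_bind_pmf)
  also have "\<dots> \<le> (\<integral>\<^sup>+x. indicator B x + ennreal c \<partial>measure_pmf M)"
  proof (rule nn_integral_mono_AE)
    show "AE x in measure_pmf M. emeasure (measure_pmf (N x)) A \<le> indicator B x + ennreal c"
      unfolding AE_measure_pmf_iff
    proof
      fix x assume x: "x \<in> set_pmf M"
      show "emeasure (measure_pmf (N x)) A \<le> indicator B x + ennreal c"
      proof (cases "x \<in> B")
        case True
        have "emeasure (measure_pmf (N x)) A \<le> 1" by (rule measure_pmf.emeasure_le_1)
        also have "1 \<le> indicator B x + ennreal c" using True by simp
        finally show ?thesis .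
      next
        case False
        then show ?thesis using assms(1)[OF x False] by (simp add: measure_pmf.emeasure_eq_measure ennreal_leI)
      qed
    qed
  qed
  also have "\<dots> = emeasure (measure_pmf M) B + ennreal c"
    by (subst nn_integral_add) (auto simp: measure_pmf.emeasure_space_1)
  also have "\<dots> = ennreal (measure_pmf.prob M B + c)"
    using assms(2) by (simp add: measure_pmf.emeasure_eq_measure ennreal_plus)
  finally show ?thesis
    unfolding measure_pmf.emeasure_eq_measure using assms(2)
    by (subst (asm) ennreal_le_iff) auto
qed

lemma prob_bind_le:
  assumes "\<And>x. x \<in> set_pmf M \<Longrightarrow> measure_pmf.prob (N x) A \<le> c" "c \<ge> 0"
  shows "measure_pmf.prob (bind_pmf M N) A \<le> c"
  using prob_bind_le_add[of M "{}" N A c] assms by simp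

lemma prob_pair_le:
  assumes "\<And>y. y \<in> set_pmf B \<Longrightarrow> measure_pmf.prob A {x. (x, y) \<in> E} \<le> c" "c \<ge> 0"
  shows "measure_pmf.prob (pair_pmf A B) E \<le> c"
proof -
  have "pair_pmf A B = bind_pmf B (\<lambda>y. map_pmf (\<lambda>x. (x, y)) A)"
    unfolding pair_pmf_def map_pmf_def by (rule bind_commute_pmf)
  moreover have "(\<lambda>x. (x, y)) -` E = {x. (x, y) \<in> E}" for y by auto
  ultimately show ?thesis using assms by (auto intro!: prob_bind_le)
qed

section \<open>Blocks of the hash value and the balance of the upper levels\<close>

lemma bit_concat_Suc:
  assumes "f (Suc r) < 2 ^ b (Suc r)"
  shows "drop_bit (b (Suc r)) (bit_concat b f (Suc r)) = bit_concat b f r"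
    and "take_bit (b (Suc r)) (bit_concat b f (Suc r)) = f (Suc r)"
  using assms by (simp_all add: drop_bit_eq_div take_bit_eq_mod push_bit_eq_mult)

lemma bit_concat_less:
  assumes "\<And>i. i \<in> {1..r} \<Longrightarrow> f i < 2 ^ b i"
  shows "bit_concat b f r < 2 ^ (\<Sum>i=1..r. b i)"
  using assms
proof (induction r)
  case (Suc r)
  then have "bit_concat b f r < 2 ^ (\<Sum>i=1..r. b i)" "f (Suc r) < 2 ^ b (Suc r)" by auto
  then have "bit_concat b f r + 1 \<le> 2 ^ (\<Sum>i=1..r. b i)" by simp
  then have "(bit_concat b f r + 1) * 2 ^ b (Suc r) \<le> 2 ^ (\<Sum>i=1..r. b i) * 2 ^ b (Suc r)"
    by (rule mult_le_mono1)
  then show ?case using \<open>f (Suc r) < 2 ^ b (Suc r)\<close>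
    by (simp add: push_bit_eq_mult power_add algebra_simps)
qed simp

lemma bit_concat_cong:
  assumes "\<And>i. i \<in> {1..r} \<Longrightarrow> f i = f' i"
  shows "bit_concat b f r = bit_concat b f' r"
  using assms by (induction r) auto

lemma xor_less_power2:
  fixes x y :: nat
  assumes "x < 2 ^ c" "y < 2 ^ c"
  shows "bxor x y < 2 ^ c"
proof -
  have "take_bit c (bxor x y) = bxor x y"
    using assms by (simp add: take_bit_nat_eq_self)
  then show ?thesis by (metis take_bit_nat_less_exp)
qed

lemma xor_eq_iff:
  fixes x y z :: nat
  shows "bxor x y = z \<longleftrightarrow> x = bxor z y"
  by (auto simp: bit_eq_iff bit_xor_iff)

definition hash_tail :: "(nat \<Rightarrow> nat) \<Rightarrow> nat \<Rightarrow> nat \<Rightarrow> nat" where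
  "hash_tail b k i = (\<Sum>s\<in>{i<..k + 1}. b s)"

text \<open>Since XOR acts blockwise, these are the \<open>i\<close> leading blocks of the hash value of \<open>x\<close>.\<close>

definition hash_prefix :: "(nat \<Rightarrow> nat) \<Rightarrow> nat \<Rightarrow> ('a \<Rightarrow> nat) \<Rightarrow> nat \<Rightarrow> (nat \<Rightarrow> 'a \<Rightarrow> nat) \<Rightarrow> 'a \<Rightarrow> nat" where
  "hash_prefix b k g i f x =
     bxor (bit_concat b (\<lambda>s. f s x) i) (drop_bit (hash_tail b k i) (g x))"

text \<open>The size of a bucket if \<open>i\<close> levels split the balls evenly, with one factor
  1 + \<epsilon> conceded per level.\<close>

definition bucket_bound :: "(nat \<Rightarrow> nat) \<Rightarrow> real \<Rightarrow> nat \<Rightarrow> nat \<Rightarrow> real" where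
  "bucket_bound b \<epsilon> m i = m * (1 + \<epsilon>) ^ i / 2 ^ (\<Sum>s=1..i. b s)"

definition buckets_balanced ::
  "(nat \<Rightarrow> nat) \<Rightarrow> nat \<Rightarrow> real \<Rightarrow> 'a set \<Rightarrow> ('a \<Rightarrow> nat) \<Rightarrow> nat \<Rightarrow> (nat \<Rightarrow> 'a \<Rightarrow> nat) \<Rightarrow> bool" where
  "buckets_balanced b k \<epsilon> X g i f \<longleftrightarrow>
     (\<forall>\<alpha>. real (card {x \<in> X. hash_prefix b k g i f x = \<alpha>}) \<le> bucket_bound b \<epsilon> (card X) i)"

text \<open>Here \<open>g\<close> is held fixed. Given \<open>g\<close>, the XOR only shifts the
  value that a level function has to hit, by an amount depending on the ball; this is why the load
  estimates allow a target \<tau> that varies from point to point.\<close>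

locale hash_levels =
  fixes U :: "'a set" and b :: "nat \<Rightarrow> nat" and k w :: nat and \<delta> \<epsilon> :: real
    and P :: "nat \<Rightarrow> ('a \<Rightarrow> nat) pmf" and X :: "'a set" and g :: "'a \<Rightarrow> nat"
  assumes U: "finite U" "X \<subseteq> U"
    and P: "\<And>i. i \<in> {1..k} \<Longrightarrow> biased_space U (b i) w \<delta> (P i)"
    and g: "\<And>x. x \<in> U \<Longrightarrow> g x < 2 ^ (\<Sum>i=1..k + 1. b i)"
    and \<delta>: "\<delta> \<ge> 0" and \<epsilon>: "\<epsilon> > 0"
begin

abbreviation tail :: "nat \<Rightarrow> nat" where
  "tail \<equiv> hash_tail b k"

abbreviation prefix :: "nat \<Rightarrow> (nat \<Rightarrow> 'a \<Rightarrow> nat) \<Rightarrow> 'a \<Rightarrow> nat" where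
  "prefix \<equiv> hash_prefix b k g"

abbreviation bound :: "nat \<Rightarrow> real" where
  "bound \<equiv> bucket_bound b \<epsilon> (card X)"

abbreviation balanced :: "nat \<Rightarrow> (nat \<Rightarrow> 'a \<Rightarrow> nat) \<Rightarrow> bool" where
  "balanced \<equiv> buckets_balanced b k \<epsilon> X g"

lemma tail_Suc: "i \<le> k \<Longrightarrow> tail i = b (Suc i) + tail (Suc i)"
proof -
  assume "i \<le> k"
  then have "{i<..k + 1} = insert (Suc i) {Suc i<..k + 1}" by auto
  then show ?thesis by (simp add: hash_tail_def)
qed

text \<open>A number is determined by its lowest block and the remaining bits, and XOR respects
  both. So a ball falls into a bucket of the next level iff it lies in the parent bucket and the new
  level function hits the target of that ball.\<close>

lemma prefix_Suc:
  assumes "i \<le> k" "f (Suc i) x < 2 ^ b (Suc i)"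
  shows "prefix (Suc i) f x = \<alpha> \<longleftrightarrow> prefix i f x = drop_bit (b (Suc i)) \<alpha> \<and>
    f (Suc i) x = take_bit (b (Suc i)) (bxor \<alpha> (drop_bit (tail (Suc i)) (g x)))"
proof -
  let ?c = "bit_concat b (\<lambda>s. f s x)" and ?v = "bxor \<alpha> (drop_bit (tail (Suc i)) (g x))"
  note c = bit_concat_Suc[of "\<lambda>s. f s x" i b, OF assms(2)]
  have "prefix (Suc i) f x = \<alpha> \<longleftrightarrow> ?c (Suc i) = ?v"
    unfolding hash_prefix_def by (rule xor_eq_iff)
  also have "\<dots> \<longleftrightarrow> drop_bit (b (Suc i)) (?c (Suc i)) = drop_bit (b (Suc i)) ?v \<and>
    take_bit (b (Suc i)) (?c (Suc i)) = take_bit (b (Suc i)) ?v"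
    by (metis bits_ident)
  also have "drop_bit (b (Suc i)) ?v = bxor (drop_bit (b (Suc i)) \<alpha>) (drop_bit (tail i) (g x))"
    using tail_Suc[OF assms(1)] by (simp add: drop_bit_xor)
  finally show ?thesis unfolding c hash_prefix_def[of _ _ _ i] by (simp add: xor_eq_iff)
qed

lemma prefix_cong:
  assumes "\<And>s. s \<in> {1..i} \<Longrightarrow> f s = f' s"
  shows "prefix i f x = prefix i f' x"
proof -
  have "bit_concat b (\<lambda>s. f s x) i = bit_concat b (\<lambda>s. f' s x) i"
    by (rule bit_concat_cong) (simp add: assms)
  then show ?thesis by (simp add: hash_prefix_def)
qed

lemma bound_Suc: "bound (Suc i) = (1 + \<epsilon>) * (bound i / 2 ^ b (Suc i))"
  by (simp add: bucket_bound_def power_add)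

lemma balanced_0: "balanced 0 f"
proof -
  have "card {x \<in> X. prefix 0 f x = \<alpha>} \<le> card X" for \<alpha>
    using U finite_subset by (intro card_mono) auto
  then show ?thesis by (simp add: buckets_balanced_def bucket_bound_def)
qed

lemma prefix_less:
  assumes "i \<le> k" "x \<in> U" "\<And>s. s \<in> {1..i} \<Longrightarrow> f s x < 2 ^ b s"
  shows "prefix i f x < 2 ^ (\<Sum>s=1..i. b s)"
  unfolding hash_prefix_def
proof (rule xor_less_power2)
  show "bit_concat b (\<lambda>s. f s x) i < 2 ^ (\<Sum>s=1..i. b s)"
    using assms(3) by (rule bit_concat_less)
  have "(\<Sum>s\<in>{1..i} \<union> {i<..k + 1}. b s) = (\<Sum>s=1..i. b s) + tail i"
    unfolding hash_tail_def by (rule sum.union_disjoint) auto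
  moreover have "{1..i} \<union> {i<..k + 1} = {1..k + 1}" using assms(1) by auto
  ultimately have e: "(\<Sum>s=1..k + 1. b s) = (\<Sum>s=1..i. b s) + tail i" by metis
  have "g x < 2 ^ (\<Sum>s=1..i. b s) * 2 ^ tail i"
    using g[OF assms(2)] unfolding e by (simp add: power_add)
  then show "drop_bit (tail i) (g x) < 2 ^ (\<Sum>s=1..i. b s)"
    by (simp add: drop_bit_eq_div less_mult_imp_div_less)
qed

lemma support_P:
  assumes "i \<in> {1..k}" "y \<in> set_pmf (P i)" "x \<in> U"
  shows "y x < 2 ^ b i"
proof -
  have "set_pmf (P i) \<subseteq> U \<rightarrow>\<^sub>E {..<2 ^ b i}" using P[OF assms(1)] unfolding biased_space_def by blast
  then have "y \<in> U \<rightarrow>\<^sub>E {..<2 ^ b i}" using assms(2) by blast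
  then show ?thesis using assms(3) by (auto dest: PiE_mem)
qed

text \<open>With the earlier levels fixed, the balls that can reach a new bucket are those of its
  parent, and \<open>biased_space_load\<close> bounds how many do. The power of 2 in front is the
  number of bucket labels in the union bound.\<close>

lemma unbalanced_step:
  assumes i: "i < k" and f: "balanced i f" "\<And>s x. s \<in> {1..i} \<Longrightarrow> x \<in> U \<Longrightarrow> f s x < 2 ^ b s"
    and p: "even p" "p \<le> w" and \<mu>: "bound i / 2 ^ b (Suc i) \<ge> 1"
  shows "measure_pmf.prob (P (Suc i)) {y. \<not> balanced (Suc i) (f(Suc i := y))} \<le>
    2 ^ (\<Sum>s=1..Suc i. b s) *
    (6 * (p / (\<epsilon> * sqrt (bound i / 2 ^ b (Suc i)))) ^ p + (4 ^ b (Suc i) / \<epsilon>) ^ p * \<delta>)"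
proof -
  let ?\<mu> = "bound i / 2 ^ b (Suc i)"
  let ?A = "{..<2 ^ (\<Sum>s=1..Suc i. b s) :: nat}"
  define S where "S = (\<lambda>\<alpha>. {x \<in> X. prefix i f x = drop_bit (b (Suc i)) \<alpha>})"
  define \<tau> where "\<tau> = (\<lambda>\<alpha> x. take_bit (b (Suc i)) (bxor \<alpha> (drop_bit (tail (Suc i)) (g x))))"
  have "measure_pmf.prob (P (Suc i)) {y. \<not> balanced (Suc i) (f(Suc i := y))} \<le>
    real (card ?A) * (6 * (p / (\<epsilon> * sqrt ?\<mu>)) ^ p + (4 ^ b (Suc i) / \<epsilon>) ^ p * \<delta>)"
  proof (rule prob_union_bound)
    show "{y. \<not> balanced (Suc i) (f(Suc i := y))} \<inter> set_pmf (P (Suc i)) \<subseteq>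
      (\<Union>\<alpha>\<in>?A. {y. real (card {x \<in> S \<alpha>. y x = \<tau> \<alpha> x}) > (1 + \<epsilon>) * ?\<mu>})"
    proof
      fix y assume y: "y \<in> {y. \<not> balanced (Suc i) (f(Suc i := y))} \<inter> set_pmf (P (Suc i))"
      have yb: "y x < 2 ^ b (Suc i)" if "x \<in> U" for x using support_P[of "Suc i" y x] i y that by auto
      obtain \<alpha> where \<alpha>: "bound (Suc i) < card {x \<in> X. prefix (Suc i) (f(Suc i := y)) x = \<alpha>}"
        using y unfolding buckets_balanced_def by (auto simp: not_le)
      \<comment> \<open>An overfull bucket is nonempty, so its label is a prefix of some ball and
        lies in the finite range of the union bound.\<close>
      have "bound (Suc i) \<ge> 0" unfolding bucket_bound_def using \<epsilon> by simp
      then have "{x \<in> X. prefix (Suc i) (f(Suc i := y)) x = \<alpha>} \<noteq> {}" using \<alpha> by (metis card.empty not_le of_nat_0)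
      then obtain x where x: "x \<in> X" "prefix (Suc i) (f(Suc i := y)) x = \<alpha>" by blast
      have "prefix (Suc i) (f(Suc i := y)) x < 2 ^ (\<Sum>s=1..Suc i. b s)"
        using i x(1) U f(2) yb by (intro prefix_less) auto
      then have "\<alpha> \<in> ?A" using x(2) by simp
      moreover have "{x \<in> X. prefix (Suc i) (f(Suc i := y)) x = \<alpha>} = {x \<in> S \<alpha>. y x = \<tau> \<alpha> x}"
      proof -
        have "prefix (Suc i) (f(Suc i := y)) x = \<alpha> \<longleftrightarrow> prefix i f x = drop_bit (b (Suc i)) \<alpha> \<and> y x = \<tau> \<alpha> x"
          if "x \<in> X" for x
        proof -
          have "prefix i (f(Suc i := y)) x = prefix i f x" by (rule prefix_cong) auto
          then show ?thesis
            using prefix_Suc[of i "f(Suc i := y)" x \<alpha>] i yb[of x] that U unfolding \<tau>_def by auto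
        qed
        then show ?thesis unfolding S_def by auto
      qed
      ultimately show "y \<in> (\<Union>\<alpha>\<in>?A. {y. real (card {x \<in> S \<alpha>. y x = \<tau> \<alpha> x}) > (1 + \<epsilon>) * ?\<mu>})"
        using \<alpha> unfolding bound_Suc by auto
    qed
    show "measure_pmf.prob (P (Suc i)) {y. real (card {x \<in> S \<alpha>. y x = \<tau> \<alpha> x}) > (1 + \<epsilon>) * ?\<mu>} \<le>
      6 * (p / (\<epsilon> * sqrt ?\<mu>)) ^ p + (4 ^ b (Suc i) / \<epsilon>) ^ p * \<delta>" for \<alpha>
    proof (rule biased_space_load[OF P U(1) _ \<delta> p \<mu>])
      show "real (card (S \<alpha>)) \<le> 2 ^ b (Suc i) * ?\<mu>"
        using f(1) unfolding buckets_balanced_def S_def by simp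
      show "\<tau> \<alpha> u < 2 ^ b (Suc i)" for u unfolding \<tau>_def by (rule take_bit_nat_less_exp)
    qed (use i U \<epsilon> in \<open>auto simp: S_def\<close>)
  qed simp
  then show ?thesis by simp
qed

text \<open>If the last level is unbalanced there is a first level that spoils the balance. Its
  function is independent of the others, so it may be drawn last, with the balance of the levels
  before it already settled.\<close>

lemma unbalanced_prob:
  fixes \<eta> :: real
  assumes p: "\<And>i. i < k \<Longrightarrow> even (p i) \<and> p i \<le> w"
    and \<mu>: "\<And>i. i < k \<Longrightarrow> bound i / 2 ^ b (Suc i) \<ge> 1"
    and \<eta>: "\<And>i. i < k \<Longrightarrow> 2 ^ (\<Sum>s=1..Suc i. b s) *
      (6 * (p i / (\<epsilon> * sqrt (bound i / 2 ^ b (Suc i)))) ^ p i + (4 ^ b (Suc i) / \<epsilon>) ^ p i * \<delta>) \<le> \<eta>"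
    and \<eta>0: "\<eta> \<ge> 0"
  shows "measure_pmf.prob (Pi_pmf {1..k} dflt P) {f. \<not> balanced k f} \<le> k * \<eta>"
proof -
  let ?F = "Pi_pmf {1..k} dflt P"
  have "measure_pmf.prob ?F {f. \<not> balanced k f} \<le> real (card {..<k}) * \<eta>"
  proof (rule prob_union_bound)
    show "{f. \<not> balanced k f} \<inter> set_pmf ?F \<subseteq> (\<Union>i\<in>{..<k}. {f. balanced i f \<and> \<not> balanced (Suc i) f})"
    proof
      fix f assume f: "f \<in> {f. \<not> balanced k f} \<inter> set_pmf ?F"
      show "f \<in> (\<Union>i\<in>{..<k}. {f. balanced i f \<and> \<not> balanced (Suc i) f})"
      proof (rule ccontr)
        assume "\<not> ?thesis"
        then have step: "balanced i f \<Longrightarrow> i < k \<Longrightarrow> balanced (Suc i) f" for i by blast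
        have "i \<le> k \<Longrightarrow> balanced i f" for i
          by (induction i) (use balanced_0 step in auto)
        then show False using f by auto
      qed
    qed
    fix i assume "i \<in> {..<k}"
    then have i: "i < k" by simp
    let ?A = "{1..k} - {Suc i}"
    have A: "{1..k} = insert (Suc i) ?A" using i by auto
    have "?F = map_pmf (\<lambda>(y, f). f(Suc i := y)) (pair_pmf (P (Suc i)) (Pi_pmf ?A dflt P))"
      by (subst A, rule Pi_pmf_insert) auto
    then have "measure_pmf.prob ?F {f. balanced i f \<and> \<not> balanced (Suc i) f} =
      measure_pmf.prob (pair_pmf (P (Suc i)) (Pi_pmf ?A dflt P))
        ((\<lambda>(y, f). f(Suc i := y)) -` {f. balanced i f \<and> \<not> balanced (Suc i) f})" by simp
    also have "\<dots> \<le> \<eta>"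
    proof (rule prob_pair_le[OF _ \<eta>0])
      fix f assume f: "f \<in> set_pmf (Pi_pmf ?A dflt P)"
      have eq: "balanced i (f(Suc i := y)) = balanced i f" for y
      proof -
        have "prefix i (f(Suc i := y)) x = prefix i f x" for x by (rule prefix_cong) auto
        then show ?thesis unfolding buckets_balanced_def by simp
      qed
      show "measure_pmf.prob (P (Suc i)) {y. (y, f) \<in> (\<lambda>(y, f). f(Suc i := y)) -` {f. balanced i f \<and> \<not> balanced (Suc i) f}} \<le> \<eta>"
      proof (cases "balanced i f")
        case True
        have "f s x < 2 ^ b s" if "s \<in> {1..i}" "x \<in> U" for s x
        proof (rule support_P)
          show "f s \<in> set_pmf (P s)" using f that i by (auto simp: set_Pi_pmf PiE_dflt_def)
        qed (use that i in auto)
        then have "measure_pmf.prob (P (Suc i)) {y. \<not> balanced (Suc i) (f(Suc i := y))} \<le> \<eta>"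
          using unbalanced_step[OF i True, of "p i"] p[OF i] \<mu>[OF i] \<eta>[OF i] by (meson order.trans)
        then show ?thesis using True by (simp add: eq)
      qed (simp add: eq \<eta>0)
    qed
    finally show "measure_pmf.prob ?F {f. balanced i f \<and> \<not> balanced (Suc i) f} \<le> \<eta>" .
  qed simp
  then show ?thesis by simp
qed

end

section \<open>From a high load to a dense set of collisions or a witness tree\<close>

lemma (in descent_dag) index_reached:
  assumes "t < m" "Q \<le> idx t" "d \<le> Q"
  shows "\<exists>t'<m. idx t' = Q"
  using assms(1,2)
proof (induction "idx t - Q" arbitrary: t)
  case 0
  then show ?case by auto
next
  case (Suc n)
  have "ch t 1 < t \<and> idx (ch t 1) = idx t - 1"
    using Suc d assms(3) by (intro ch) auto
  then show ?case using Suc by (intro Suc.hyps(1)[of "ch t 1"]) auto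
qed

text \<open>Distinct directions from one ball lead to distinct groups, so an edge may equally be
  recorded by its ball and its group. This keeps the count of edges intact when they become
  equations between hash values.\<close>

lemma mod_diff_inj:
  fixes a d i i' :: nat
  assumes "i \<in> {1..d}" "i' \<in> {1..d}" "i \<le> a" "i' \<le> a" "(a - i) mod d = (a - i') mod d"
  shows "i = i'"
proof -
  have *: "i = i'" if "i \<le> i'" "i \<in> {1..d}" "i' \<in> {1..d}" "i' \<le> a" "(a - i) mod d = (a - i') mod d" for i i'
  proof -
    have "d dvd (a - i) - (a - i')"
      using that by (subst mod_eq_dvd_iff_nat[symmetric]) auto
    moreover have "(a - i) - (a - i') = i' - i" using that by simp
    moreover have "i' - i < d" using that by auto
    ultimately have "i' - i = 0" using dvd_imp_le by fastforce
    then show ?thesis using that(1) by simp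
  qed
  consider "i \<le> i'" | "i' \<le> i" by linarith
  then show ?thesis
  proof cases
    case 1
    show ?thesis by (rule *) (use 1 assms in auto)
  next
    case 2
    have "i' = i" by (rule *) (use 2 assms in auto)
    then show ?thesis by simp
  qed
qed

text \<open>The deterministic core. A load of \<open>v\<close> forces an index of at least
  \<open>d * v\<close>, and unit steps downwards then meet the index q + K * d + 1 exactly. Either
  some ball of index \<open>q\<close> unfolds into a tree, or the surplus of \<open>K\<close> - 1
  edges over vertices becomes a surplus of equations.\<close>

lemma agl_witness:
  fixes h :: "nat \<Rightarrow> 'a \<Rightarrow> nat"
  assumes d: "d \<ge> 2" and N: "N \<ge> 1" and q: "q0 = (b + 2) * d" "q0 \<le> q" and K: "K \<ge> 1"
    and v: "1 \<le> v" "q + K * d + 1 \<le> d * v" "v \<le> agl_max_load d N h xs"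
  shows "dense d (length xs) (1 + K * (2 * (q + K * d + 1))) (K - 1) (\<lambda>j t. h j (xs ! t)) \<or>
    (\<exists>t<length xs. \<exists>E. witness_tree d q0 b (\<lambda>j x. {y. y < x \<and> h j (xs ! y) = h j (xs ! x)}) q t E \<and>
      finite E \<and> inj_on fst E \<and> card E = tree_edges d q0 b q)"
proof -
  let ?m = "length xs" and ?idx = "agl_index d h xs" and ?hv = "\<lambda>j t. h j (xs ! t)"
  define ch where "ch = (\<lambda>t i. SOME t'. t' < t \<and> ?idx t' = ?idx t - i \<and>
    ?hv (?idx t' mod d + 1) t' = ?hv (?idx t' mod d + 1) t)"
  have chp: "ch t i < t \<and> ?idx (ch t i) = ?idx t - i \<and>
    ?hv (?idx (ch t i) mod d + 1) (ch t i) = ?hv (?idx (ch t i) mod d + 1) t"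
    if "t < ?m" "i \<in> {1..d}" "d + i \<le> ?idx t" for t i
    unfolding ch_def by (rule someI_ex) (rule agl_index_child, use that d in auto)
  interpret descent_dag d ?m ?idx ch
    by unfold_locales (use d chp in auto)
  have dq: "d \<le> q" using q by auto
  obtain t where "t < ?m" "q + K * d + 1 \<le> ?idx t"
    using agl_max_load_index[of d N v h xs] d N v by auto
  then obtain X where X: "X < ?m" "?idx X = q + K * d + 1"
    using index_reached[of t "q + K * d + 1"] dq by auto
  from collision_free_or_dense[OF dq X] show ?thesis
  proof
    assume "\<exists>r<?m. ?idx r = q \<and> \<not> collide r"
    then obtain r where r: "r < ?m" "?idx r = q" "\<not> collide r" by blast
    have "\<exists>E. witness_tree d q0 b (\<lambda>j x. {y. y < x \<and> ?hv j y = ?hv j x}) q r E \<and> finite E \<and> inj_on fst E \<and>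
      card E = tree_edges d q0 b q \<and> fst ` E \<subseteq> {pos r p | p. p \<noteq> [] \<and> legit r p}"
    proof (rule collision_free_witness_tree[OF r(3,1,2) _ q(1)])
      show "(b + 1) * d \<le> q" using q by auto
      show "?hv ((?idx t - i) mod d + 1) (ch t i) = ?hv ((?idx t - i) mod d + 1) t"
        if "t < ?m" "i \<in> {1..d}" "d + i \<le> ?idx t" for t i using chp[OF that] by metis
    qed
    then show ?thesis using r(1) by blast
  next
    assume "\<exists>V D. sub_dag V D \<and> X \<in> V \<and> V \<subseteq> {v. ?idx v \<le> ?idx X} \<and>
       card V \<le> 1 + K * (2 * (q + K * d + 1)) \<and> card V + K \<le> card D + 1"
    then obtain V D where VD: "sub_dag V D" "card V \<le> 1 + K * (2 * (q + K * d + 1))" "card V + K \<le> card D + 1"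
      by blast
    define f where "f = (\<lambda>(t, i). ((?idx t - i) mod d + 1, t))"
    define e where "e = (\<lambda>j t. SOME t'. \<exists>i. (t, i) \<in> D \<and> j = (?idx t - i) mod d + 1 \<and> t' = ch t i)"
    have D: "t \<in> V \<and> t < ?m \<and> i \<in> {1..d} \<and> d + i \<le> ?idx t \<and> ch t i \<in> V" if "(t, i) \<in> D" for t i
      using VD(1) that unfolding sub_dag_def by blast
    have "inj_on f D"
    proof (rule inj_onI)
      fix x y assume xy: "x \<in> D" "y \<in> D" "f x = f y"
      obtain t i i' where ti: "x = (t, i)" "y = (t, i')"
        using xy(3) unfolding f_def by (cases x; cases y) auto
      then have "i = i'" using D[of t i] D[of t i'] xy unfolding f_def
        by (intro mod_diff_inj[of i d i' "?idx t"]) auto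
      then show "x = y" using ti by simp
    qed
    then have "card (f ` D) = card D" by (rule card_image)
    have key: "e j t \<in> V \<and> e j t < t \<and> ?hv j t = ?hv j (e j t)" if "(j, t) \<in> f ` D" for j t
    proof -
      have "\<exists>t' i. (t, i) \<in> D \<and> j = (?idx t - i) mod d + 1 \<and> t' = ch t i"
        using that unfolding f_def by auto
      then have "\<exists>i. (t, i) \<in> D \<and> j = (?idx t - i) mod d + 1 \<and> e j t = ch t i"
        unfolding e_def by (rule someI_ex)
      then obtain i where i: "(t, i) \<in> D" "j = (?idx t - i) mod d + 1" "e j t = ch t i" by blast
      then show ?thesis using D[OF i(1)] chp[of t i] by auto
    qed
    have "dense d ?m (1 + K * (2 * (q + K * d + 1))) (K - 1) ?hv"
      unfolding dense_def
    proof (rule exI[of _ V], rule exI[of _ "f ` D"], rule exI[of _ e], intro conjI)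
      show "V \<subseteq> {..<?m}" using VD(1) unfolding sub_dag_def by blast
      show "card V \<le> 1 + K * (2 * (q + K * d + 1))" by fact
      show "f ` D \<subseteq> {1..d} \<times> V"
        using D d unfolding f_def by (auto simp: Suc_le_eq)
      show "card V + (K - 1) \<le> card (f ` D)" using VD(3) K \<open>card (f ` D) = card D\<close> by simp
      show "\<forall>(j, t)\<in>f ` D. e j t \<in> V \<and> e j t < t \<and> ?hv j t = ?hv j (e j t)"
        using key by blast
    qed
    then show ?thesis by blast
  qed
qed

section \<open>The tail of the maximum load\<close>

text \<open>An inequality, because z may take values outside the range.\<close>

lemma kwise_independent_point:
  assumes G: "kwise_independent U N kg G" and U: "finite U" "S \<subseteq> U" "card S \<le> kg" and N: "N > 0"
  shows "measure_pmf.prob G {g. \<forall>x\<in>S. g x = z x} \<le> 1 / real N ^ card S"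
proof -
  have finS: "finite S" using U finite_subset by auto
  have "{g. \<forall>x\<in>S. g x = z x} \<subseteq> (\<lambda>g. restrict g S) -` {restrict z S}"
    by (auto intro!: restrict_ext)
  then have "measure_pmf.prob G {g. \<forall>x\<in>S. g x = z x} \<le> measure_pmf.prob G ((\<lambda>g. restrict g S) -` {restrict z S})"
    by (intro measure_pmf.finite_measure_mono) auto
  also have "\<dots> = pmf (map_pmf (\<lambda>g. restrict g S) G) (restrict z S)" by (simp add: pmf_map)
  also have "map_pmf (\<lambda>g. restrict g S) G = pmf_of_set (S \<rightarrow>\<^sub>E {..<N})"
    using G U unfolding kwise_independent_def by blast
  also have "pmf (pmf_of_set (S \<rightarrow>\<^sub>E {..<N})) (restrict z S) = indicator (S \<rightarrow>\<^sub>E {..<N}) (restrict z S) / card (S \<rightarrow>\<^sub>E {..<N})"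
    using finS N by (intro pmf_of_set) (auto simp: PiE_eq_empty_iff lessThan_empty_iff intro: finite_PiE)
  also have "\<dots> \<le> 1 / real N ^ card S"
    using finS by (simp add: card_PiE indicator_def)
  finally show ?thesis .
qed

lemma Pi_pmf_point:
  assumes "finite J" "\<And>j. j \<in> J \<Longrightarrow> measure_pmf.prob (p j) {h. \<forall>x\<in>S. h x = z j x} \<le> c"
  shows "measure_pmf.prob (Pi_pmf J dflt p) {h. \<forall>j\<in>J. \<forall>x\<in>S. h j x = z j x} \<le> c ^ card J"
proof -
  have "{h. \<forall>j\<in>J. \<forall>x\<in>S. h j x = z j x} = Pi J (\<lambda>j. {h. \<forall>x\<in>S. h x = z j x})" by auto
  then have "measure_pmf.prob (Pi_pmf J dflt p) {h. \<forall>j\<in>J. \<forall>x\<in>S. h j x = z j x} =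
    (\<Prod>j\<in>J. measure_pmf.prob (p j) {h. \<forall>x\<in>S. h x = z j x})"
    by (simp add: measure_Pi_pmf_Pi[OF assms(1)])
  also have "\<dots> \<le> (\<Prod>j\<in>J. c)" using assms(2) by (intro prod_mono) auto
  finally show ?thesis by simp
qed

lemma Pi_pmf_map_dflt:
  assumes "finite A"
  shows "Pi_pmf A dflt (\<lambda>x. map_pmf (f x) (p x)) =
    map_pmf (\<lambda>h x. if x \<in> A then f x (h x) else dflt) (Pi_pmf A dflt' p)"
  using assms unfolding map_pmf_def by (subst Pi_pmf_bind[where d' = dflt']) auto

text \<open>Hash functions act on balls, while trees and dense sets speak of insertion times.
  Distinctness of the balls makes the translation injective, so that equations for different times
  concern different points of the universe.\<close>

lemma point_positions:
  assumes "distinct xs" "V \<subseteq> {..<length xs}"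
    and le: "\<And>z. measure_pmf.prob M {h. \<forall>j\<in>J. \<forall>x\<in>(!) xs ` V. h j x = z j x} \<le> c"
  shows "measure_pmf.prob (map_pmf (\<lambda>h j t. h j (xs ! t)) M) {h. \<forall>j\<in>J. \<forall>t\<in>V. h j t = z j t} \<le> c"
proof -
  define z' where "z' = (\<lambda>j x. z j (the_inv_into {..<length xs} ((!) xs) x))"
  have "z' j (xs ! t) = z j t" if "t \<in> V" for j t
    unfolding z'_def using that assms(1,2)
    by (subst the_inv_into_f_f) (auto simp: inj_on_nth)
  then have "(\<lambda>h j t. h j (xs ! t)) -` {h. \<forall>j\<in>J. \<forall>t\<in>V. h j t = z j t} = {h. \<forall>j\<in>J. \<forall>x\<in>(!) xs ` V. h j x = z' j x}"
    by auto
  then show ?thesis using le by simp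
qed

lemma card_positions:
  assumes "distinct xs"
  shows "card {t. t < length xs \<and> Q (xs ! t)} = card {x \<in> set xs. Q x}"
proof -
  have "{x \<in> set xs. Q x} = (!) xs ` {t. t < length xs \<and> Q (xs ! t)}" by (auto simp: set_conv_nth)
  moreover have "inj_on ((!) xs) {t. t < length xs \<and> Q (xs ! t)}" using assms by (intro inj_on_nth) auto
  ultimately show ?thesis by (simp add: card_image)
qed

locale hash_family_agl =
  fixes U :: "'a set" and b :: "nat \<Rightarrow> nat" and k w kg m N d :: nat and \<delta>1 \<delta>2 \<epsilon> :: real
    and P :: "nat \<Rightarrow> ('a \<Rightarrow> nat) pmf" and G H :: "('a \<Rightarrow> nat) pmf" and xs :: "'a list"
  assumes d: "d \<ge> 2" and U: "finite U" "set xs \<subseteq> U" "distinct xs" "length xs = m"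
    and N: "N = 2 ^ (\<Sum>i=1..k + 1. b i)" "N \<le> m"
    and P: "\<And>i. i \<in> {1..k} \<Longrightarrow> biased_space U (b i) w \<delta>1 (P i)"
    and L: "biased_space U (b (k + 1)) w \<delta>2 (P (k + 1))"
    and G: "kwise_independent U N kg G"
    and H: "H = map_pmf (\<lambda>(hs, g). \<lambda>x\<in>U. bxor
      (bit_concat b (\<lambda>i. hs i x) (k + 1)) (g x)) (pair_pmf (Pi_pmf {1..k + 1} (\<lambda>_. undefined) P) G)"
    and \<delta>: "\<delta>1 \<ge> 0" "\<delta>2 \<ge> 0" and \<epsilon>: "\<epsilon> > 0"
begin

lemma G_less: "g \<in> set_pmf G \<Longrightarrow> x \<in> U \<Longrightarrow> g x < N"
  using G unfolding kwise_independent_def by (auto dest!: subsetD dest: PiE_mem)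

lemma P_less:
  assumes "i \<in> {1..k + 1}" "y \<in> set_pmf (P i)" "x \<in> U"
  shows "y x < 2 ^ b i"
proof -
  have "set_pmf (P i) \<subseteq> U \<rightarrow>\<^sub>E {..<2 ^ b i}"
  proof (cases "i = k + 1")
    case False
    then show ?thesis using P[of i] assms(1) unfolding biased_space_def by simp
  qed (use L in \<open>simp add: biased_space_def\<close>)
  then have "y \<in> U \<rightarrow>\<^sub>E {..<2 ^ b i}" using assms(2) by blast
  then show ?thesis using assms(3) by (auto dest: PiE_mem)
qed

lemma xs_in_U: "t < m \<Longrightarrow> xs ! t \<in> U"
  using U nth_mem by blast

lemma levels: "g \<in> set_pmf G \<Longrightarrow> hash_levels U b k w \<delta>1 \<epsilon> P (set xs) g"
  using U P G_less \<delta> \<epsilon> N by unfold_locales auto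

lemma H_less:
  assumes "h \<in> set_pmf H" "x \<in> U"
  shows "h x < N"
proof -
  obtain hs g where hg: "hs \<in> set_pmf (Pi_pmf {1..k + 1} (\<lambda>_. undefined) P)" "g \<in> set_pmf G"
    "h = (\<lambda>x\<in>U. bxor (bit_concat b (\<lambda>i. hs i x) (k + 1)) (g x))"
    using assms(1) unfolding H by auto
  have "hs i \<in> set_pmf (P i)" if "i \<in> {1..k + 1}" for i
    using hg(1) that by (auto simp: set_Pi_pmf PiE_dflt_def)
  then have "bit_concat b (\<lambda>i. hs i x) (k + 1) < N"
    unfolding N using P_less assms(2) by (intro bit_concat_less) blast
  then show ?thesis using G_less[OF hg(2) assms(2)] assms(2) unfolding hg(3) N by (simp add: xor_less_power2)
qed

text \<open>For fixed level functions the hash function is \<open>g\<close> XORed with a fixed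
  function. This only permutes the target values, so the exact independence of \<open>g\<close>
  passes to the hash function.\<close>

lemma H_point:
  assumes "S \<subseteq> U" "card S \<le> kg"
  shows "measure_pmf.prob H {h. \<forall>x\<in>S. h x = z x} \<le> 1 / real N ^ card S"
proof -
  have "H = bind_pmf (Pi_pmf {1..k + 1} (\<lambda>_. undefined) P) (\<lambda>hs. map_pmf (\<lambda>g. \<lambda>x\<in>U.
    bxor (bit_concat b (\<lambda>i. hs i x) (k + 1)) (g x)) G)"
    unfolding H pair_pmf_def map_pmf_def by (simp add: bind_assoc_pmf bind_return_pmf)
  moreover have "measure_pmf.prob (map_pmf (\<lambda>g. \<lambda>x\<in>U.
    bxor (bit_concat b (\<lambda>i. hs i x) (k + 1)) (g x)) G) {h. \<forall>x\<in>S. h x = z x}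
    \<le> 1 / real N ^ card S" for hs
  proof -
    have "(\<lambda>g. \<lambda>x\<in>U. bxor (bit_concat b (\<lambda>i. hs i x) (k + 1)) (g x)) -` {h. \<forall>x\<in>S. h x = z x}
      \<subseteq> {g. \<forall>x\<in>S. g x = bxor (z x) (bit_concat b (\<lambda>i. hs i x) (k + 1))}"
    proof clarify
      fix g x assume a: "\<forall>x\<in>S. (\<lambda>x\<in>U. bxor (bit_concat b (\<lambda>i. hs i x) (k + 1)) (g x)) x = z x" "x \<in> S"
      then have "x \<in> U" using assms(1) by blast
      then have "bxor (g x) (bit_concat b (\<lambda>i. hs i x) (k + 1)) = z x"
        using bspec[OF a] by (simp add: xor.commute del: bit_concat.simps)
      then show "g x = bxor (z x) (bit_concat b (\<lambda>i. hs i x) (k + 1))"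
        by (rule iffD1[OF xor_eq_iff])
    qed
    then have "measure_pmf.prob G ((\<lambda>g. \<lambda>x\<in>U. bxor (bit_concat b (\<lambda>i. hs i x) (k + 1)) (g x)) -` {h. \<forall>x\<in>S. h x = z x})
      \<le> measure_pmf.prob G {g. \<forall>x\<in>S. g x = bxor (z x) (bit_concat b (\<lambda>i. hs i x) (k + 1))}"
      by (intro measure_pmf.finite_measure_mono) auto
    also have "\<dots> \<le> 1 / real N ^ card S"
      using assms N(1) by (intro kwise_independent_point[OF G U(1)]) auto
    finally show ?thesis by simp
  qed
  ultimately show ?thesis by (auto intro: prob_bind_le)
qed

lemma dense_prob_H:
  assumes "c \<ge> 1" "kg \<ge> 1"
  shows "measure_pmf.prob (Pi_pmf {1..d} dflt (\<lambda>_. H)) {h. dense d m kg c (\<lambda>j t. h j (xs ! t))}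
    \<le> real kg * ((real m / real N) * 2 ^ d * real kg) ^ kg * real kg ^ c / real N ^ c"
proof -
  let ?M = "map_pmf (\<lambda>h j t. h j (xs ! t)) (Pi_pmf {1..d} dflt (\<lambda>_. H))"
  have "measure_pmf.prob ?M {h. dense d m kg c h}
    \<le> real kg * ((real m / real N) * 2 ^ d * real kg) ^ kg * real kg ^ c / real N ^ c"
  proof (rule dense_prob)
    show "h j t < N" if "h \<in> set_pmf ?M" "j \<in> {1..d}" "t < m" for h j t
    proof -
      obtain h' where "h' \<in> set_pmf (Pi_pmf {1..d} dflt (\<lambda>_. H))" "h = (\<lambda>j t. h' j (xs ! t))"
        using \<open>h \<in> set_pmf ?M\<close> by auto
      moreover have "xs ! t \<in> U" using U that(3) by auto
      ultimately show ?thesis using that(2) H_less by (auto simp: set_Pi_pmf PiE_dflt_def)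
    qed
    show "measure_pmf.prob ?M {h. \<forall>j\<in>{1..d}. \<forall>t\<in>V. h j t = z j t} \<le> 1 / real N ^ (d * card V)"
      if V: "V \<subseteq> {..<m}" "card V \<le> kg" for V z
    proof (rule point_positions)
      fix z
      have inj: "inj_on ((!) xs) V" using U(3,4) V(1) by (intro inj_on_nth) auto
      have "measure_pmf.prob (Pi_pmf {1..d} dflt (\<lambda>_. H)) {h. \<forall>j\<in>{1..d}. \<forall>x\<in>(!) xs ` V. h j x = z j x}
        \<le> (1 / real N ^ card ((!) xs ` V)) ^ card {1..d}"
      proof (rule Pi_pmf_point)
        have "(!) xs ` V \<subseteq> U" using xs_in_U V(1) by auto
        then show "measure_pmf.prob H {h. \<forall>x\<in>(!) xs ` V. h x = z j x} \<le> 1 / real N ^ card ((!) xs ` V)" for j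
          using V(2) by (intro H_point) (simp_all add: card_image[OF inj])
      qed simp
      then show "measure_pmf.prob (Pi_pmf {1..d} dflt (\<lambda>_. H)) {h. \<forall>j\<in>{1..d}. \<forall>x\<in>(!) xs ` V. h j x = z j x}
        \<le> 1 / real N ^ (d * card V)"
        by (simp add: card_image[OF inj] power_divide power_mult[symmetric] mult.commute)
    qed (use U V in auto)
  qed (use assms N in auto)
  then show ?thesis by simp
qed

definition hash_value :: "(nat \<Rightarrow> 'a \<Rightarrow> nat) \<times> ('a \<Rightarrow> nat) \<Rightarrow> ('a \<Rightarrow> nat) \<Rightarrow> 'a \<Rightarrow> nat" where
  "hash_value q l = (\<lambda>x\<in>U. bxor
     (push_bit (b (k + 1)) (bit_concat b (\<lambda>i. fst q i x) k) + l x) (snd q x))"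

abbreviation Q where
  "Q \<equiv> pair_pmf (Pi_pmf {1..k} (\<lambda>_. undefined) P) G"

text \<open>The same distribution with the last level drawn after everything else, so that one can
  condition on the first \<open>k\<close> levels and \<open>g\<close>.\<close>

lemma H_eq: "H = bind_pmf Q (\<lambda>q. map_pmf (hash_value q) (P (k + 1)))"
proof -
  have "{1..k + 1} = insert (k + 1) {1..k}" by auto
  then have "Pi_pmf {1..k + 1} (\<lambda>_. undefined) P =
    bind_pmf (P (k + 1)) (\<lambda>y. map_pmf (\<lambda>f. f(k + 1 := y)) (Pi_pmf {1..k} (\<lambda>_. undefined) P))"
    by (simp add: Pi_pmf_insert pair_pmf_def map_pmf_def bind_assoc_pmf bind_return_pmf)
  also have "\<dots> = bind_pmf (Pi_pmf {1..k} (\<lambda>_. undefined) P) (\<lambda>f. map_pmf (\<lambda>y. f(k + 1 := y)) (P (k + 1)))"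
    unfolding map_pmf_def by (rule bind_commute_pmf)
  finally have *: "Pi_pmf {1..k + 1} (\<lambda>_. undefined) P = \<dots>" .
  have c: "bit_concat b (\<lambda>i. (f(Suc k := y)) i x) (Suc k) = push_bit (b (Suc k)) (bit_concat b (\<lambda>i. f i x) k) + y x" for f y x
  proof -
    have "bit_concat b (\<lambda>i. (f(Suc k := y)) i x) k = bit_concat b (\<lambda>i. f i x) k"
      by (rule bit_concat_cong) auto
    then show ?thesis by simp
  qed
  have "H = bind_pmf (Pi_pmf {1..k} (\<lambda>_. undefined) P) (\<lambda>f. bind_pmf (P (k + 1)) (\<lambda>y. map_pmf (\<lambda>g. hash_value (f, g) y) G))"
    unfolding H pair_pmf_def * map_pmf_def
    by (simp add: bind_assoc_pmf bind_return_pmf c hash_value_def del: bit_concat.simps fun_upd_apply)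
  also have "\<dots> = bind_pmf (Pi_pmf {1..k} (\<lambda>_. undefined) P) (\<lambda>f. bind_pmf G (\<lambda>g. map_pmf (hash_value (f, g)) (P (k + 1))))"
    unfolding map_pmf_def by (subst bind_commute_pmf) simp
  also have "\<dots> = bind_pmf Q (\<lambda>q. map_pmf (hash_value q) (P (k + 1)))"
    unfolding pair_pmf_def by (simp add: bind_assoc_pmf bind_return_pmf)
  finally show ?thesis .
qed

definition unbalanced :: "(nat \<Rightarrow> 'a \<Rightarrow> nat) \<times> ('a \<Rightarrow> nat) \<Rightarrow> bool" where
  "unbalanced q \<longleftrightarrow> \<not> buckets_balanced b k \<epsilon> (set xs) (snd q) k (fst q)"

definition tree_event :: "nat \<Rightarrow> nat \<Rightarrow> nat \<Rightarrow> (nat \<Rightarrow> 'a \<Rightarrow> nat) set" where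
  "tree_event q0 b0 q = {h. \<exists>t<m. \<exists>E. witness_tree d q0 b0 (\<lambda>j x. {y. y < x \<and> h j (xs ! y) = h j (xs ! x)}) q t E \<and>
     finite E \<and> inj_on fst E \<and> card E = tree_edges d q0 b0 q}"

text \<open>The second condition in \<open>w\<close> says that \<delta>2 is at most the uniform
  probability of prescribed values on the balls of a tree. So the bias at most doubles such a
  probability in each group, whence 2^d. Equal hash values mean equal prefixes, that is, a common
  bucket, and last blocks that agree after XOR with the low bits of \<open>g\<close>; \<Phi> solves
  the latter for the child.\<close>

lemma tree_prob_given_prefix:
  fixes \<rho> :: real
  assumes q: "d \<le> q0" "q0 \<le> q + d"
    and \<rho>: "\<rho> \<ge> 1" "\<rho> ^ (b0 + 2) / fact b0 \<le> 1 / 2" "bucket_bound b \<epsilon> m k \<le> \<rho> * 2 ^ b (k + 1)"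
    and w: "2 * tree_edges d q0 b0 q \<le> w" "\<delta>2 * (2 ^ b (k + 1)) ^ (2 * tree_edges d q0 b0 q) \<le> 1"
    and qs: "\<And>j. j \<in> {1..d} \<Longrightarrow> \<not> unbalanced (qs j)" "\<And>j. j \<in> {1..d} \<Longrightarrow> qs j \<in> set_pmf Q"
  shows "measure_pmf.prob (Pi_pmf {1..d} dflt (\<lambda>j. map_pmf (hash_value (qs j)) (P (k + 1)))) (tree_event q0 b0 q)
    \<le> 2 ^ d * real m * (1 / 2) ^ tree_leaves d q0 q"
proof -
  let ?L = "Pi_pmf {1..d} undefined (\<lambda>_. P (k + 1))" and ?R = "2 ^ b (k + 1) :: nat"
  let ?M = "map_pmf (\<lambda>l j t. l j (xs ! t)) ?L"
  define pre where "pre = (\<lambda>j t. hash_prefix b k (snd (qs j)) k (fst (qs j)) (xs ! t))"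
  define hv where "hv = (\<lambda>(h :: nat \<Rightarrow> nat \<Rightarrow> nat) j y. bxor
    (push_bit (b (k + 1)) (bit_concat b (\<lambda>i. fst (qs j) i (xs ! y)) k) + h j y) (snd (qs j) (xs ! y)))"
  let ?g = "\<lambda>j y. take_bit (b (k + 1)) (snd (qs j) (xs ! y))"
  define \<Phi> where "\<Phi> = (\<lambda>j y x v. bxor (bxor v (?g j x)) (?g j y))"
  have xU: "xs ! t \<in> U" if "t < m" for t using U that by auto
  have Mless: "h j t < ?R" if h: "h \<in> set_pmf ?M" "j \<in> {1..d}" "t < m" for h j t
  proof -
    obtain l where l: "l \<in> set_pmf ?L" "h = (\<lambda>j t. l j (xs ! t))" using h(1) by auto
    then have "l j \<in> set_pmf (P (k + 1))" using h(2) by (auto simp: set_Pi_pmf PiE_dflt_def)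
    then show ?thesis using P_less[of "k + 1" "l j" "xs ! t"] xU[OF h(3)] l(2) by simp
  qed
  have "measure_pmf.prob ?M {h. \<exists>t<m. \<exists>E. witness_tree d q0 b0 (\<lambda>j x. {y. y < x \<and> hv h j y = hv h j x}) q t E \<and>
      finite E \<and> inj_on fst E \<and> card E = tree_edges d q0 b0 q} \<le> 2 ^ d * real m * (1 / 2) ^ tree_leaves d q0 q"
  proof (rule tree_prob[OF d q _ \<rho>(1,2), where pre = pre and \<Phi> = \<Phi> and R = ?R])
    show "real (card {y. y < m \<and> pre j y = pre j t}) \<le> \<rho> * real ?R" if j: "j \<in> {1..d}" "t < m" for j t
    proof -
      have "card {y. y < m \<and> pre j y = pre j t} =
        card {x \<in> set xs. hash_prefix b k (snd (qs j)) k (fst (qs j)) x = pre j t}"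
        using card_positions[OF U(3), of "\<lambda>x. hash_prefix b k (snd (qs j)) k (fst (qs j)) x = pre j t"]
        unfolding pre_def U(4) .
      moreover have "card (set xs) = m" using U(3,4) distinct_card by blast
      then have "real (card {x \<in> set xs. hash_prefix b k (snd (qs j)) k (fst (qs j)) x = pre j t}) \<le> bucket_bound b \<epsilon> m k"
        using qs(1)[OF j(1)] unfolding unbalanced_def buckets_balanced_def by simp
      ultimately show ?thesis using \<rho>(3) by simp
    qed
    show "measure_pmf.prob ?M {h. \<forall>j\<in>{1..d}. \<forall>t\<in>V. h j t = z j t} \<le> 2 ^ d / real ?R ^ (d * card V)"
      if V: "V \<subseteq> {..<m}" "card V \<le> 2 * tree_edges d q0 b0 q" for V z
    proof (rule point_positions)
      fix z :: "nat \<Rightarrow> 'a \<Rightarrow> nat"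
      have inj: "inj_on ((!) xs) V" using U(3,4) V(1) by (intro inj_on_nth) auto
      have S: "(!) xs ` V \<subseteq> U" using xU V(1) by auto
      have one: "measure_pmf.prob (P (k + 1)) {h. \<forall>x\<in>(!) xs ` V. h x = z j x} \<le> 2 / ?R ^ card V" for j
      proof (cases "\<forall>x\<in>(!) xs ` V. z j x < ?R")
        case True
        have "\<bar>measure_pmf.prob (P (k + 1)) {h. \<forall>x\<in>(!) xs ` V. h x = z j x} - (1 / 2 ^ b (k + 1)) ^ card ((!) xs ` V)\<bar> \<le> \<delta>2"
          using True V w by (intro biased_space_point[OF L U(1) S]) (auto simp: card_image[OF inj] \<delta>)
        then have "measure_pmf.prob (P (k + 1)) {h. \<forall>x\<in>(!) xs ` V. h x = z j x} \<le> 1 / ?R ^ card V + \<delta>2"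
          by (simp add: card_image[OF inj] power_one_over)
        moreover have "\<delta>2 * ?R ^ card V \<le> 1"
        proof -
          have "\<delta>2 * real ?R ^ card V \<le> \<delta>2 * real ?R ^ (2 * tree_edges d q0 b0 q)"
            using V(2) \<delta> by (intro mult_left_mono power_increasing) auto
          then show ?thesis using w(2) by simp
        qed
        then have "\<delta>2 \<le> 1 / ?R ^ card V" by (simp add: field_simps)
        ultimately show ?thesis by simp
      next
        case False
        then obtain x where x: "x \<in> (!) xs ` V" "\<not> z j x < ?R" by blast
        have "{h. \<forall>x\<in>(!) xs ` V. h x = z j x} \<inter> set_pmf (P (k + 1)) = {}"
          using P_less[of "k + 1" _ x] x S by fastforce
        then have "measure_pmf.prob (P (k + 1)) {h. \<forall>x\<in>(!) xs ` V. h x = z j x} = 0"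
          by (metis measure_Int_set_pmf measure_empty)
        then show ?thesis by simp
      qed
      have "measure_pmf.prob ?L {h. \<forall>j\<in>{1..d}. \<forall>x\<in>(!) xs ` V. h j x = z j x} \<le> (2 / ?R ^ card V) ^ card {1..d}"
        using one by (intro Pi_pmf_point) auto
      then show "measure_pmf.prob ?L {h. \<forall>j\<in>{1..d}. \<forall>x\<in>(!) xs ` V. h j x = z j x} \<le> 2 ^ d / real ?R ^ (d * card V)"
        by (simp add: power_divide power_mult[symmetric] mult_ac)
    qed (use U V in auto)
    show "pre j y = pre j x \<and> h j y = \<Phi> j y x (h j x)"
      if h: "h \<in> set_pmf ?M" "j \<in> {1..d}" "x < m" "y < m" "hv h j y = hv h j x" for h j x y
    proof
      have less: "h j y < ?R" "h j x < ?R" using Mless h by auto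
      have tail: "hash_tail b k k = b (k + 1)"
      proof -
        have "{k<..k + 1} = {k + 1}" by auto
        then show ?thesis by (simp add: hash_tail_def)
      qed
      have dr: "drop_bit (b (k + 1)) (hv h j t) = pre j t" if "h j t < ?R" for t
        using that unfolding hv_def pre_def hash_prefix_def tail
        by (simp add: drop_bit_eq_div[of _ "_ + _"] push_bit_eq_mult)
      have tk: "take_bit (b (k + 1)) (hv h j t) = bxor (h j t) (?g j t)" if "h j t < ?R" for t
      proof -
        have "take_bit (b (k + 1)) (push_bit (b (k + 1)) c + h j t) = h j t" for c
          using that by (simp add: take_bit_eq_mod push_bit_eq_mult)
        then show ?thesis unfolding hv_def by simp
      qed
      show "pre j y = pre j x" using dr[OF less(1)] dr[OF less(2)] h(5) by simp
      have "bxor (h j y) (?g j y) = bxor (h j x) (?g j x)"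
        using tk[OF less(1)] tk[OF less(2)] h(5) by simp
      then show "h j y = \<Phi> j y x (h j x)" unfolding \<Phi>_def by (rule iffD1[OF xor_eq_iff])
    qed
  qed (use Mless in auto)
  moreover have "Pi_pmf {1..d} dflt (\<lambda>j. map_pmf (hash_value (qs j)) (P (k + 1))) =
    map_pmf (\<lambda>l j. if j \<in> {1..d} then hash_value (qs j) (l j) else dflt) ?L"
    by (rule Pi_pmf_map_dflt) simp
  moreover have "(\<lambda>l j. if j \<in> {1..d} then hash_value (qs j) (l j) else dflt) -` tree_event q0 b0 q \<subseteq>
    (\<lambda>l j t. l j (xs ! t)) -` {h. \<exists>t<m. \<exists>E. witness_tree d q0 b0 (\<lambda>j x. {y. y < x \<and> hv h j y = hv h j x}) q t E \<and>
      finite E \<and> inj_on fst E \<and> card E = tree_edges d q0 b0 q}"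
  proof
    fix l assume "l \<in> (\<lambda>l j. if j \<in> {1..d} then hash_value (qs j) (l j) else dflt) -` tree_event q0 b0 q"
    then obtain t E where tE: "t < m" "finite E" "inj_on fst E" "card E = tree_edges d q0 b0 q" and
      e: "witness_tree d q0 b0 (\<lambda>j x. {y. y < x \<and> (if j \<in> {1..d} then hash_value (qs j) (l j) else dflt) (xs ! y) =
        (if j \<in> {1..d} then hash_value (qs j) (l j) else dflt) (xs ! x)}) q t E"
      unfolding tree_event_def by auto
    let ?h = "\<lambda>j t. l j (xs ! t)"
    have "witness_tree d q0 b0 (\<lambda>j x. {y. y < x \<and> hv ?h j y = hv ?h j x}) q t E"
    proof (rule witness_tree_mono[OF e])
      fix j x assume "x \<le> t" "j \<in> {1..d}"
      then show "{y. y < x \<and> (if j \<in> {1..d} then hash_value (qs j) (l j) else dflt) (xs ! y) =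
        (if j \<in> {1..d} then hash_value (qs j) (l j) else dflt) (xs ! x)} \<subseteq> {y. y < x \<and> hv ?h j y = hv ?h j x}"
        using xU tE(1) by (auto simp: hash_value_def hv_def)
    qed (use d in auto)
    then show "l \<in> (\<lambda>l j t. l j (xs ! t)) -` {h. \<exists>t<m. \<exists>E. witness_tree d q0 b0 (\<lambda>j x. {y. y < x \<and> hv h j y = hv h j x}) q t E \<and>
      finite E \<and> inj_on fst E \<and> card E = tree_edges d q0 b0 q}" using tE by auto
  qed
  ultimately show ?thesis
    by (simp add: order.trans[OF measure_pmf.finite_measure_mono])
qed

text \<open>The summands belong to dense sets, to unbalanced buckets in one of the \<open>d\<close>
  groups, and to trees within balanced buckets. The first uses all the randomness of
  \<open>g\<close>, the third holds for each fixed \<open>g\<close>; a union bound over the two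
  events lets both uses stand side by side.\<close>

lemma agl_tail:
  fixes \<rho> \<eta> :: real
  assumes q: "q0 = (b0 + 2) * d" "q0 \<le> q" and K: "K \<ge> 2" and kg: "kg = 1 + K * (2 * (q + K * d + 1))"
    and v: "q + K * d + 1 \<le> d * v"
    and \<rho>: "\<rho> \<ge> 1" "\<rho> ^ (b0 + 2) / fact b0 \<le> 1 / 2" "bucket_bound b \<epsilon> m k \<le> \<rho> * 2 ^ b (k + 1)"
    and w: "2 * tree_edges d q0 b0 q \<le> w" "\<delta>2 * (2 ^ b (k + 1)) ^ (2 * tree_edges d q0 b0 q) \<le> 1"
    and p: "\<And>i. i < k \<Longrightarrow> even (p i) \<and> p i \<le> w"
    and \<mu>: "\<And>i. i < k \<Longrightarrow> bucket_bound b \<epsilon> m i / 2 ^ b (Suc i) \<ge> 1"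
    and \<eta>: "\<And>i. i < k \<Longrightarrow> 2 ^ (\<Sum>s=1..Suc i. b s) *
      (6 * (p i / (\<epsilon> * sqrt (bucket_bound b \<epsilon> m i / 2 ^ b (Suc i)))) ^ p i + (4 ^ b (Suc i) / \<epsilon>) ^ p i * \<delta>1) \<le> \<eta>"
    and \<eta>0: "\<eta> \<ge> 0"
  shows "measure_pmf.prob (Pi_pmf {1..d} dflt (\<lambda>_. H)) {h. v \<le> agl_max_load d N h xs} \<le>
    real kg * ((real m / real N) * 2 ^ d * real kg) ^ kg * real kg ^ (K - 1) / real N ^ (K - 1) +
    (d * (k * \<eta>) + 2 ^ d * real m * (1 / 2) ^ tree_leaves d q0 q)"
proof -
  let ?\<Omega> = "Pi_pmf {1..d} dflt (\<lambda>_. H)"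
  let ?D = "{h. dense d m kg (K - 1) (\<lambda>j t. h j (xs ! t))}"
  have N1: "N \<ge> 1" using N(1) by simp
  have "0 < d * v" using v by linarith
  then have v1: "1 \<le> v" by (cases v) auto
  have "{h. v \<le> agl_max_load d N h xs} \<subseteq> ?D \<union> tree_event q0 b0 q"
  proof
    fix h assume "h \<in> {h. v \<le> agl_max_load d N h xs}"
    then show "h \<in> ?D \<union> tree_event q0 b0 q"
      using agl_witness[OF d N1 q _ v1 v, of h xs] K unfolding tree_event_def kg U(4) by auto
  qed
  then have "measure_pmf.prob ?\<Omega> {h. v \<le> agl_max_load d N h xs} \<le> measure_pmf.prob ?\<Omega> (?D \<union> tree_event q0 b0 q)"
    by (intro measure_pmf.finite_measure_mono) auto
  also have "\<dots> \<le> measure_pmf.prob ?\<Omega> ?D + measure_pmf.prob ?\<Omega> (tree_event q0 b0 q)"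
    by (rule measure_Un_le) auto
  also have "measure_pmf.prob ?\<Omega> ?D \<le> real kg * ((real m / real N) * 2 ^ d * real kg) ^ kg * real kg ^ (K - 1) / real N ^ (K - 1)"
    using K kg by (intro dense_prob_H) auto
  also have "measure_pmf.prob ?\<Omega> (tree_event q0 b0 q) \<le> d * (k * \<eta>) + 2 ^ d * real m * (1 / 2) ^ tree_leaves d q0 q"
  proof -
    let ?B = "{qs. \<exists>j\<in>{1..d}. unbalanced (qs j)}"
    let ?QQ = "Pi_pmf {1..d} undefined (\<lambda>_. Q)"
    \<comment> \<open>All \<open>d\<close> samples are split in two stages at once: first the upper
      levels and \<open>g\<close> of every group, then the \<open>d\<close> last functions.\<close>
    have eq: "?\<Omega> = bind_pmf ?QQ (\<lambda>qs. Pi_pmf {1..d} dflt (\<lambda>j. map_pmf (hash_value (qs j)) (P (k + 1))))"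
      unfolding H_eq by (rule Pi_pmf_bind) simp
    have "measure_pmf.prob ?\<Omega> (tree_event q0 b0 q) \<le> measure_pmf.prob ?QQ ?B + 2 ^ d * real m * (1 / 2) ^ tree_leaves d q0 q"
      unfolding eq
    proof (rule prob_bind_le_add)
      fix qs assume qs: "qs \<in> set_pmf ?QQ" "qs \<notin> ?B"
      then have "qs j \<in> set_pmf Q" if "j \<in> {1..d}" for j
        using that by (auto simp: set_Pi_pmf PiE_dflt_def)
      then show "measure_pmf.prob (Pi_pmf {1..d} dflt (\<lambda>j. map_pmf (hash_value (qs j)) (P (k + 1)))) (tree_event q0 b0 q)
        \<le> 2 ^ d * real m * (1 / 2) ^ tree_leaves d q0 q"
        using qs(2) q d by (intro tree_prob_given_prefix[OF _ _ \<rho> w]) auto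
    qed simp
    moreover have "measure_pmf.prob ?QQ ?B \<le> real (card {1..d}) * (k * \<eta>)"
    proof (rule prob_union_bound[where B = "\<lambda>j. {qs. unbalanced (qs j)}"])
      fix j assume j: "j \<in> {1..d}"
      have "measure_pmf.prob ?QQ {qs. unbalanced (qs j)} = measure_pmf.prob (map_pmf (\<lambda>qs. qs j) ?QQ) {q. unbalanced q}"
        by (simp add: vimage_def)
      also have "map_pmf (\<lambda>qs. qs j) ?QQ = Q" using j by (subst Pi_pmf_component) auto
      also have "measure_pmf.prob Q {q. unbalanced q} \<le> k * \<eta>"
      proof (rule prob_pair_le)
        fix g assume g: "g \<in> set_pmf G"
        interpret hl: hash_levels U b k w \<delta>1 \<epsilon> P "set xs" g by (rule levels[OF g])
        have "card (set xs) = m" using U(3,4) distinct_card by blast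
        then show "measure_pmf.prob (Pi_pmf {1..k} (\<lambda>_. undefined) P) {f. (f, g) \<in> {q. unbalanced q}} \<le> k * \<eta>"
          using hl.unbalanced_prob[of p \<eta> "\<lambda>_. undefined"] p \<mu> \<eta> \<eta>0 by (simp add: unbalanced_def)
      qed (use \<eta>0 in simp)
      finally show "measure_pmf.prob ?QQ {qs. unbalanced (qs j)} \<le> k * \<eta>" .
    qed auto
    ultimately show ?thesis by simp
  qed
  finally show ?thesis by simp
qed

end

section \<open>Choice of the parameters\<close>

lemma le_two_powr: "x \<le> 2 powr x" for x :: real
proof (cases "x > 0")
  case True
  have "ln (x / 2) \<le> x / 2 - 1" using True by (intro ln_le_minus_one) auto
  then have "ln x \<le> x / 2 + (ln 2 - 1)" using True by (simp add: ln_div)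
  also have "\<dots> \<le> x / 2" using ln_2_less_1 by simp
  also have "\<dots> \<le> x * ln 2" using ln2_ge_two_thirds True by (intro order.trans[OF _ mult_left_mono[of "1 / 2" "ln 2" x]]) auto
  finally have "exp (ln x) \<le> exp (x * ln 2)" by simp
  then show ?thesis using True by (simp add: powr_def)
next
  case False
  then show ?thesis by (meson not_less order.trans powr_ge_zero)
qed

lemma log2_le: "log 2 x \<le> x" if "x > 0" for x :: real
  using le_two_powr[of x] that by (simp add: log_le_iff)

text \<open>From b! \<ge> (b / e)^b, e \<le> 3 and b \<ge> 6 \<rho> one gets b! \<ge> (2 \<rho>)^b,
  and the spare factor 2^b covers both additional powers of \<rho> and the factor 2.\<close>

lemma leaf_weight:
  fixes \<rho> :: real
  assumes "\<rho> \<ge> 1"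
  shows "\<rho> ^ (nat \<lceil>6 * \<rho>\<rceil> + 2) / fact (nat \<lceil>6 * \<rho>\<rceil>) \<le> 1 / 2"
proof -
  define b where "b = nat \<lceil>6 * \<rho>\<rceil>"
  have b: "real b \<ge> 6 * \<rho>" unfolding b_def by linarith
  have bpos: "real b > 0" using b assms by linarith
  have "real b ^ b \<le> fact b * exp (real b)" by (intro power_le_fact_exp) simp
  also have "exp (real b) = exp 1 ^ b" by (simp flip: exp_of_nat_mult)
  also have "fact b * exp 1 ^ b \<le> fact b * (3 :: real) ^ b"
    by (intro mult_left_mono power_mono exp_le) auto
  finally have "(real b / 3) ^ b \<le> fact b" by (simp add: power_divide field_simps)
  moreover have "(2 * \<rho>) ^ b \<le> (real b / 3) ^ b" using b assms by (intro power_mono) auto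
  ultimately have f: "(2 * \<rho>) ^ b \<le> fact b" by linarith
  have "2 * \<rho>\<^sup>2 \<le> 2 ^ b"
  proof -
    have "\<rho>\<^sup>2 \<le> (2 powr \<rho>)\<^sup>2" using le_two_powr assms by (intro power_mono) auto
    then have "2 * \<rho>\<^sup>2 \<le> 2 powr 1 * (2 powr \<rho>)\<^sup>2" by simp
    also have "\<dots> = 2 powr (1 + (\<rho> + \<rho>))"
      unfolding power2_eq_square powr_add ..
    also have "\<dots> \<le> 2 powr real b" using b assms by (intro powr_mono) auto
    also have "\<dots> = 2 ^ b" by (simp add: powr_realpow)
    finally show ?thesis .
  qed
  then have "2 * \<rho> ^ (b + 2) \<le> 2 ^ b * \<rho> ^ b"
    using assms by (simp add: power_add power2_eq_square)
  also have "\<dots> = (2 * \<rho>) ^ b" by (simp add: power_mult_distrib)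
  finally have "2 * \<rho> ^ (b + 2) \<le> fact b" using f by linarith
  then show ?thesis unfolding b_def[symmetric] by (simp add: field_simps)
qed

locale agl_parameters =
  fixes d :: nat and c M :: real and n N m l :: nat
  assumes d: "d \<ge> 2" and c: "c > 1" and M: "M \<ge> 1"
    and n: "n = d * N" and N: "N = 2 ^ l" and m: "n \<le> m" "real m \<le> M * real n"
begin

definition L :: real where "L = log 2 (real n)"
definition LL :: real where "LL = log 2 L"
text \<open>Of the \<open>K\<close> - 1 powers of 1 / N in the bound for dense sets, one absorbs the
  number of these sets; at least c + 2 powers remain, which leaves room for passing from N to
  n.\<close>

definition K :: nat where "K = nat \<lceil>c\<rceil> + 4"
text \<open>Twice the average number of balls in a bin of a group, which bounds the number of
  balls in a bucket divided by its number of bins.\<close>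

definition \<rho> :: real where "\<rho> = 2 * real m / real N"
definition b0 :: nat where "b0 = nat \<lceil>6 * \<rho>\<rceil>"
text \<open>The number of index steps after which a tree has at least (c + 3) log n leaves; their
  weight n^(-(c + 3)) has to beat the M n possible roots and constants.\<close>

definition T :: nat where "T = nat \<lceil>log (phi d) ((c + 3) * L)\<rceil>"
definition q0 :: nat where "q0 = (b0 + 2) * d"
definition q :: nat where "q = q0 + T"
definition kg :: nat where "kg = 1 + K * (2 * (q + K * d + 1))"
text \<open>Multiplied by \<open>d\<close> this has to reach q + K * d + 1: b0 + 2 stands for
  \<open>q0\<close>, the last summand for \<open>T\<close> / d rounded upwards, and one further unit
  for the summand 1.\<close>

definition v :: nat where "v = b0 + 3 + K + (T div d + 1)"
text \<open>With this \<open>k\<close>, \<open>n powr (1 / 2 ^ k)\<close> lies between \<open>L ^ 12\<close> and \<open>L ^ 24\<close>.\<close>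

definition k :: nat where "k = nat \<lfloor>log 2 (L / (12 * LL))\<rfloor>"

text \<open>This bounds \<open>b0\<close> uniformly in m, so the constants built on it depend on d,
  c and M only.\<close>

definition bM :: real where "bM = 12 * real d * M + 1"
definition edge_const :: real where "edge_const = (bM + 2) * (c + 3) * 2 ^ (d + 1)"
definition kg_const :: real where
  "kg_const = 1 + 2 * real K * ((bM + 2) * d + 2 + 2 * (c + 3) + 2 + real K * d)"
text \<open>A sum of nonnegative terms dominates each of them, so a single number collects all
  largeness conditions.\<close>

definition threshold :: real where
  "threshold = d * M * 2 ^ d * kg_const\<^sup>2 + kg_const * K + d + 24 + K + 3 * d powr (c + 2) + 3 * 2 ^ d * M + 21 * d"

end

text \<open>The condition on the square of \<open>LL\<close> is dictated by dense sets: their size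
  and the logarithm of the factor per ball are both bounded by multiples of \<open>LL\<close>, so
  their total weight is 2 to the O(\<open>LL\<close>^2), which must stay below N.\<close>

locale agl_parameters_large = agl_parameters +
  assumes large: "threshold \<le> real n" "threshold \<le> L" "threshold \<le> LL" "threshold * LL\<^sup>2 \<le> L"
begin

lemma K_bounds: "c + 4 \<le> real K" "real K \<le> c + 5" "K \<ge> 2"
  using c unfolding K_def by linarith+

lemma consts_pos: "bM \<ge> 1" "edge_const \<ge> 1" "kg_const \<ge> 1"
proof -
  show bM: "bM \<ge> 1" using M unfolding bM_def by simp
  have "(1::real) \<le> (bM + 2) * (c + 3)" using bM c mult_mono[of 1 "bM + 2" 1 "c + 3"] by simp
  then show "edge_const \<ge> 1" unfolding edge_const_def
    using mult_mono[of 1 "(bM + 2) * (c + 3)" 1 "2 ^ (d + 1) :: real"]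
      one_le_power[of "2 :: real" "d + 1"] by linarith
  show "kg_const \<ge> 1" unfolding kg_const_def using bM c by simp
qed

lemma threshold_ge:
  "d * M * 2 ^ d * kg_const\<^sup>2 + kg_const * K + d \<le> threshold" "24 \<le> threshold" "K \<le> threshold" "d \<le> threshold"
  "3 * d powr (c + 2) \<le> threshold" "3 * 2 ^ d * M \<le> threshold" "21 * d \<le> threshold"
proof -
  have "0 \<le> d * M * 2 ^ d * kg_const\<^sup>2" "0 \<le> kg_const * K" "0 \<le> 3 * d powr (c + 2)" "0 \<le> 3 * 2 ^ d * M"
    using M consts_pos by auto
  then show
    "d * M * 2 ^ d * kg_const\<^sup>2 + kg_const * K + d \<le> threshold" "24 \<le> threshold" "K \<le> threshold" "d \<le> threshold"
    "3 * d powr (c + 2) \<le> threshold" "3 * 2 ^ d * M \<le> threshold" "21 * d \<le> threshold"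
    unfolding threshold_def by linarith+
qed

lemma LL24: "LL \<ge> 24" and L24: "L \<ge> 24" and n24: "real n \<ge> 24"
  using large threshold_ge(2) by linarith+

lemma n_powr: "real n = 2 powr L" "L = 2 powr LL" "real n powr x = 2 powr (L * x)"
proof -
  show 1: "real n = 2 powr L" unfolding L_def using n24 by simp
  show "L = 2 powr LL" unfolding LL_def using L24 by simp
  show "real n powr x = 2 powr (L * x)" unfolding 1 by (simp add: powr_powr)
qed

lemma LL_sq: "LL \<le> LL\<^sup>2" using LL24 by (simp add: power2_eq_square)

lemma L_ge: "24 * LL \<le> L"
proof -
  have "24 * LL \<le> threshold * LL\<^sup>2" using LL_sq LL24 threshold_ge(2) by (intro mult_mono) auto
  then show ?thesis using large(4) by linarith
qed

lemma N_real: "real N = real n / d" "real N > 0" "log 2 (real N) = L - log 2 d" "real l = L - log 2 d"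
proof -
  show N1: "real N = real n / d" using n d by simp
  show N0: "real N > 0" using N by simp
  show N2: "log 2 (real N) = L - log 2 d" unfolding L_def N1 using n24 d by (subst log_divide) auto
  then show "real l = L - log 2 d" using N by (simp add: log_nat_power)
qed

lemma log_d: "0 \<le> log 2 d" "log 2 d \<le> LL" "log 2 d \<le> d"
proof -
  show "0 \<le> log 2 d" using d by simp
  show "log 2 d \<le> d" using d by (intro log2_le) auto
  then show "log 2 d \<le> LL" using threshold_ge(4) large(3) by linarith
qed

lemma \<rho>_bounds: "\<rho> \<ge> 1" "\<rho> = 2 * d * (m / n)" "\<rho> \<le> 2 * d * M"
proof -
  have n0: "real n > 0" using n24 by linarith
  show r: "\<rho> = 2 * d * (m / n)" unfolding \<rho>_def N_real(1) using n0 d by (simp add: field_simps)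
  have "1 \<le> real m / n" "real m / n \<le> M" using m n0 by (simp_all add: field_simps)
  moreover have "1 \<le> 2 * real d" using d by simp
  ultimately show "\<rho> \<ge> 1" unfolding r using mult_mono[of 1 "2 * real d" 1 "m / n"] by simp
  show "\<rho> \<le> 2 * d * M" unfolding r using \<open>real m / n \<le> M\<close> by (intro mult_left_mono) auto
qed

lemma b0_bounds: "real b0 \<le> 6 * \<rho> + 1" "real b0 \<le> bM"
proof -
  show 1: "real b0 \<le> 6 * \<rho> + 1" unfolding b0_def using \<rho>_bounds(1) by linarith
  show "real b0 \<le> bM" using 1 \<rho>_bounds(3) unfolding bM_def by linarith
qed

lemma phi_log: "phi d > 1" "log 2 (phi d) \<ge> 1 / 2" "phi d < 2"
proof -
  note ph = phi_bounds[OF d]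
  show 1: "phi d > 1" "phi d < 2" using ph by auto
  have "2 powr (1 / 2) \<le> phi d"
  proof -
    have "2 powr (1 / 2) = sqrt (2 :: real)" by (simp add: powr_half_sqrt)
    also have "\<dots> \<le> sqrt ((161 / 100)\<^sup>2)" by (intro real_sqrt_le_mono) (simp add: power2_eq_square)
    also have "\<dots> \<le> phi d" using ph(3) by simp
    finally show ?thesis .
  qed
  then have "log 2 (2 powr (1 / 2)) \<le> log 2 (phi d)" using 1 by (subst log_le_cancel_iff) auto
  then show "log 2 (phi d) \<ge> 1 / 2" by simp
qed

lemma leaf_target: "(c + 3) * L \<ge> 1" "log 2 ((c + 3) * L) = log 2 (c + 3) + LL"
proof -
  show "(c + 3) * L \<ge> 1" using c L24 mult_mono[of 1 "c + 3" 1 L] by simp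
  show "log 2 ((c + 3) * L) = log 2 (c + 3) + LL" unfolding LL_def using c L24 by (subst log_mult) auto
qed

lemma log_phi: "log (phi d) ((c + 3) * L) = (log 2 (c + 3) + LL) / log 2 (phi d)"
  unfolding leaf_target(2)[symmetric] using phi_log leaf_target(1) by (intro log_base_change) auto

lemma T_bounds:
  "log (phi d) ((c + 3) * L) \<le> T" "T \<le> (log 2 (c + 3) + LL) / log 2 (phi d) + 1" "T \<le> 2 * LL + 2 * (c + 3) + 1"
proof -
  have nn: "log (phi d) ((c + 3) * L) \<ge> 0" using phi_log leaf_target by simp
  show "log (phi d) ((c + 3) * L) \<le> T" unfolding T_def by linarith
  define A where "A = (log 2 (c + 3) + LL) / log 2 (phi d)"
  have 2: "T \<le> A + 1"
    unfolding T_def A_def log_phi[symmetric] using nn by linarith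
  then show "T \<le> (log 2 (c + 3) + LL) / log 2 (phi d) + 1" unfolding A_def .
  have lc: "log 2 (c + 3) \<le> c + 3" "0 \<le> log 2 (c + 3)" using c log2_le[of "c + 3"] by auto
  have "A \<le> (log 2 (c + 3) + LL) / (1 / 2)"
    unfolding A_def using phi_log lc LL24 by (intro divide_left_mono) auto
  also have "\<dots> = 2 * (log 2 (c + 3) + LL)" by simp
  also have "\<dots> \<le> 2 * ((c + 3) + LL)" using lc by (intro mult_left_mono add_right_mono) auto
  finally have "A \<le> 2 * LL + 2 * (c + 3)" by (simp add: algebra_simps)
  then show "T \<le> 2 * LL + 2 * (c + 3) + 1" using 2 by (meson add_right_mono order.trans)
qed

lemma tree_leaves_bounds: "(c + 3) * L \<le> tree_leaves d q0 q" "tree_leaves d q0 q \<le> (c + 3) * L * 2 ^ (d + 1)"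
proof -
  have q0: "d \<le> q0" unfolding q0_def by simp
  have "(c + 3) * L = phi d powr log (phi d) ((c + 3) * L)" using phi_log leaf_target by simp
  also have "\<dots> \<le> phi d powr T" using T_bounds phi_log by (intro powr_mono) auto
  also have "\<dots> \<le> tree_leaves d q0 q" using tree_leaves_ge[OF d q0, of q] unfolding q_def by simp
  finally show "(c + 3) * L \<le> tree_leaves d q0 q" .
  have "tree_leaves d q0 q \<le> phi d powr (T + d)" using tree_leaves_le[OF d q0, of q] unfolding q_def by simp
  also have "\<dots> \<le> phi d powr (log (phi d) ((c + 3) * L) + (d + 1))"
    using T_bounds(2) phi_log unfolding log_phi[symmetric] by (intro powr_mono) auto
  also have "\<dots> = (c + 3) * L * phi d ^ (d + 1)"
    using phi_log leaf_target by (simp add: powr_add powr_realpow del: power_Suc of_nat_add of_nat_Suc flip: of_nat_Suc)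
  also have "\<dots> \<le> (c + 3) * L * 2 ^ (d + 1)"
    using phi_log c L24 by (intro mult_left_mono power_mono) auto
  finally show "tree_leaves d q0 q \<le> (c + 3) * L * 2 ^ (d + 1)" .
qed

lemma tree_edges_bound: "real (tree_edges d q0 b0 q) \<le> edge_const * L"
proof -
  have q0: "d \<le> q0" unfolding q0_def by simp
  have "tree_edges d q0 b0 q + 2 \<le> (b0 + 2) * tree_leaves d q0 q" using q0 by (intro tree_edges_le[OF d]) (auto simp: q_def)
  then have "real (tree_edges d q0 b0 q + 2) \<le> real ((b0 + 2) * tree_leaves d q0 q)" by (rule of_nat_mono)
  then have "real (tree_edges d q0 b0 q) \<le> (real b0 + 2) * tree_leaves d q0 q" by (simp add: distrib_right)
  also have "\<dots> \<le> (bM + 2) * ((c + 3) * L * 2 ^ (d + 1))"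
    using b0_bounds tree_leaves_bounds(2) consts_pos by (intro mult_mono) auto
  finally show ?thesis unfolding edge_const_def by (simp add: mult_ac)
qed

lemma kg_bounds: "kg \<ge> 1" "real kg \<le> kg_const * LL"
proof -
  show "kg \<ge> 1" unfolding kg_def by simp
  have "real kg = 1 + 2 * real K * ((real b0 + 2) * d + T + real K * d + 1)"
    unfolding kg_def q_def q0_def by (simp add: algebra_simps)
  also have "\<dots> \<le> 1 + 2 * real K * ((bM + 2) * d + (2 * LL + 2 * (c + 3) + 1) + real K * d + 1)"
    using T_bounds(3) b0_bounds(2) by (intro add_mono mult_left_mono mult_right_mono) auto
  also have "\<dots> \<le> LL * 1 + 2 * real K * (LL * ((bM + 2) * d) + (LL * 2 + LL * (2 * (c + 3) + 1)) + LL * (real K * d) + LL * 1)"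
  proof -
    have ge: "x \<le> LL * x" if "x \<ge> 0" for x using LL24 that mult_right_mono[of 1 LL x] by simp
    have "0 \<le> (bM + 2) * d" "0 \<le> 2 * (c + 3) + 1" "0 \<le> real K * d" using consts_pos c by auto
    then have "(bM + 2) * d + (2 * LL + 2 * (c + 3) + 1) + real K * d + 1 \<le>
      LL * ((bM + 2) * d) + (LL * 2 + LL * (2 * (c + 3) + 1)) + LL * (real K * d) + LL * 1"
      using ge[of "(bM + 2) * d"] ge[of "2 * (c + 3) + 1"] ge[of "real K * d"] ge[of 1] by linarith
    then have "2 * real K * ((bM + 2) * d + (2 * LL + 2 * (c + 3) + 1) + real K * d + 1) \<le>
      2 * real K * (LL * ((bM + 2) * d) + (LL * 2 + LL * (2 * (c + 3) + 1)) + LL * (real K * d) + LL * 1)"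
      by (intro mult_left_mono) auto
    then show ?thesis using LL24 by linarith
  qed
  also have "\<dots> = kg_const * LL" unfolding kg_const_def by (simp add: algebra_simps)
  finally show "real kg \<le> kg_const * LL" .
qed

lemma v_ok: "q + K * d + 1 \<le> d * v"
proof -
  have "T < d * (T div d + 1)" using dividend_less_times_div[of d T] d by simp
  then have "q0 + T + K * d + 1 \<le> d * (b0 + 2) + d * (T div d + 1) + K * d + d"
    unfolding q0_def by (simp add: mult.commute)
  also have "\<dots> = d * v" unfolding v_def by (simp add: algebra_simps)
  finally show ?thesis unfolding q_def .
qed

text \<open>The part 12 d comes from \<rho> via \<open>b0\<close>. The remaining contributions of
  \<open>b0\<close>, \<open>K\<close>, \<open>T\<close> / d and the fixed summands add up to 2 c +
  13, at most 15 c since c > 1. Bounding log (c + 3) by c + 3 keeps the factor independent of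
  c.\<close>

lemma v_bound: "real v - 1 \<le> LL / (d * log 2 (phi d)) + (12 * real d + 15) * (c + m / n)"
proof -
  have pl: "log 2 (phi d) > 0" using phi_log by linarith
  have "real (T div d) \<le> T / d" by (rule of_nat_div_le_of_nat)
  also have "\<dots> \<le> ((log 2 (c + 3) + LL) / log 2 (phi d) + 1) / d"
    using T_bounds(2) by (intro divide_right_mono) auto
  also have "\<dots> = LL / (d * log 2 (phi d)) + log 2 (c + 3) / (d * log 2 (phi d)) + 1 / d"
    using pl d by (simp add: field_simps)
  also have "log 2 (c + 3) / (d * log 2 (phi d)) \<le> log 2 (c + 3) / 1"
  proof (intro divide_left_mono)
    show "1 \<le> d * log 2 (phi d)" using mult_mono[of 2 "real d" "1 / 2" "log 2 (phi d)"] phi_log d by simp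
  qed (use c pl d in auto)
  also have "\<dots> \<le> c + 3" using log2_le[of "c + 3"] c by simp
  also have "1 / real d \<le> 1" using d by simp
  finally have "real (T div d) \<le> LL / (d * log 2 (phi d)) + (c + 3) + 1" by simp
  moreover have "real v - 1 = b0 + 3 + K + real (T div d)" unfolding v_def by simp
  moreover have "real b0 \<le> 12 * real d * (m / n) + 1" using b0_bounds(1) unfolding \<rho>_bounds(2) by simp
  moreover have "12 * real d * (m / n) + 2 * c + 13 \<le> (12 * real d + 15) * (c + m / n)"
  proof -
    have "(12 * real d + 15) * (c + m / n) = 12 * real d * c + 12 * real d * (m / n) + 15 * c + 15 * (m / n)"
      by (simp add: algebra_simps)
    moreover have "0 \<le> 12 * real d * c" "0 \<le> 15 * (real m / n)" using c by auto
    ultimately show ?thesis using c by linarith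
  qed
  ultimately show ?thesis using K_bounds(2) by linarith
qed

text \<open>Crude bounds x \<le> 2^x turn all counting factors into 2 to a multiple of
  \<open>LL\<close>^2, and the largeness condition makes this at most N.\<close>

lemma dense_term:
  "real kg * ((real m / real N) * 2 ^ d * real kg) ^ kg * real kg ^ (K - 1) / real N ^ (K - 1) \<le> real n powr (- c) / 3"
proof -
  define D where "D = d * M * 2 ^ d * kg_const * LL"
  have D0: "D \<ge> 0" unfolding D_def using M consts_pos LL24 by auto
  have mN: "real m / real N \<le> d * M" "0 \<le> real m / real N"
  proof -
    have "real m \<le> (d * M) * real N" using m(2) n by (simp add: mult_ac)
    then show "real m / real N \<le> d * M" using N_real(2) by (simp add: pos_divide_le_eq)
  qed simp
  have "(real m / real N) * 2 ^ d * real kg \<le> (d * M) * 2 ^ d * (kg_const * LL)"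
    using mN M kg_bounds by (intro mult_mono) auto
  also have "\<dots> = D" unfolding D_def by simp
  also have "\<dots> \<le> 2 powr D" by (rule le_two_powr)
  finally have "((real m / real N) * 2 ^ d * real kg) ^ kg \<le> (2 powr D) ^ kg"
    using mN by (intro power_mono) auto
  also have "\<dots> = 2 powr (D * kg)" by (simp add: powr_realpow[symmetric] powr_powr)
  also have "\<dots> \<le> 2 powr (D * (kg_const * LL))"
    using D0 kg_bounds by (intro powr_mono mult_left_mono) auto
  finally have X: "((real m / real N) * 2 ^ d * real kg) ^ kg \<le> 2 powr (D * (kg_const * LL))" .
  have "real kg ^ K \<le> (2 powr kg) ^ K" by (intro power_mono le_two_powr) auto
  also have "\<dots> = 2 powr (real kg * real K)" by (simp add: powr_realpow[symmetric] powr_powr)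
  also have "\<dots> \<le> 2 powr (kg_const * LL * K)" using kg_bounds by (intro powr_mono mult_right_mono) auto
  finally have Y: "real kg ^ K \<le> 2 powr (kg_const * LL * K)" .
  have "real kg * ((real m / real N) * 2 ^ d * real kg) ^ kg * real kg ^ (K - 1) =
    real kg ^ K * ((real m / real N) * 2 ^ d * real kg) ^ kg"
    using K_bounds(3) by (cases K) auto
  also have "\<dots> \<le> 2 powr (kg_const * LL * K) * 2 powr (D * (kg_const * LL))"
    using X Y mN by (intro mult_mono) auto
  also have "\<dots> = 2 powr (kg_const * LL * K + D * (kg_const * LL))" by (simp add: powr_add)
  also have "\<dots> \<le> 2 powr (log 2 (real N))"
  proof (intro powr_mono)
    have "kg_const * LL * K \<le> kg_const * K * LL\<^sup>2" 
      using mult_left_mono[OF LL_sq, of "kg_const * K"] consts_pos by (simp add: mult_ac)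
    moreover have "D * (kg_const * LL) = d * M * 2 ^ d * kg_const\<^sup>2 * LL\<^sup>2"
      unfolding D_def by (simp add: power2_eq_square)
    moreover have "log 2 d \<le> d * LL\<^sup>2"
    proof -
      have "real d * 1 \<le> d * LL\<^sup>2" using LL24 LL_sq by (intro mult_left_mono) auto
      then show ?thesis using log_d(3) by linarith
    qed
    moreover have "(d * M * 2 ^ d * kg_const\<^sup>2 + kg_const * K + d) * LL\<^sup>2 \<le> threshold * LL\<^sup>2"
      using threshold_ge(1) by (intro mult_right_mono) auto
    ultimately show "kg_const * LL * K + D * (kg_const * LL) \<le> log 2 (real N)"
      unfolding N_real(3) using large(4) by (simp add: algebra_simps)
  qed simp
  also have "\<dots> = real N" using N_real(2) by simp
  finally have top: "real kg * ((real m / real N) * 2 ^ d * real kg) ^ kg * real kg ^ (K - 1) \<le> real N" .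
  have N1: "real N \<ge> 1" using N by simp
  have "real kg * ((real m / real N) * 2 ^ d * real kg) ^ kg * real kg ^ (K - 1) / real N ^ (K - 1) \<le> real N / real N ^ (K - 1)"
    using top by (intro divide_right_mono) auto
  also have "\<dots> = real N powr (- real (K - 2))"
  proof -
    have "real N ^ (K - 1) = real N * real N ^ (K - 2)"
      using K_bounds(3) by (metis Suc_diff_le diff_Suc_Suc numeral_2_eq_2 One_nat_def power_Suc)
    then show ?thesis using N1 by (simp add: powr_minus powr_realpow field_simps)
  qed
  also have "\<dots> \<le> real N powr (- (c + 2))" using N1 K_bounds by (intro powr_mono) auto
  also have "\<dots> = d powr (c + 2) * real n powr (- (c + 2))"
  proof -
    have 1: "(real n / real d) powr (- (c + 2)) = real n powr (- (c + 2)) / real d powr (- (c + 2))"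
      using powr_divide[of "real n" "real d" "- (c + 2)"] by simp
    have 2: "real d powr (- (c + 2)) = inverse (real d powr (c + 2))"
      using powr_minus[of "real d" "c + 2"] by simp
    show ?thesis unfolding N_real(1) 1 2 by (simp add: divide_inverse mult.commute)
  qed
  also have "\<dots> = d powr (c + 2) / (real n ^ 2) * real n powr (- c)"
  proof -
    have "real n powr (- (c + 2)) = real n powr (- c) * real n powr (- 2)" by (simp flip: powr_add)
    also have "real n powr (- 2) = 1 / real n ^ 2" using n24 by (simp add: powr_minus powr_numeral inverse_eq_divide)
    finally show ?thesis by simp
  qed
  also have "\<dots> \<le> 1 / 3 * real n powr (- c)"
  proof (intro mult_right_mono)
    have "3 * d powr (c + 2) \<le> real n" using threshold_ge(5) large(1) by linarith
    also have "\<dots> \<le> real n ^ 2" using n24 by (simp add: power2_eq_square)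
    finally show "d powr (c + 2) / (real n ^ 2) \<le> 1 / 3" using n24 by (simp add: field_simps)
  qed simp
  finally show ?thesis by simp
qed

lemma tree_term: "2 ^ d * real m * (1 / 2) ^ tree_leaves d q0 q \<le> real n powr (- c) / 3"
proof -
  have "(1 / 2 :: real) ^ tree_leaves d q0 q = 2 powr (- real (tree_leaves d q0 q))"
    by (simp add: powr_minus powr_realpow power_one_over inverse_eq_divide)
  also have "\<dots> \<le> 2 powr (L * (- (c + 3)))" using tree_leaves_bounds(1) by (intro powr_mono) (auto simp: algebra_simps)
  also have "\<dots> = real n powr (- (c + 3))" by (simp only: n_powr(3))
  finally have "2 ^ d * real m * (1 / 2) ^ tree_leaves d q0 q \<le> 2 ^ d * (M * real n) * real n powr (- (c + 3))"
    using m(2) by (intro mult_mono) auto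
  also have "\<dots> = 2 ^ d * M / (real n ^ 2) * real n powr (- c)"
  proof -
    have "real n powr (- (c + 3)) = real n powr (- c) * real n powr (- 3)" by (simp flip: powr_add)
    also have "real n powr (- 3) = 1 / real n ^ 3" using n24 by (simp add: powr_minus powr_numeral inverse_eq_divide)
    finally show ?thesis using n24 by (simp add: power2_eq_square power3_eq_cube)
  qed
  also have "\<dots> \<le> 1 / 3 * real n powr (- c)"
  proof (intro mult_right_mono)
    have "3 * 2 ^ d * M \<le> real n" using threshold_ge(6) large(1) by linarith
    also have "\<dots> \<le> real n ^ 2" using n24 by (simp add: power2_eq_square)
    finally show "2 ^ d * M / (real n ^ 2) \<le> 1 / 3" using n24 by (simp add: field_simps)
  qed simp
  finally show ?thesis by simp
qed

end

section \<open>Biases, moments and seed lengths of the levels\<close>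

context agl_parameters_large
begin

text \<open>In \<open>level_term\<close> the bias is multiplied by at most 2^(12 K L) on every
  level; the exponent 13 leaves 2^(-K L).\<close>

definition \<delta>1 :: real where "\<delta>1 = 2 powr (- (13 * K * L))"
definition last_bits :: nat where "last_bits = l - (\<Sum>i=1..k. level_bits n i)"
text \<open>The uniform probability of prescribed last blocks on as many balls as a witness tree has
  edge ends.\<close>

definition \<delta>2 :: real where "\<delta>2 = (1 / 2) ^ (last_bits * (2 * tree_edges d q0 b0 q))"
text \<open>The last level has to handle all balls of a tree, the upper levels moments up to the
  largest \<open>p i\<close>.\<close>

definition w :: nat where "w = max (2 * tree_edges d q0 b0 q) (4 * K * 2 ^ k)"
text \<open>The logarithm of the mean bucket load halves from level to level, so the moment doubles:
  their product is 4 K L throughout, and every level fails with the same small probability.\<close>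

definition p :: "nat \<Rightarrow> nat" where "p i = 4 * K * 2 ^ Suc i"
text \<open>At most 2^L bucket labels, with weight 6 from the uniform moment and 1 from the
  bias.\<close>

definition \<eta> :: real where "\<eta> = 7 * 2 powr (L - K * L)"

lemma k_bounds: "2 ^ k \<le> L / (12 * LL)" "L / 2 ^ k \<le> 24 * LL" "12 * LL \<le> L / 2 ^ k" "k \<ge> 1" "real k \<le> LL"
proof -
  define y where "y = L / (12 * LL)"
  have y2: "y \<ge> 2" unfolding y_def using L_ge LL24 by (simp add: field_simps)
  have lg: "log 2 y \<ge> 1" using y2 by simp
  then have kr: "real k \<le> log 2 y" "log 2 y \<le> real k + 1" unfolding k_def y_def[symmetric] by linarith+
  show "k \<ge> 1" unfolding k_def y_def[symmetric] using lg by linarith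
  have "2 powr real k \<le> y" using kr(1) y2 by (simp add: le_log_iff)
  then show 1: "2 ^ k \<le> L / (12 * LL)" by (simp add: powr_realpow y_def)
  have "y \<le> 2 powr (real k + 1)" using kr(2) y2 by (simp add: log_le_iff)
  then have "y \<le> 2 * 2 ^ k" by (simp add: powr_add powr_realpow)
  then show "L / 2 ^ k \<le> 24 * LL" using LL24 by (simp add: y_def field_simps)
  show "12 * LL \<le> L / 2 ^ k" using 1 LL24 by (simp add: field_simps)
  have "y \<le> L" unfolding y_def using L24 LL24 by (simp add: field_simps)
  then have "log 2 y \<le> LL" unfolding LL_def using y2 by simp
  then show "real k \<le> LL" using kr(1) by linarith
qed

lemma level_bits_bounds: "real (level_bits n i) \<le> L / 2 ^ i" "L / 2 ^ i - 1 \<le> real (level_bits n i)"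
proof -
  have "L / 2 ^ i \<ge> 0" using L24 by simp
  then show "real (level_bits n i) \<le> L / 2 ^ i" "L / 2 ^ i - 1 \<le> real (level_bits n i)"
    unfolding level_bits_def L_def[symmetric] by linarith+
qed

lemma sum_halves: "(\<Sum>s=1..i. L / 2 ^ s) = L - L / 2 ^ i"
  by (induction i) (auto simp: field_simps)

lemma sum_level_bits:
  "real (\<Sum>s=1..i. level_bits n s) \<le> L - L / 2 ^ i" "L - L / 2 ^ i - i \<le> real (\<Sum>s=1..i. level_bits n s)"
proof -
  have "real (\<Sum>s=1..i. level_bits n s) \<le> (\<Sum>s=1..i. L / 2 ^ s)"
    unfolding of_nat_sum by (intro sum_mono level_bits_bounds)
  then show "real (\<Sum>s=1..i. level_bits n s) \<le> L - L / 2 ^ i" unfolding sum_halves .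
  have "(\<Sum>s=1..i. L / 2 ^ s - 1) \<le> real (\<Sum>s=1..i. level_bits n s)"
    unfolding of_nat_sum by (intro sum_mono level_bits_bounds)
  then show "L - L / 2 ^ i - i \<le> real (\<Sum>s=1..i. level_bits n s)"
    unfolding sum_subtractf sum_halves by simp
qed

text \<open>Without rounding about L / 2^k bits would be left, at most 24 \<open>LL\<close>;
  rounding down adds at most one bit per level, hence at most \<open>k\<close> \<le>
  \<open>LL\<close> in total.\<close>

lemma last_bits: "(\<Sum>i=1..k. level_bits n i) + last_bits = l" "real last_bits \<le> 25 * LL"
proof -
  have "real (\<Sum>i=1..k. level_bits n i) \<le> real l"
    unfolding N_real(4) using sum_level_bits(1)[of k] k_bounds(3) log_d LL24 by linarith
  then have "(\<Sum>i=1..k. level_bits n i) \<le> l" by (simp only: of_nat_le_iff)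
  then show eq: "(\<Sum>i=1..k. level_bits n i) + last_bits = l" unfolding last_bits_def by simp
  then have "real last_bits = real l - real (\<Sum>i=1..k. level_bits n i)" by linarith
  then show "real last_bits \<le> 25 * LL"
    unfolding N_real(4) using sum_level_bits(2)[of k] k_bounds(2,5) log_d by linarith
qed

lemma w_bound: "real w \<le> (2 * edge_const + 4 * K) * L\<^sup>2"
proof -
  have "2 ^ k \<le> L"
  proof -
    have "L / (12 * LL) \<le> L / 1" using LL24 L24 by (intro divide_left_mono) auto
    then show ?thesis using k_bounds(1) by linarith
  qed
  then have "real (4 * K * 2 ^ k) \<le> 4 * K * L" by (simp add: mult_left_mono)
  moreover have "real (2 * tree_edges d q0 b0 q) \<le> 2 * edge_const * L" using tree_edges_bound by simp
  moreover have "0 \<le> 2 * edge_const * L" "0 \<le> 4 * real K * L" using consts_pos L24 by auto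
  ultimately have "real (2 * tree_edges d q0 b0 q) \<le> 2 * edge_const * L + 4 * K * L"
    "real (4 * K * 2 ^ k) \<le> 2 * edge_const * L + 4 * K * L" by linarith+
  then have "real w \<le> 2 * edge_const * L + 4 * K * L"
    unfolding w_def of_nat_max by (rule max.boundedI)
  also have "\<dots> = (2 * edge_const + 4 * K) * L" by (simp add: distrib_right)
  also have "\<dots> \<le> (2 * edge_const + 4 * K) * L\<^sup>2"
    using L24 consts_pos by (intro mult_left_mono) (auto simp: power2_eq_square)
  finally show ?thesis .
qed

lemma p_ok: "i < k \<Longrightarrow> even (p i) \<and> p i \<le> w"
proof -
  assume "i < k"
  then have "(2 :: nat) ^ Suc i \<le> 2 ^ k" by (intro power_increasing) auto
  then have "p i \<le> 4 * K * 2 ^ k" unfolding p_def by (rule mult_le_mono2)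
  then have "p i \<le> w" unfolding w_def by simp
  then show ?thesis by (simp add: p_def)
qed

lemma p_le: "i < k \<Longrightarrow> real (p i) \<le> L"
proof -
  assume "i < k"
  then have "(2 :: real) ^ Suc i \<le> 2 ^ k" by (intro power_increasing) auto
  then have "(2 :: real) ^ Suc i \<le> L / (12 * LL)" using k_bounds(1) by (rule order.trans)
  then have "4 * real K * 2 ^ Suc i \<le> 4 * real K * (L / (12 * LL))"
    by (intro mult_left_mono) auto
  then have "real (p i) \<le> 4 * real K * (L / (12 * LL))" by (simp add: p_def)
  also have "\<dots> \<le> 4 * LL * (L / (12 * LL))"
    using threshold_ge(3) large(3) L24 LL24 by (intro mult_right_mono) auto
  also have "\<dots> \<le> L" using LL24 L24 by simp
  finally show ?thesis .
qed

context
  fixes b :: "nat \<Rightarrow> nat"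
  assumes b: "\<And>i. i \<in> {1..k} \<Longrightarrow> b i = level_bits n i" "2 ^ (\<Sum>i=1..k + 1. b i) = N"
begin

lemma b_sum: "i \<le> k \<Longrightarrow> (\<Sum>s=1..i. b s) = (\<Sum>s=1..i. level_bits n s)"
  using b(1) by (intro sum.cong) auto

lemma b_last: "b (k + 1) = last_bits"
proof -
  have "(\<Sum>i=1..k + 1. b i) = l" using b(2) N by simp
  then show ?thesis using b_sum[of k] last_bits(1) by simp
qed

text \<open>At least n balls are spread over at most 2 to the L - L / 2^(i + 1) buckets; rounding
  the block lengths down makes the buckets fewer and the mean larger.\<close>

lemma bucket_mean:
  assumes "i < k"
  shows "2 powr (L / 2 ^ Suc i) \<le> bucket_bound b (1 / L) m i / 2 ^ b (Suc i)"
proof -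
  have eq: "bucket_bound b (1 / L) m i / 2 ^ b (Suc i) = m * (1 + 1 / L) ^ i / 2 ^ (\<Sum>s=1..Suc i. b s)"
    by (simp add: bucket_bound_def power_add)
  have "(2 :: real) ^ (\<Sum>s=1..Suc i. b s) = 2 powr real (\<Sum>s=1..Suc i. b s)"
    by (rule powr_realpow[symmetric]) simp
  also have "\<dots> \<le> 2 powr (L - L / 2 ^ Suc i)"
    using sum_level_bits(1)[of "Suc i"] b_sum[of "Suc i"] assms by (intro powr_mono) auto
  finally have le: "(2 :: real) ^ (\<Sum>s=1..Suc i. b s) \<le> 2 powr (L - L / 2 ^ Suc i)" .
  have "2 powr (L / 2 ^ Suc i) = real n / 2 powr (L - L / 2 ^ Suc i)"
    unfolding n_powr(1) by (simp flip: powr_diff)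
  also have "\<dots> \<le> m * (1 + 1 / L) ^ i / 2 ^ (\<Sum>s=1..Suc i. b s)"
  proof (rule frac_le)
    have "real n * 1 \<le> m * (1 + 1 / L) ^ i"
      using m(1) L24 by (intro mult_mono one_le_power) auto
    then show "real n \<le> m * (1 + 1 / L) ^ i" by simp
  qed (use le L24 in auto)
  finally show ?thesis unfolding eq .
qed

lemma bucket_mean_ge1: "i < k \<Longrightarrow> bucket_bound b (1 / L) m i / 2 ^ b (Suc i) \<ge> 1"
  using order.trans[OF _ bucket_mean[of i]] L24 by (simp add: ge_one_powr_ge_zero)

text \<open>Let Y = L / 2^(i + 1), so that Y times \<open>p i\<close> is 4 K L. The losses
  \<open>p i\<close> / \<epsilon> amount to at most L^2 = 2^(2 LL), while the square root of the
  mean gains 2^(Y / 2); since Y \<ge> 12 \<open>LL\<close>, the base of the moment term is at most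
  2^(-Y / 4). The base of the bias term is at most 2^(3 Y). Raised to the power \<open>p i\<close>
  these are 2^(-K L) and 2^(12 K L).\<close>

lemma level_term:
  assumes i: "i < k"
  shows "2 ^ (\<Sum>s=1..Suc i. b s) *
      (6 * (p i / (1 / L * sqrt (bucket_bound b (1 / L) m i / 2 ^ b (Suc i)))) ^ p i + (4 ^ b (Suc i) / (1 / L)) ^ p i * \<delta>1) \<le> \<eta>"
proof -
  define Y where "Y = L / 2 ^ Suc i"
  define \<mu> where "\<mu> = bucket_bound b (1 / L) m i / 2 ^ b (Suc i)"
  have \<mu>: "2 powr Y \<le> \<mu>" unfolding Y_def \<mu>_def by (rule bucket_mean[OF i])
  have "12 * LL \<le> L / 2 ^ k" by (rule k_bounds(3))
  also have "\<dots> \<le> Y" unfolding Y_def using i L24 by (intro divide_left_mono power_increasing) auto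
  finally have Y12: "12 * LL \<le> Y" .
  have Yp: "Y * p i = 4 * K * L" unfolding Y_def p_def by simp
  have "p i / (1 / L * sqrt \<mu>) \<le> L / (1 / L * 2 powr (Y / 2))"
  proof (rule frac_le)
    have "2 powr (Y / 2) = sqrt (2 powr Y)" by (simp add: powr_half_sqrt[symmetric] powr_powr)
    also have "\<dots> \<le> sqrt \<mu>" using \<mu> by simp
    finally show "1 / L * 2 powr (Y / 2) \<le> 1 / L * sqrt \<mu>" using L24 by (intro mult_left_mono) auto
  qed (use p_le[OF i] L24 in auto)
  also have "\<dots> = 2 powr (2 * LL) / 2 powr (Y / 2)"
  proof -
    have "2 powr (2 * LL) = (2 powr LL) * (2 powr LL)" by (simp flip: powr_add)
    then show ?thesis unfolding n_powr(2)[symmetric] by simp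
  qed
  also have "\<dots> = 2 powr (2 * LL - Y / 2)" by (simp add: powr_diff)
  also have "\<dots> \<le> 2 powr (- (Y / 4))" using Y12 LL24 by (intro powr_mono) auto
  finally have "(p i / (1 / L * sqrt \<mu>)) ^ p i \<le> (2 powr (- (Y / 4))) ^ p i"
    using L24 order.trans[OF _ \<mu>] by (intro power_mono) auto
  also have "\<dots> = 2 powr (- (K * L))"
    using Yp by (simp add: powr_realpow[symmetric] powr_powr)
  finally have t1: "(p i / (1 / L * sqrt \<mu>)) ^ p i \<le> 2 powr (- (K * L))" .
  have "(4 :: real) ^ b (Suc i) = (2 ^ 2) ^ b (Suc i)" by simp
  also have "\<dots> = 2 ^ (2 * b (Suc i))" by (simp only: power_mult)
  also have "\<dots> = 2 powr (2 * real (b (Suc i)))" by (simp flip: powr_realpow)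
  also have "\<dots> \<le> 2 powr (2 * Y)"
    using b(1)[of "Suc i"] i level_bits_bounds(1)[of "Suc i"] unfolding Y_def by (intro powr_mono) auto
  finally have "4 ^ b (Suc i) / (1 / L) \<le> 2 powr (2 * Y) * 2 powr LL"
    using L24 unfolding n_powr(2)[symmetric] by (simp add: mult_right_mono)
  also have "\<dots> \<le> 2 powr (3 * Y)" unfolding powr_add[symmetric] using Y12 LL24 by (intro powr_mono) auto
  finally have "(4 ^ b (Suc i) / (1 / L)) ^ p i \<le> (2 powr (3 * Y)) ^ p i"
    using L24 by (intro power_mono) auto
  also have "\<dots> = 2 powr (3 * (Y * p i))" by (simp add: powr_realpow[symmetric] powr_powr mult_ac)
  also have "\<dots> = 2 powr (12 * K * L)" unfolding Yp by (simp add: mult.assoc)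
  finally have "(4 ^ b (Suc i) / (1 / L)) ^ p i * \<delta>1 \<le> 2 powr (12 * K * L) * \<delta>1"
    unfolding \<delta>1_def by (intro mult_right_mono) auto
  also have "\<dots> = 2 powr (- (K * L))" unfolding \<delta>1_def powr_add[symmetric] by (simp add: algebra_simps)
  finally have t2: "(4 ^ b (Suc i) / (1 / L)) ^ p i * \<delta>1 \<le> 2 powr (- (K * L))" .
  have "(2 :: real) ^ (\<Sum>s=1..Suc i. b s) = 2 powr real (\<Sum>s=1..Suc i. b s)"
    by (rule powr_realpow[symmetric]) simp
  also have "\<dots> \<le> 2 powr L"
  proof (intro powr_mono)
    have "0 \<le> L / 2 ^ Suc i" using L24 by simp
    then show "real (\<Sum>s=1..Suc i. b s) \<le> L"
      using sum_level_bits(1)[of "Suc i"] b_sum[of "Suc i"] i by linarith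
  qed simp
  finally have t0: "(2 :: real) ^ (\<Sum>s=1..Suc i. b s) \<le> 2 powr L" .
  have "2 ^ (\<Sum>s=1..Suc i. b s) * (6 * (p i / (1 / L * sqrt \<mu>)) ^ p i + (4 ^ b (Suc i) / (1 / L)) ^ p i * \<delta>1)
    \<le> 2 powr L * (6 * 2 powr (- (K * L)) + 2 powr (- (K * L)))"
  proof (rule mult_mono[OF t0])
    show "6 * (p i / (1 / L * sqrt \<mu>)) ^ p i + (4 ^ b (Suc i) / (1 / L)) ^ p i * \<delta>1
      \<le> 6 * 2 powr (- (K * L)) + 2 powr (- (K * L))"
      using t1 t2 by (intro add_mono mult_left_mono) auto
    have "0 \<le> \<mu>" using order.trans[OF _ \<mu>, of 0] by simp
    then show "0 \<le> 6 * (p i / (1 / L * sqrt \<mu>)) ^ p i + (4 ^ b (Suc i) / (1 / L)) ^ p i * \<delta>1"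
      using L24 unfolding \<delta>1_def by (intro add_nonneg_nonneg mult_nonneg_nonneg zero_le_power divide_nonneg_nonneg) auto
  qed simp
  also have "\<dots> = \<eta>" unfolding \<eta>_def by (simp add: powr_diff powr_minus divide_inverse)
  finally show ?thesis unfolding \<mu>_def .
qed

text \<open>With \<epsilon> = 1 / L the at most \<open>LL\<close> losses multiply to less than 2,
  the factor 2 in \<rho>.\<close>

lemma final_bucket: "bucket_bound b (1 / L) m k \<le> \<rho> * 2 ^ b (k + 1)"
proof -
  have "(1 + 1 / L) ^ k \<le> exp (1 / L) ^ k" using L24 by (intro power_mono exp_ge_add_one_self) auto
  also have "\<dots> = exp (k * (1 / L))" by (rule exp_of_nat_mult[symmetric])
  also have "\<dots> \<le> exp (1 / 24)"
    using k_bounds(5) L_ge L24 by (simp add: field_simps)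
  also have "\<dots> \<le> 2" using exp_le_quadratic[of "1 / 24"] by (simp add: power2_eq_square)
  finally have le2: "(1 + 1 / L) ^ k \<le> 2" .
  have Neq: "real N = 2 ^ (\<Sum>s=1..k. b s) * 2 ^ b (k + 1)" using b(2)[symmetric] by (simp add: power_add)
  have "bucket_bound b (1 / L) m k \<le> real m * 2 / 2 ^ (\<Sum>s=1..k. b s)"
    unfolding bucket_bound_def using le2 by (intro divide_right_mono mult_left_mono) auto
  also have "\<dots> = \<rho> * 2 ^ b (k + 1)" unfolding \<rho>_def Neq by simp
  finally show ?thesis .
qed

end

lemma level_total: "d * (k * \<eta>) \<le> real n powr (- c) / 3"
proof -
  have "2 powr (L - K * L) \<le> 2 powr (L * (- (c + 3)))"
  proof (intro powr_mono)
    have "L * (c + 4) \<le> L * K" using K_bounds L24 by (intro mult_left_mono) auto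
    then show "L - K * L \<le> L * (- (c + 3))" by (simp add: algebra_simps)
  qed simp
  also have "\<dots> = real n powr (- (c + 3))" by (simp only: n_powr(3))
  also have "\<dots> = real n powr (- c) / real n ^ 3"
  proof -
    have "real n powr (- (c + 3)) = real n powr (- c) * real n powr (- 3)" by (simp flip: powr_add)
    also have "real n powr (- 3) = 1 / real n ^ 3" using n24 by (simp add: powr_minus powr_numeral inverse_eq_divide)
    finally show ?thesis by simp
  qed
  finally have e: "\<eta> \<le> 7 * (real n powr (- c) / real n ^ 3)" unfolding \<eta>_def by simp
  have "real k \<le> LL" by (rule k_bounds(5))
  also have "\<dots> \<le> L" using L_ge LL24 by linarith
  also have "\<dots> \<le> n" unfolding L_def using n24 by (intro log2_le) auto
  finally have kn: "real k \<le> n" .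
  have dn: "7 * real d \<le> real n / 3" using threshold_ge(7) large(1) by linarith
  have "real d * (k * \<eta>) \<le> d * (n * (7 * (real n powr (- c) / real n ^ 3)))"
    using kn e by (intro mult_left_mono mult_mono) (auto simp: \<eta>_def)
  also have "\<dots> = (7 * real d) * (n * (real n powr (- c) / real n ^ 3))" by simp
  also have "\<dots> \<le> (real n / 3) * (n * (real n powr (- c) / real n ^ 3))"
    using dn by (intro mult_right_mono) auto
  also have "\<dots> = real n powr (- c) / 3 / n" using n24 by (simp add: power3_eq_cube)
  also have "\<dots> \<le> real n powr (- c) / 3" using n24 by (simp add: field_simps)
  finally show ?thesis .
qed

lemma max_load_tail:
  fixes U :: "'a set"
  assumes H: "hash_family U n N \<delta>1 \<delta>2 w k kg H" and U: "finite U" "distinct xs" "set xs \<subseteq> U" "length xs = m"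
  shows "measure_pmf.prob (Pi_pmf {1..d} dflt (\<lambda>_. H)) {h. v \<le> agl_max_load d N h xs} \<le> real n powr (- c)"
proof -
  obtain b P G where b: "\<forall>i\<in>{1..k}. b i = level_bits n i" "2 ^ (\<Sum>i\<in>{1..k + 1}. b i) = N"
    and P: "\<forall>i\<in>{1..k}. biased_space U (b i) w \<delta>1 (P i)" "biased_space U (b (k + 1)) w \<delta>2 (P (k + 1))"
    and G: "kwise_independent U N kg G"
    and Heq: "H = map_pmf (\<lambda>(hs, g). \<lambda>x\<in>U. bxor (bit_concat b (\<lambda>i. hs i x) (k + 1)) (g x))
              (pair_pmf (Pi_pmf {1..k + 1} (\<lambda>_. undefined) P) G)"
    using H unfolding hash_family_def by blast
  have b': "\<And>i. i \<in> {1..k} \<Longrightarrow> b i = level_bits n i" using b(1) by blast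
  have Nm: "N \<le> m" using n m(1) d by (metis le_trans mult_le_mono1 mult_1 one_le_numeral order.trans)
  interpret hf: hash_family_agl U b k w kg m N d \<delta>1 \<delta>2 "1 / L" P G H xs
    by unfold_locales (use d U b P G Heq Nm L24 in \<open>auto simp: \<delta>1_def \<delta>2_def\<close>)
  have "measure_pmf.prob (Pi_pmf {1..d} dflt (\<lambda>_. H)) {h. v \<le> agl_max_load d N h xs} \<le>
    real kg * ((real m / real N) * 2 ^ d * real kg) ^ kg * real kg ^ (K - 1) / real N ^ (K - 1) +
    (d * (k * \<eta>) + 2 ^ d * real m * (1 / 2) ^ tree_leaves d q0 q)"
  proof (rule hf.agl_tail[where \<rho> = \<rho> and p = p])
    show "q0 = (b0 + 2) * d" by (rule q0_def)
    show "q0 \<le> q" unfolding q_def by simp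
    show "2 \<le> K" by (rule K_bounds)
    show "kg = 1 + K * (2 * (q + K * d + 1))" by (rule kg_def)
    show "q + K * d + 1 \<le> d * v" by (rule v_ok)
    show "1 \<le> \<rho>" by (rule \<rho>_bounds)
    show "\<rho> ^ (b0 + 2) / fact b0 \<le> 1 / 2" unfolding b0_def by (rule leaf_weight[OF \<rho>_bounds(1)])
    show "bucket_bound b (1 / L) m k \<le> \<rho> * 2 ^ b (k + 1)" by (rule final_bucket[OF b' b(2)])
    show "2 * tree_edges d q0 b0 q \<le> w" unfolding w_def by simp
    show "\<delta>2 * (2 ^ b (k + 1)) ^ (2 * tree_edges d q0 b0 q) \<le> 1"
    proof -
      have "b (k + 1) = last_bits" by (rule b_last[OF b' b(2)])
      then show ?thesis unfolding \<delta>2_def by (simp add: power_one_over flip: power_mult)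
    qed
    show "even (p i) \<and> p i \<le> w" if "i < k" for i by (rule p_ok[OF that])
    show "1 \<le> bucket_bound b (1 / L) m i / 2 ^ b (Suc i)" if "i < k" for i
      by (rule bucket_mean_ge1[OF b' b(2) that])
    show "2 ^ (\<Sum>s=1..Suc i. b s) * (6 * (p i / (1 / L * sqrt (bucket_bound b (1 / L) m i / 2 ^ b (Suc i)))) ^ p i +
      (4 ^ b (Suc i) / (1 / L)) ^ p i * \<delta>1) \<le> \<eta>" if "i < k" for i
      by (rule level_term[OF b' b(2) that])
    show "0 \<le> \<eta>" unfolding \<eta>_def by simp
  qed
  then show ?thesis using dense_term tree_term level_total by linarith
qed

text \<open>Each of the three parts of the seed is O(L \<open>LL\<close>) for a different reason:
  \<open>k\<close> = O(\<open>LL\<close>) level functions of O(L) bits each, one last function whose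
  bias is tied to \<open>last_bits\<close> = O(\<open>LL\<close>) on O(L) balls, and
  \<open>g\<close> with O(L) bits for each of \<open>kg\<close> = O(\<open>LL\<close>)
  points.\<close>

lemma hash_family_exists:
  fixes U :: "'a set" and A0 :: nat
  assumes U: "finite U" "real (card U) \<le> real n ^ A0"
  shows "\<exists>(H :: ('a \<Rightarrow> nat) pmf) s. hash_family U n N \<delta>1 \<delta>2 w k kg H \<and> sampled_with_bits s H \<and>
    real s \<le> ((A0 + 4 + 26 * K) + (A0 + 4) + 100 * edge_const + kg_const * (A0 + 4)) * L * LL"
proof -
  define b where "b = (\<lambda>i. if i \<le> k then level_bits n i else last_bits)"
  \<comment> \<open>n^(A0 + 3) dominates the union bounds over characters for all parts; the further
    bits in \<open>s1\<close> and \<open>s2\<close> compensate the square of the bias.\<close>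
  define t where "t = nat \<lceil>(A0 + 3) * L\<rceil>"
  define s1 where "s1 = nat \<lceil>(A0 + 3) * L + 26 * K * L\<rceil>"
  define s2 where "s2 = t + 2 * (last_bits * (2 * tree_edges d q0 b0 q))"
  have bs: "(\<Sum>i=1..k. b i) = (\<Sum>i=1..k. level_bits n i)" unfolding b_def by (intro sum.cong) auto
  then have bN: "2 ^ (\<Sum>i\<in>{1..k + 1}. b i) = N" using last_bits(1) N by (simp add: b_def)
  have bL: "real (b i) \<le> real n" if "i \<in> {1..k + 1}" for i
  proof -
    have "b i \<le> (\<Sum>i=1..k + 1. b i)" using that by (intro member_le_sum) auto
    also have "\<dots> = l" using bN N by simp
    finally have "real (b i) \<le> L" using N_real(4) log_d(1) by linarith
    also have "\<dots> \<le> n" unfolding L_def using n24 by (intro log2_le) auto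
    finally show ?thesis .
  qed
  have big: "4 * (real n * real n ^ A0 + 2) \<le> 2 powr ((A0 + 3) * L)"
  proof -
    have "real n ^ (A0 + 3) = 2 powr ((A0 + 3) * L)"
      using n24 n_powr(3)[of "A0 + 3"] by (simp add: powr_realpow[symmetric] mult.commute)
    moreover have "4 * (real n * real n ^ A0 + 2) \<le> real n ^ (A0 + 3)"
    proof -
      define y where "y = real n ^ (A0 + 1)"
      have n1: "1 \<le> y" unfolding y_def using n24 by (intro one_le_power) auto
      have "(12::real) \<le> real n * real n" using n24 mult_mono[of 24 "real n" 24 "real n"] by simp
      then have "12 * y \<le> (real n * real n) * y" using n1 by (intro mult_right_mono) auto
      also have "\<dots> = real n ^ (A0 + 3)" unfolding y_def by (simp add: power_add power3_eq_cube mult_ac)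
      finally have "12 * y \<le> real n ^ (A0 + 3)" .
      moreover have "4 * (y + 2) = 4 * y + 8" by simp
      ultimately have "4 * (y + 2) \<le> real n ^ (A0 + 3)" using n1 by linarith
      then show ?thesis unfolding y_def by simp
    qed
    ultimately show ?thesis by simp
  qed
  have bU: "4 * (real (b i) * card U + 2) \<le> 2 powr ((A0 + 3) * L)" if "i \<in> {1..k + 1}" for i
  proof -
    have "real (b i) * card U \<le> real n * real n ^ A0" using bL[OF that] U by (intro mult_mono) auto
    then have "4 * (real (b i) * card U + 2) \<le> 4 * (real n * real n ^ A0 + 2)" by simp
    then show ?thesis using big by (rule order.trans)
  qed
  have t: "2 powr ((A0 + 3) * L) \<le> 2 ^ t"
  proof -
    have "2 powr ((A0 + 3) * L) \<le> 2 powr real t" unfolding t_def by (intro powr_mono) linarith+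
    then show ?thesis by (simp add: powr_realpow)
  qed
  have tL: "real t \<le> (A0 + 4) * L"
  proof -
    have "0 \<le> (A0 + 3) * L" using L24 by simp
    then have "real t \<le> (A0 + 3) * L + 1" unfolding t_def by linarith
    then show ?thesis using L24 by (simp add: algebra_simps)
  qed
  have s1L: "real s1 \<le> (A0 + 4 + 26 * K) * L"
  proof -
    have "0 \<le> (A0 + 3) * L + 26 * K * L" using L24 by simp
    then have "real s1 \<le> (A0 + 3) * L + 26 * K * L + 1" unfolding s1_def by linarith
    then show ?thesis using L24 by (simp add: algebra_simps)
  qed
  have "\<exists>P. biased_space U (b i) w \<delta>1 P \<and> sampled_with_bits s1 P" if i: "i \<in> {1..k}" for i
  proof (rule biased_space_exists[OF U(1)])
    show "0 < \<delta>1" unfolding \<delta>1_def by simp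
    have "2 powr (- (13 * K * L)) \<le> 2 powr 0" using L24 by (intro powr_mono) auto
    then show "\<delta>1 \<le> 1" unfolding \<delta>1_def by simp
    have "2 powr ((A0 + 3) * L) = \<delta>1\<^sup>2 * 2 powr ((A0 + 3) * L + 26 * K * L)"
      unfolding \<delta>1_def power2_eq_square by (simp flip: powr_add)
    also have "\<dots> \<le> \<delta>1\<^sup>2 * 2 powr real s1"
      unfolding s1_def by (intro mult_left_mono powr_mono) (simp_all, linarith)
    finally show "4 * (real (b i) * card U + 2) \<le> \<delta>1\<^sup>2 * 2 ^ s1"
      using bU[of i] i by (simp add: powr_realpow)
  qed
  then obtain P1 where P1: "\<And>i. i \<in> {1..k} \<Longrightarrow> biased_space U (b i) w \<delta>1 (P1 i) \<and> sampled_with_bits s1 (P1 i)"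
    by metis
  have "\<exists>P. biased_space U (b (k + 1)) w \<delta>2 P \<and> sampled_with_bits s2 P"
  proof (rule biased_space_exists[OF U(1)])
    show "0 < \<delta>2" "\<delta>2 \<le> 1" unfolding \<delta>2_def by (simp_all add: power_le_one)
    have "\<delta>2\<^sup>2 * 2 ^ s2 = (2 :: real) ^ t"
      unfolding \<delta>2_def s2_def by (simp add: power_add power_mult[symmetric] power_one_over mult.commute)
    then show "4 * (real (b (k + 1)) * card U + 2) \<le> \<delta>2\<^sup>2 * 2 ^ s2" using bU[of "k + 1"] t by simp
  qed
  then obtain P2 where P2: "biased_space U (b (k + 1)) w \<delta>2 P2" "sampled_with_bits s2 P2" by blast
  have "\<exists>G. biased_space U l kg 0 G \<and> sampled_with_bits (t * kg) G"
  proof (rule unbiased_space_exists[OF U(1)])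
    have "real (1 + card U * 2 ^ l) < 2 ^ t"
    proof -
      have "real (2 ^ l) \<le> real n" using n N d by simp
      then have "real (card U) * real (2 ^ l) \<le> real n ^ A0 * real n" using U(2) by (intro mult_mono) auto
      moreover have "0 \<le> real n ^ A0 * real n" by simp
      moreover have "real (1 + card U * 2 ^ l) = 1 + real (card U) * real (2 ^ l)" by simp
      moreover have "4 * (real n * real n ^ A0 + 2) = 4 * (real n ^ A0 * real n) + 8" by simp
      ultimately have "real (1 + card U * 2 ^ l) < 4 * (real n * real n ^ A0 + 2)" by linarith
      also note big
      also note t
      finally show ?thesis .
    qed
    then have "1 + card U * 2 ^ l < 2 ^ t" by (metis of_nat_less_iff of_nat_numeral of_nat_power)
    then have "(1 + card U * 2 ^ l) ^ kg < (2 ^ t) ^ kg" using kg_bounds(1) by (intro power_strict_mono) auto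
    then show "(1 + card U * 2 ^ l) ^ kg < 2 ^ (t * kg)" by (simp add: power_mult)
  qed
  then obtain G where G: "biased_space U l kg 0 G" "sampled_with_bits (t * kg) G" by blast
  define P where "P = P1(k + 1 := P2)"
  define H where "H = map_pmf (\<lambda>(hs, g). \<lambda>x\<in>U. bxor (bit_concat b (\<lambda>i. hs i x) (k + 1)) (g x))
              (pair_pmf (Pi_pmf {1..k + 1} (\<lambda>_. undefined) P) G)"
  have "hash_family U n N \<delta>1 \<delta>2 w k kg H"
    unfolding hash_family_def
  proof (intro exI[of _ b] exI[of _ P] exI[of _ G] conjI)
    show "kwise_independent U N kg G" 
      by (rule subst[OF N[symmetric], where P = "\<lambda>x. kwise_independent U x kg G"])
        (rule kwise_independent_of_unbiased[OF G(1) U(1)])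
    show "\<forall>i\<in>{1..k}. biased_space U (b i) w \<delta>1 (P i)" using P1 unfolding P_def by auto
    show "biased_space U (b (k + 1)) w \<delta>2 (P (k + 1))" using P2 unfolding P_def by simp
  qed (use bN in \<open>auto simp: b_def H_def\<close>)
  moreover have "sampled_with_bits ((\<Sum>i=1..k + 1. if i = k + 1 then s2 else s1) + t * kg) H"
    unfolding H_def
  proof (intro sampled_map sampled_pair sampled_Pi)
    show "sampled_with_bits (if i = k + 1 then s2 else s1) (P i)" if "i \<in> {1..k + 1}" for i
      using that P1[of i] P2(2) unfolding P_def by auto
  qed (use G in auto)
  moreover have "real ((\<Sum>i=1..k + 1. if i = k + 1 then s2 else s1) + t * kg) \<le>
    ((A0 + 4 + 26 * K) + (A0 + 4) + 100 * edge_const + kg_const * (A0 + 4)) * L * LL"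
  proof -
    have "(\<Sum>i=1..k + 1. if i = k + 1 then s2 else s1) = (\<Sum>i=1..k. s1) + s2"
    proof -
      have "(\<Sum>i=1..k. if i = k + 1 then s2 else s1) = (\<Sum>i=1..k. s1)" by (intro sum.cong) auto
      then show ?thesis by simp
    qed
    then have eq: "real ((\<Sum>i=1..k + 1. if i = k + 1 then s2 else s1) + t * kg) =
      real k * s1 + real t + 4 * (real last_bits * tree_edges d q0 b0 q) + t * real kg"
      unfolding s2_def by simp
    have "real k * s1 \<le> LL * ((A0 + 4 + 26 * K) * L)"
      using k_bounds(5) s1L LL24 by (intro mult_mono) auto
    moreover have "real t \<le> (A0 + 4) * L * LL"
    proof -
      have "(A0 + 4) * L * 1 \<le> (A0 + 4) * L * LL" using LL24 L24 by (intro mult_left_mono) auto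
      then show ?thesis using tL by linarith
    qed
    moreover have "real last_bits * tree_edges d q0 b0 q \<le> (25 * LL) * (edge_const * L)"
      using last_bits(2) tree_edges_bound LL24 by (intro mult_mono) auto
    moreover have "t * real kg \<le> ((A0 + 4) * L) * (kg_const * LL)"
      using tL kg_bounds(2) L24 by (intro mult_mono) auto
    moreover have "((A0 + 4 + 26 * K) + (A0 + 4) + 100 * edge_const + kg_const * (A0 + 4)) * L * LL =
      LL * ((A0 + 4 + 26 * K) * L) + (A0 + 4) * L * LL + 4 * ((25 * LL) * (edge_const * L)) + ((A0 + 4) * L) * (kg_const * LL)"
      by (simp add: algebra_simps)
    ultimately show ?thesis unfolding eq by linarith
  qed
  ultimately show ?thesis by blast
qed

end

section \<open>Largeness of n and the order of the constants\<close>

lemma eventually_large: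
  "\<exists>n0. \<forall>n\<ge>n0. t \<le> real n \<and> t \<le> log 2 (real n) \<and> t \<le> log 2 (log 2 (real n)) \<and>
     t * (log 2 (log 2 (real n)))\<^sup>2 \<le> log 2 (real n)"
proof -
  have "filterlim (\<lambda>n :: nat. real n) at_top sequentially" by real_asymp
  then have 1: "eventually (\<lambda>n. t \<le> real n) sequentially" by (simp add: filterlim_at_top)
  have "filterlim (\<lambda>n :: nat. log 2 (real n)) at_top sequentially" by real_asymp
  then have 2: "eventually (\<lambda>n. t \<le> log 2 (real n)) sequentially" by (simp add: filterlim_at_top)
  have "filterlim (\<lambda>n :: nat. log 2 (log 2 (real n))) at_top sequentially" by real_asymp
  then have 3: "eventually (\<lambda>n. t \<le> log 2 (log 2 (real n))) sequentially" by (simp add: filterlim_at_top)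
  have "filterlim (\<lambda>n :: nat. log 2 (real n) / (log 2 (log 2 (real n)))\<^sup>2) at_top sequentially" by real_asymp
  then have 4: "eventually (\<lambda>n. t \<le> log 2 (real n) / (log 2 (log 2 (real n)))\<^sup>2) sequentially" by (simp add: filterlim_at_top)
  have "filterlim (\<lambda>n :: nat. log 2 (log 2 (real n))) at_top sequentially" by real_asymp
  then have 5: "eventually (\<lambda>n. 1 \<le> log 2 (log 2 (real n))) sequentially" by (simp add: filterlim_at_top)
  have "eventually (\<lambda>n. t \<le> real n \<and> t \<le> log 2 (real n) \<and> t \<le> log 2 (log 2 (real n)) \<and>
     t * (log 2 (log 2 (real n)))\<^sup>2 \<le> log 2 (real n)) sequentially"
    using 1 2 3 4 5
  proof eventually_elim
    case (elim n)
    then have "0 < (log 2 (log 2 (real n)))\<^sup>2" by simp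
    then show ?case using elim by (simp add: pos_le_divide_eq)
  qed
  then show ?thesis by (simp add: eventually_sequentially)
qed

text \<open>The additive constant is explicit here so that it visibly depends on \<open>d\<close>
  alone, whereas seed constant, width constant and \<open>n0\<close> are chosen after c, a and
  M.\<close>

lemma always_go_left_parameters:
  fixes d :: nat and c a M :: real
  assumes d: "d \<ge> 2" and c: "c > 1"
  shows "\<exists>(B :: real) (W :: real) (n0 :: nat). \<forall>(n :: nat) (N :: nat) (m :: nat) (U :: 'a set).
  n \<ge> n0 \<and> n = d * N \<and> (\<exists>l. N = 2 ^ l) \<and>
  n \<le> m \<and> real m \<le> M * real n \<and>
  finite U \<and> real (card U) \<le> real n powr a \<longrightarrow>
  (\<exists>(\<delta>1 :: real) (\<delta>2 :: real) (k :: nat) (kg :: nat) (w :: nat).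
    \<delta>1 > 0 \<and> \<delta>2 > 0 \<and> k \<ge> 1 \<and> kg \<ge> 1 \<and>
    real w \<le> W * (log 2 (real n))\<^sup>2 \<and>
    (\<exists>(H :: ('a \<Rightarrow> nat) pmf) (s :: nat).
       hash_family U n N \<delta>1 \<delta>2 w k kg H \<and> sampled_with_bits s H \<and>
       real s \<le> B * log 2 (real n) * log 2 (log 2 (real n))) \<and>
    (\<forall>(H :: ('a \<Rightarrow> nat) pmf) (xs :: 'a list).
       hash_family U n N \<delta>1 \<delta>2 w k kg H \<and>
       distinct xs \<and> set xs \<subseteq> U \<and> length xs = m \<longrightarrow>
       measure_pmf.prob (Pi_pmf {1..d} (\<lambda>_. undefined) (\<lambda>_. H))
         {h. real (agl_max_load d N h xs)
               \<le> log 2 (log 2 (real n)) / (real d * log 2 (phi d))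
                  + (12 * real d + 15) * (c + real m / real n)}
       \<ge> 1 - real n powr (- c)))"
proof -
  define M1 where "M1 = max M 1"
  define A0 where "A0 = nat \<lceil>a\<rceil>"
  obtain n0 where n0: "\<And>n. n \<ge> n0 \<Longrightarrow> agl_parameters.threshold d c M1 \<le> real n \<and>
    agl_parameters.threshold d c M1 \<le> log 2 (real n) \<and> agl_parameters.threshold d c M1 \<le> log 2 (log 2 (real n)) \<and>
    agl_parameters.threshold d c M1 * (log 2 (log 2 (real n)))\<^sup>2 \<le> log 2 (real n)"
    using eventually_large by blast
  let ?K = "agl_parameters.K c" and ?E = "agl_parameters.edge_const d c M1"
  show ?thesis
  proof (rule exI[of _ "(A0 + 4 + 26 * ?K) + (A0 + 4) + 100 * ?E + agl_parameters.kg_const d c M1 * (A0 + 4)"],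
      rule exI[of _ "2 * ?E + 4 * ?K"], rule exI[of _ n0], intro allI impI, elim conjE exE, goal_cases)
    case (1 n N m U l)
    then have hn: "n \<ge> n0" "n = d * N" "N = 2 ^ l" and hm: "n \<le> m" "real m \<le> M * real n"
      and hU: "finite U" "real (card U) \<le> real n powr a" by blast+
    have "M * real n \<le> M1 * real n" unfolding M1_def by (intro mult_right_mono) auto
    then have mM: "real m \<le> M1 * real n" using hm(2) by linarith
    interpret agl_parameters d c M1 n N m l
      by unfold_locales (use d c hn(2,3) hm(1) mM M1_def in simp_all)
    interpret agl_parameters_large d c M1 n N m l
      by unfold_locales (use n0[OF hn(1)] in \<open>auto simp: LL_def L_def\<close>)
    have Ln: "log 2 (real n) = L" by (simp add: L_def)
    have "real n powr a \<le> real n powr A0"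
      unfolding A0_def using n24 by (intro powr_mono) linarith+
    also have "\<dots> = real n ^ A0" using n24 by (intro powr_realpow) simp
    finally have UA: "real (card U) \<le> real n ^ A0" using hU(2) by linarith
    have tail: "measure_pmf.prob (Pi_pmf {1..d} (\<lambda>_. undefined) (\<lambda>_. H))
             {h. real (agl_max_load d N h xs) \<le> LL / (real d * log 2 (phi d)) + (12 * real d + 15) * (c + real m / real n)}
           \<ge> 1 - real n powr (- c)"
      if H: "hash_family U n N \<delta>1 \<delta>2 w k kg H" "distinct xs" "set xs \<subseteq> U" "length xs = m" for H xs
    proof -
      let ?\<Omega> = "Pi_pmf {1..d} (\<lambda>_. undefined) (\<lambda>_. H)" and ?V = "{h. v \<le> agl_max_load d N h xs}"
      have "1 - real n powr (- c) \<le> 1 - measure_pmf.prob ?\<Omega> ?V"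
        using max_load_tail[OF H(1) hU(1) H(2-4)] by simp
      also have "\<dots> = measure_pmf.prob ?\<Omega> (- ?V)"
        using measure_pmf.prob_compl[of ?V ?\<Omega>] by (simp add: Compl_eq_Diff_UNIV)
      also have "\<dots> \<le> measure_pmf.prob ?\<Omega>
        {h. real (agl_max_load d N h xs) \<le> LL / (real d * log 2 (phi d)) + (12 * real d + 15) * (c + real m / real n)}"
      proof (intro measure_pmf.finite_measure_mono)
        show "- ?V \<subseteq> {h. real (agl_max_load d N h xs) \<le> LL / (real d * log 2 (phi d)) + (12 * real d + 15) * (c + real m / real n)}"
        proof
          fix h assume "h \<in> - ?V"
          then have "agl_max_load d N h xs < v" by simp
          \<comment> \<open>Loads are integers, so staying below \<open>v\<close> gains a full
            unit.\<close>
          then have "real (agl_max_load d N h xs) \<le> real v - 1" by linarith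
          then show "h \<in> {h. real (agl_max_load d N h xs) \<le> LL / (real d * log 2 (phi d)) + (12 * real d + 15) * (c + real m / real n)}"
            using v_bound by simp
        qed
      qed simp
      finally show ?thesis .
    qed
    show ?case
      unfolding Ln
    proof (rule exI[of _ \<delta>1], rule exI[of _ \<delta>2], rule exI[of _ k], rule exI[of _ kg], rule exI[of _ w],
        intro conjI allI impI)
      show "\<delta>1 > 0" "\<delta>2 > 0" by (simp_all add: \<delta>1_def \<delta>2_def)
      show "k \<ge> 1" "kg \<ge> 1" by (rule k_bounds kg_bounds)+
      show "real w \<le> (2 * ?E + 4 * ?K) * L\<^sup>2" by (rule w_bound)
      show "\<exists>(H :: ('a \<Rightarrow> nat) pmf) (s :: nat).
           hash_family U n N \<delta>1 \<delta>2 w k kg H \<and> sampled_with_bits s H \<and>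
           real s \<le> ((A0 + 4 + 26 * ?K) + (A0 + 4) + 100 * ?E + agl_parameters.kg_const d c M1 * (A0 + 4)) * L * log 2 L"
        unfolding LL_def[symmetric] by (rule hash_family_exists[OF hU(1) UA])
      show "measure_pmf.prob (Pi_pmf {1..d} (\<lambda>_. undefined) (\<lambda>_. H))
             {h. real (agl_max_load d N h xs)
                   \<le> log 2 L / (real d * log 2 (phi d)) + (12 * real d + 15) * (c + real m / real n)}
           \<ge> 1 - real n powr (- c)"
        if "hash_family U n N \<delta>1 \<delta>2 w k kg H \<and> distinct xs \<and> set xs \<subseteq> U \<and> length xs = m" for H xs
        unfolding LL_def[symmetric] using that by (intro tail) auto
    qed
  qed
qed

theorem theorem6p3:
  fixes d :: nat
  assumes "d \<ge> 2"
  shows "(\<exists>!\<phi>. is_phi d \<phi>) \<and> 161 / 100 < phi d \<and> phi d < 2 \<and>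
    (\<exists>C :: real. \<forall>(c :: real) (a :: real) (M :: real). c > 1 \<longrightarrow>
      (\<exists>(B :: real) (W :: real) (n0 :: nat). \<forall>(n :: nat) (N :: nat) (m :: nat) (U :: 'a set).
        n \<ge> n0 \<and> n = d * N \<and> (\<exists>l. N = 2 ^ l) \<and>
        n \<le> m \<and> real m \<le> M * real n \<and>
        finite U \<and> real (card U) \<le> real n powr a \<longrightarrow>
        (\<exists>(\<delta>1 :: real) (\<delta>2 :: real) (k :: nat) (kg :: nat) (w :: nat).
          \<delta>1 > 0 \<and> \<delta>2 > 0 \<and> k \<ge> 1 \<and> kg \<ge> 1 \<and>
          real w \<le> W * (log 2 (real n))\<^sup>2 \<and>
          (\<exists>(H :: ('a \<Rightarrow> nat) pmf) (s :: nat).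
             hash_family U n N \<delta>1 \<delta>2 w k kg H \<and> sampled_with_bits s H \<and>
             real s \<le> B * log 2 (real n) * log 2 (log 2 (real n))) \<and>
          (\<forall>(H :: ('a \<Rightarrow> nat) pmf) (xs :: 'a list).
             hash_family U n N \<delta>1 \<delta>2 w k kg H \<and>
             distinct xs \<and> set xs \<subseteq> U \<and> length xs = m \<longrightarrow>
             measure_pmf.prob (Pi_pmf {1..d} (\<lambda>_. undefined) (\<lambda>_. H))
               {h. real (agl_max_load d N h xs)
                     \<le> log 2 (log 2 (real n)) / (real d * log 2 (phi d))
                        + C * (c + real m / real n)}
             \<ge> 1 - real n powr (- c)))))"
  by (intro conjI phi_bounds[OF assms] exI[of _ "12 * real d + 15"])
    (intro allI impI, rule always_go_left_parameters[OF assms])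

end
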